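(* Let $T>0$, $p\in[1,\infty)$ and let $b:[0,T]\times\mathbb{R}^d\times\mathcal{P}_p(\mathbb{R}^d)\to\mathbb{R}^d$ be a measurable function for which there is a constant $K_b$ such that $|b(t,x,\mu)-b(t,x',\mu')|^p\le K_b(|x-x'|^p+\mathcal{W}_{\mathbb{R}^d,p}(\mu,\mu')^p)$ for all $t\in[0,T]$, $x,x'\in\mathbb{R}^d$, $\mu,\mu'\in\mathcal{P}_p(\mathbb{R}^d)$. Let $(\Omega,\mathcal{A},\mathbb{P})$ be a probability space. For each $N\in\mathbb{N}$, let $(\zeta^{(N)},W^{(N)})=(\zeta^{i,N},W^{i,N})_{1\le i\le N}:\Omega\to(\mathbb{R}^d\times C_T)^N$ be a family of random variables. Let $\bar\zeta\in L^p(\Omega,\mathbb{R}^d)$ and $\bar W\in L^p(\Omega,C_T)$. Then: (i) For every $\omega\in\Omega$, there exists a unique pathwise solution $X^{(N)}(\omega)=(X^{1,N}(\omega),\dots,X^{N,N}(\omega))$ to the interacting particle system $$dX^{i,N}_t=b\Big(t,X^{i,N}_t,\tfrac1N\sum_{j=1}^N\delta_{X^{j,N}_t}\Big)dt+dW^{i,N}_t,\qquad X^{i,N}_0=\zeta^{i,N},\qquad i=1,\dots,N.$$ Moreover, $\omega\mapsto X^{(N)}(\omega)$ is $\mathcal{A}$-measurable. (ii) There exists a unique pathwise solution $\bar X$ to the McKean-Vlasov equation $$d\bar X_t=b(t,\bar X_t,\mathcal{L}(\bar X_t))\,dt+d\bar W_t,\qquad \bar X_0=\bar\zeta.$$ (iii)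 There exists a constant $C$ depending on $b$ such that for all $N\ge1$ and for $\mathbb{P}$-a.e. $\omega\in\Omega$, $$\mathcal{W}_{C_T,p}\big(L^N(X^{(N)}(\omega)),\mathcal{L}(\bar X)\big)^p\le C\,\mathcal{W}_{\mathbb{R}^d\times C_T,p}\big(L^N(\zeta^{(N)}(\omega),W^{(N)}(\omega)),\mathcal{L}(\bar\zeta,\bar W)\big)^p.$$
   Context: $C_T:=C([0,T],\mathbb{R}^d)$ carries the supremum norm $\|\cdot\|_\infty$, and $\mathbb{R}^d\times C_T$ a product norm, e.g. $|x|+\|\gamma\|_\infty$. For a separable Banach space $E$, $\mathcal{P}_p(E)$ is the set of Borel probability measures on $E$ with finite $p$-th moment and $\mathcal{W}_{E,p}(\mu,\nu)^p=\inf_{m\in\Gamma(\mu,\nu)}\iint\|x-y\|_E^p\,m(dx,dy)$ the $p$-Wasserstein metric ($\Gamma(\mu,\nu)$ = couplings). $\mathcal{L}(Y)$ is the law of $Y$. For $y^{(N)}=(y^1,\dots,y^N)\in E^N$, $L^N(y^{(N)}):=\frac1N\sum_{i=1}^N\delta_{y^i}$. Equations are understood pathwise, in integrated form. For the particle system at fixed $\omega$: $X^{(N)}(\omega)\in C_T^N$ and, for all $t\in[0,T]$ and all $i$, $X^{i,N}_t(\omega)=\zeta^{i,N}(\omega)+\int_0^t b(s,X^{i,N}_s(\omega),L^N(X^{(N)}_s(\omega)))\,ds+W^{i,N}_t(\omega)$. For the McKean-Vlasov equation: $\bar X:\Omega\to C_T$ is a random variable such that for a.e. $\omega$ and all $t$,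 $\bar X_t(\omega)=\bar\zeta(\omega)+\int_0^t b(s,\bar X_s(\omega),\mathcal{L}(\bar X_s))\,ds+\bar W_t(\omega)$; uniqueness is up to almost sure equality. No independence, exchangeability or filtration is assumed.
   Formalization: It is additionally assumed that t ↦ b(t,0,δ_0) is Lebesgue integrable on [0,T]; without this the claim fails (e.g. d=1, b(t,x,μ)=1/t for t>0, b(0,x,μ)=0 has no solution), and existence in (i) for a single ω forces it. *)

theory Defs
  imports "HOL-Probability.Probability"
begin

definition borel_metric :: "'a metric \<Rightarrow> 'a measure" where
  "borel_metric m = sigma (mspace m) {U. openin (mtopology_of m) U}"

lemma borel_metric_euclidean: "borel_metric euclidean_metric = borel"
  by (simp add: borel_metric_def borel_def)

text \<open>The space of continuous paths on \<open>[0,T]\<close> with the supremum metric. Its elements are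
  functions on the reals that are \<open>undefined\<close> outside of \<open>[0,T]\<close>, so that equality of elements
  is equality on \<open>[0,T]\<close>.\<close>

definition path_metric :: "real \<Rightarrow> (real \<Rightarrow> 'a::real_normed_vector) metric" where
  "path_metric T = cfunspace (top_of_set {0..T}) euclidean_metric"

abbreviation path_borel :: "real \<Rightarrow> (real \<Rightarrow> 'a::real_normed_vector) measure" where
  "path_borel T \<equiv> borel_metric (path_metric T)"

definition sup_norm :: "real \<Rightarrow> (real \<Rightarrow> 'a::real_normed_vector) \<Rightarrow> real" where
  "sup_norm T x = (SUP t\<in>{0..T}. norm (x t))"

lemma mspace_path_metric:
  "mspace (path_metric T) = {x. continuous_on {0..T} x \<and> x \<in> extensional {0..T}}"
proof -
  have "bounded (x ` {0..T})" if "continuous_on {0..T} x" for x :: "real \<Rightarrow> 'a"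
    using that by (intro compact_imp_bounded compact_continuous_image) auto
  then show ?thesis
    by (auto simp: path_metric_def cfunspace_def Met_TC.fspace_def)
qed

lemma mdist_path_metric:
  assumes "T \<ge> 0" "x \<in> mspace (path_metric T)" "y \<in> mspace (path_metric T)"
  shows "mdist (path_metric T) x y = sup_norm T (\<lambda>t. x t - y t)"
  using assms
  by (auto simp: path_metric_def cfunspace_def Met_TC.fdist_def sup_norm_def dist_norm)

text \<open>The space \<open>\<real>\<^sup>d \<times> C([0,T],\<real>\<^sup>d)\<close> with the norm \<open>sqrt (|x|\<^sup>2 + \<parallel>\<gamma>\<parallel>\<^sup>2)\<close>, where
  \<open>\<parallel>\<gamma>\<parallel>\<close> is the supremum norm.\<close>

abbreviation input_metric :: "real \<Rightarrow> ('a \<times> (real \<Rightarrow> 'a::real_normed_vector)) metric" where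
  "input_metric T \<equiv> prod_metric euclidean_metric (path_metric T)"

definition couplings :: "'a measure \<Rightarrow> 'a measure \<Rightarrow> ('a \<times> 'a) measure set" where
  "couplings \<mu> \<nu> = {\<gamma>. sets \<gamma> = sets (\<mu> \<Otimes>\<^sub>M \<nu>) \<and> distr \<gamma> \<mu> fst = \<mu> \<and> distr \<gamma> \<nu> snd = \<nu>}"

text \<open>The value is meaningful for probability measures with finite \<open>p\<close>-th moment, for which
  the infimum is finite. On separable spaces the product sigma-algebra of the couplings is the
  Borel sigma-algebra of the product.\<close>

definition wasserstein :: "real \<Rightarrow> 'a metric \<Rightarrow> 'a measure \<Rightarrow> 'a measure \<Rightarrow> real" where
  "wasserstein p m \<mu> \<nu> =
     enn2real (INF \<gamma>\<in>couplings \<mu> \<nu>. \<integral>\<^sup>+(x, y). ennreal (mdist m x y powr p) \<partial>\<gamma>) powr (1 / p)"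

definition wasserstein_space :: "real \<Rightarrow> 'a::euclidean_space measure set" where
  "wasserstein_space p =
     {\<mu>. sets \<mu> = sets borel \<and> prob_space \<mu> \<and> integrable \<mu> (\<lambda>x. norm x powr p)}"

text \<open>The Borel sigma-algebra of the metric space \<open>wasserstein_space p\<close>. The predicate
  \<open>Metric_space.mopen\<close> is openness with respect to balls and presupposes no metric axioms.\<close>

definition wasserstein_borel :: "real \<Rightarrow> 'a::euclidean_space measure measure" where
  "wasserstein_borel p =
     sigma (wasserstein_space p)
       {U. Metric_space.mopen (wasserstein_space p) (wasserstein p euclidean_metric) U}"

text \<open>The measure \<open>1/N \<Sum>\<^sub>i \<delta>\<^bsub>y i\<^esub>\<close>, as the image of the uniform distribution on the indices.\<close>

definition empirical :: "'a measure \<Rightarrow> nat \<Rightarrow> (nat \<Rightarrow> 'a) \<Rightarrow> 'a measure" where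
  "empirical S N y = distr (uniform_count_measure {1..N}) S y"

lemma emeasure_empirical:
  assumes "N \<ge> 1" "\<And>i. i \<in> {1..N} \<Longrightarrow> y i \<in> space S" "A \<in> sets S"
  shows "emeasure (empirical S N y) A = ennreal ((\<Sum>i=1..N. indicator A (y i)) / real N)"
proof -
  have y: "y \<in> uniform_count_measure {1..N} \<rightarrow>\<^sub>M S"
    using assms(2) by (auto simp: measurable_def sets_uniform_count_measure space_uniform_count_measure)
  have "(\<Sum>i=1..N. indicator A (y i)) = (\<Sum>i\<in>{1..N}. indicator (y -` A \<inter> {1..N}) i :: real)"
    by (intro sum.cong) (auto simp: indicator_def)
  also have "\<dots> = real (card (y -` A \<inter> {1..N}))"
    by (simp add: indicator_def sum.If_cases vimage_def Int_commute)
  finally have "(\<Sum>i=1..N. indicator A (y i)) = real (card (y -` A \<inter> {1..N}))" .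
  moreover have "emeasure (empirical S N y) A = ennreal (card (y -` A \<inter> {1..N}) / real N)"
    unfolding empirical_def emeasure_distr[OF y assms(3)] space_uniform_count_measure
    using emeasure_uniform_count_measure[of "{1..N}" "y -` A \<inter> {1..N}"] by simp
  ultimately show ?thesis
    by simp
qed

text \<open>A Bochner integral of a non-integrable function is \<open>0\<close> by convention, hence
  integrability of the drift is part of both notions of solution.\<close>

definition particle_solution ::
  "real \<Rightarrow> (real \<Rightarrow> 'a::euclidean_space \<Rightarrow> 'a measure \<Rightarrow> 'a) \<Rightarrow> nat
    \<Rightarrow> (nat \<Rightarrow> 'a) \<Rightarrow> (nat \<Rightarrow> real \<Rightarrow> 'a) \<Rightarrow> (nat \<Rightarrow> real \<Rightarrow> 'a) \<Rightarrow> bool" where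
  "particle_solution T b N z w x \<longleftrightarrow>
     x \<in> {1..N} \<rightarrow>\<^sub>E mspace (path_metric T) \<and>
     (\<forall>i\<in>{1..N}. \<forall>t\<in>{0..T}.
        set_integrable lborel {0..t} (\<lambda>s. b s (x i s) (empirical borel N (\<lambda>j. x j s))) \<and>
        x i t = z i + (LBINT s:{0..t}. b s (x i s) (empirical borel N (\<lambda>j. x j s))) + w i t)"

definition the_particle_solution ::
  "real \<Rightarrow> (real \<Rightarrow> 'a::euclidean_space \<Rightarrow> 'a measure \<Rightarrow> 'a) \<Rightarrow> nat
    \<Rightarrow> (nat \<Rightarrow> 'a) \<Rightarrow> (nat \<Rightarrow> real \<Rightarrow> 'a) \<Rightarrow> nat \<Rightarrow> real \<Rightarrow> 'a" where
  "the_particle_solution T b N z w = (THE x. particle_solution T b N z w x)"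

text \<open>The time marginals have to lie in \<open>wasserstein_space p\<close>, the domain of the last
  argument of \<open>b\<close>.\<close>

definition mckean_vlasov_solution ::
  "real \<Rightarrow> real \<Rightarrow> (real \<Rightarrow> 'a::euclidean_space \<Rightarrow> 'a measure \<Rightarrow> 'a) \<Rightarrow> 'w measure
    \<Rightarrow> ('w \<Rightarrow> 'a) \<Rightarrow> ('w \<Rightarrow> real \<Rightarrow> 'a) \<Rightarrow> ('w \<Rightarrow> real \<Rightarrow> 'a) \<Rightarrow> bool" where
  "mckean_vlasov_solution p T b M \<zeta> W X \<longleftrightarrow>
     X \<in> M \<rightarrow>\<^sub>M path_borel T \<and>
     (\<forall>t\<in>{0..T}. distr M borel (\<lambda>\<omega>. X \<omega> t) \<in> wasserstein_space p) \<and>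
     (AE \<omega> in M. \<forall>t\<in>{0..T}.
        set_integrable lborel {0..t} (\<lambda>s. b s (X \<omega> s) (distr M borel (\<lambda>\<omega>'. X \<omega>' s))) \<and>
        X \<omega> t = \<zeta> \<omega> + (LBINT s:{0..t}. b s (X \<omega> s) (distr M borel (\<lambda>\<omega>'. X \<omega>' s))) + W \<omega> t)"

end

theory Submission
  imports Defs
begin

text \<open>The particle system is the McKean-Vlasov equation on the uniform probability space \<open>{1..N}\<close>,
  so existence, uniqueness and stability are proved only once, for the McKean-Vlasov equation on an
  arbitrary probability space. In the supremum norm with weight \<open>exp (- rate * t)\<close> the drift is a
  contraction in both the path and the flow of laws, hence the Picard iteration converges and two
  solutions on a common space satisfy
  \<open>E \<parallel>X - Y\<parallel>\<^sup>p \<le> C * E (\<bar>\<zeta> - \<zeta>'\<bar> + \<parallel>W - W'\<parallel>)\<^sup>p\<close>. On the canonical space a solution is a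
  function of its input, so every coupling of two input laws induces a coupling of the laws of the
  solutions, and the stability estimate bounds its cost.\<close>

section \<open>Paths and Borel sets of metric spaces\<close>

text \<open>For fixed \<omega> the particles live on {1..N} and the limit on \<Omega>, so no
  pathwise difference of the two is available; a coupling of the input laws supplies the common
  space, and pathwise uniqueness ensures that solutions constructed there have the right laws. The
  resulting constant involves T, p and the Lipschitz constant only, not N, \<omega> or the laws.

  Two questions of measurability shape the rest. The drift is merely Borel in (t, x, \<mu>), so
  along a path and a flow of laws it is measurable in time only if the flow is measurable into the
  Wasserstein space. This is deduced from continuity of the flow and forces a proof of the metric
  axioms for W_p, including the triangle inequality. Measurability of the particle solution in
  \<omega>, where the solution is given by a definite description, follows from its continuous
  dependence on the inputs, because the space of inputs is separable.\<close>

lemma powr_add_le: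
  fixes a b p :: real
  assumes "a \<ge> 0" "b \<ge> 0" "p \<ge> 0"
  shows "(a + b) powr p \<le> 2 powr p * (a powr p + b powr p)"
proof -
  have "(a + b) powr p \<le> (2 * max a b) powr p"
    using assms by (intro powr_mono2) auto
  also have "\<dots> = 2 powr p * max a b powr p"
    using assms by (simp add: powr_mult)
  also have "max a b powr p \<le> a powr p + b powr p"
    by (simp add: max_def)
  finally show ?thesis
    by simp
qed

abbreviation sup_dist :: "real \<Rightarrow> (real \<Rightarrow> 'a::real_normed_vector) \<Rightarrow> (real \<Rightarrow> 'a) \<Rightarrow> real" where
  "sup_dist T x y \<equiv> sup_norm T (\<lambda>t. x t - y t)"

lemma continuous_on_imp_bdd_above_norm:
  fixes z :: "real \<Rightarrow> 'a::real_normed_vector"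
  assumes "continuous_on {0..T} z"
  shows "bdd_above ((\<lambda>t. norm (z t)) ` {0..T})"
  using assms
  by (intro bounded_imp_bdd_above compact_imp_bounded compact_continuous_image continuous_on_norm)
    auto

lemma norm_le_sup_norm:
  assumes "continuous_on {0..T} z" "t \<in> {0..T}"
  shows "norm (z t) \<le> sup_norm T z"
  unfolding sup_norm_def
  using assms continuous_on_imp_bdd_above_norm by (intro cSUP_upper) auto

lemma sup_norm_le:
  assumes "T \<ge> 0" "\<And>t. t \<in> {0..T} \<Longrightarrow> norm (z t) \<le> B"
  shows "sup_norm T z \<le> B"
  unfolding sup_norm_def using assms by (intro cSUP_least) auto

lemma sup_norm_nonneg:
  assumes "T \<ge> 0" "continuous_on {0..T} z"
  shows "sup_norm T z \<ge> 0"
  using order_trans[OF norm_ge_zero norm_le_sup_norm[OF assms(2), of 0]] assms(1) by simp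

text \<open>By continuity the supremum over [0,T] is already attained as a supremum over a countable
  dense set of times, so measurability at single times is enough.\<close>

lemma borel_measurable_sup_norm:
  fixes Z :: "'w \<Rightarrow> real \<Rightarrow> 'a::{real_normed_vector,second_countable_topology}"
  assumes T: "T \<ge> 0"
    and cont: "\<And>\<omega>. \<omega> \<in> space M \<Longrightarrow> continuous_on {0..T} (Z \<omega>)"
    and meas: "\<And>t. t \<in> {0..T} \<Longrightarrow> (\<lambda>\<omega>. Z \<omega> t) \<in> borel_measurable M"
  shows "(\<lambda>\<omega>. sup_norm T (Z \<omega>)) \<in> borel_measurable M"
proof -
  obtain D where D: "countable D" "D \<subseteq> {0..T}" "{0..T} \<subseteq> closure D"
    using separable[of "{0..T}"] by metis
  have clD: "closure D = {0..T}"
    using D by (intro antisym closure_minimal) auto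
  have "{\<omega> \<in> space M. sup_norm T (Z \<omega>) \<le> a} \<in> sets M" for a
  proof -
    have "{\<omega> \<in> space M. sup_norm T (Z \<omega>) \<le> a} = {\<omega> \<in> space M. \<forall>t\<in>D. norm (Z \<omega> t) \<le> a}"
    proof (intro Collect_cong conj_cong refl iffI ballI)
      fix \<omega> t assume "\<omega> \<in> space M" "sup_norm T (Z \<omega>) \<le> a" "t \<in> D"
      then show "norm (Z \<omega> t) \<le> a"
        using norm_le_sup_norm[OF cont, of \<omega> t] D by auto
    next
      fix \<omega> assume \<omega>: "\<omega> \<in> space M" "\<forall>t\<in>D. norm (Z \<omega> t) \<le> a"
      show "sup_norm T (Z \<omega>) \<le> a"
      proof (rule sup_norm_le[OF T])
        fix t assume "t \<in> {0..T}"
        then show "norm (Z \<omega> t) \<le> a"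
          using continuous_on_closure_norm_le[of D "Z \<omega>" a t] \<omega> cont clD by auto
      qed
    qed
    also have "\<dots> \<in> sets M"
    proof (rule sets.sets_Collect_countable_All'[OF _ D(1)])
      fix t assume "t \<in> D"
      then have [measurable]: "(\<lambda>\<omega>. Z \<omega> t) \<in> borel_measurable M"
        using meas D by auto
      show "{\<omega> \<in> space M. norm (Z \<omega> t) \<le> a} \<in> sets M"
        by measurable
    qed
    finally show ?thesis .
  qed
  then show ?thesis
    by (simp add: borel_measurable_iff_le)
qed

section \<open>Borel sigma-algebras of metric spaces\<close>

lemma openin_subset_Pow: "{U. openin (mtopology_of m) U} \<subseteq> Pow (mspace m)"
  using openin_subset[of "mtopology_of m"] by auto

lemma space_borel_metric [simp]: "space (borel_metric m) = mspace m"
  unfolding borel_metric_def using openin_subset_Pow by (rule space_measure_of)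

lemma sets_borel_metric: "sets (borel_metric m) = sigma_sets (mspace m) {U. openin (mtopology_of m) U}"
  unfolding borel_metric_def using openin_subset_Pow by (rule sets_measure_of)

lemma openin_in_sets_borel_metric: "openin (mtopology_of m) U \<Longrightarrow> U \<in> sets (borel_metric m)"
  by (auto simp: sets_borel_metric)

lemma measurable_borel_metric_continuous_map:
  assumes "continuous_map (mtopology_of m1) (mtopology_of m2) f"
  shows "f \<in> borel_metric m1 \<rightarrow>\<^sub>M borel_metric m2"
  unfolding borel_metric_def[of m2]
proof (rule measurable_measure_of[OF openin_subset_Pow])
  show "f \<in> space (borel_metric m1) \<rightarrow> mspace m2"
    using continuous_map_funspace[OF assms] by simp
  fix U assume "U \<in> {U. openin (mtopology_of m2) U}"
  then have "openin (mtopology_of m1) {x \<in> topspace (mtopology_of m1). f x \<in> U}"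
    using assms openin_continuous_map_preimage by blast
  moreover have "{x \<in> topspace (mtopology_of m1). f x \<in> U} = f -` U \<inter> space (borel_metric m1)"
    by auto
  ultimately show "f -` U \<inter> space (borel_metric m1) \<in> sets (borel_metric m1)"
    by (simp add: openin_in_sets_borel_metric)
qed

lemma measurable_borel_metric_Lipschitz:
  "Lipschitz_continuous_map m1 m2 f \<Longrightarrow> f \<in> borel_metric m1 \<rightarrow>\<^sub>M borel_metric m2"
  by (intro measurable_borel_metric_continuous_map Lipschitz_continuous_imp_continuous_map)

lemma separable_space_mtopology_of_iff:
  "separable_space (mtopology_of m) \<longleftrightarrow>
    (\<exists>D. countable D \<and> D \<subseteq> mspace m \<and> (\<forall>x\<in>mspace m. \<forall>r>0. \<exists>d\<in>D. mdist m x d < r))"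
proof -
  interpret Metric_space "mspace m" "mdist m" by simp
  have "mtopology closure_of D = mspace m \<longleftrightarrow> (\<forall>x\<in>mspace m. \<forall>r>0. \<exists>d\<in>D. mdist m x d < r)"
    if "D \<subseteq> mspace m" for D
    using that by (fastforce simp: metric_closure_of)
  then show ?thesis
    by (auto simp: separable_space_def mtopology_of_def)
qed

text \<open>In a separable space an open set is a countable union of balls with centres in a dense
  set, and preimages of balls are sublevel sets of distance functions.\<close>

lemma measurable_borel_metricI:
  assumes sep: "separable_space (mtopology_of m)"
    and f: "f \<in> space M \<rightarrow> mspace m"
    and dist: "\<And>y. y \<in> mspace m \<Longrightarrow> (\<lambda>\<omega>. mdist m y (f \<omega>)) \<in> borel_measurable M"
  shows "f \<in> M \<rightarrow>\<^sub>M borel_metric m"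
  unfolding borel_metric_def
proof (rule measurable_measure_of[OF openin_subset_Pow f])
  interpret Metric_space "mspace m" "mdist m" by simp
  obtain D where D: "countable D" "D \<subseteq> mspace m"
    "\<And>x r. x \<in> mspace m \<Longrightarrow> r > 0 \<Longrightarrow> \<exists>d\<in>D. mdist m x d < r"
    using sep unfolding separable_space_mtopology_of_iff by metis
  fix U assume "U \<in> {U. openin (mtopology_of m) U}"
  then have U: "openin mtopology U"
    by (simp add: mtopology_of_def)
  define P where "P = {(d, n). d \<in> D \<and> mball d (1 / real (Suc n)) \<subseteq> U}"
  have "countable P"
    by (rule countable_subset[of _ "D \<times> UNIV"]) (auto simp: P_def D)
  have ball: "{\<omega> \<in> space M. mdist m d (f \<omega>) < r} \<in> sets M" if "d \<in> D" for d r
  proof -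
    have [measurable]: "(\<lambda>\<omega>. mdist m d (f \<omega>)) \<in> borel_measurable M"
      using dist D that by auto
    show ?thesis by measurable
  qed
  have "f -` U \<inter> space M = (\<Union>(d, n)\<in>P. {\<omega> \<in> space M. mdist m d (f \<omega>) < 1 / real (Suc n)})"
  proof (intro equalityI subsetI)
    fix \<omega> assume \<omega>: "\<omega> \<in> f -` U \<inter> space M"
    then obtain r where r: "r > 0" "mball (f \<omega>) r \<subseteq> U"
      using U by (auto simp: openin_mtopology)
    \<comment> \<open>Half of \<open>r\<close>, because the radius is used twice: once from
      \<open>f \<omega>\<close> to the centre \<open>d\<close> and once inside the ball around
      \<open>d\<close>.\<close>
    obtain n where n: "1 / real (Suc n) < r / 2"
      using reals_Archimedean[of "r / 2"] r(1) by (auto simp: inverse_eq_divide)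
    obtain d where d: "d \<in> D" "mdist m (f \<omega>) d < 1 / real (Suc n)"
      using D(3)[of "f \<omega>" "1 / real (Suc n)"] f \<omega> by auto
    have "mball d (1 / real (Suc n)) \<subseteq> mball (f \<omega>) r"
    proof
      fix y assume y: "y \<in> mball d (1 / real (Suc n))"
      then have "mdist m (f \<omega>) y \<le> mdist m (f \<omega>) d + mdist m d y"
        using triangle f \<omega> d D by auto
      then show "y \<in> mball (f \<omega>) r"
        using y d n f \<omega> by auto
    qed
    then have "(d, n) \<in> P"
      using r d by (auto simp: P_def)
    then show "\<omega> \<in> (\<Union>(d, n)\<in>P. {\<omega> \<in> space M. mdist m d (f \<omega>) < 1 / real (Suc n)})"
      using d \<omega> commute[of "f \<omega>" d] by auto
  next
    fix \<omega> assume "\<omega> \<in> (\<Union>(d, n)\<in>P. {\<omega> \<in> space M. mdist m d (f \<omega>) < 1 / real (Suc n)})"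
    then obtain d n where dn: "d \<in> D" "mball d (1 / real (Suc n)) \<subseteq> U" "\<omega> \<in> space M"
      "mdist m d (f \<omega>) < 1 / real (Suc n)"
      by (auto simp: P_def)
    then have "f \<omega> \<in> mball d (1 / real (Suc n))"
      using D(2) f by auto
    with dn show "\<omega> \<in> f -` U \<inter> space M"
      by auto
  qed
  also have "\<dots> \<in> sets M"
    using \<open>countable P\<close> ball by (intro sets.countable_UN') (auto simp: P_def)
  finally show "f -` U \<inter> space M \<in> sets M" .
qed

section \<open>Separability and measurability of path space\<close>

lemma mspace_path_metric_iff:
  "x \<in> mspace (path_metric T) \<longleftrightarrow> continuous_on {0..T} x \<and> x \<in> extensional {0..T}"
  by (simp add: mspace_path_metric)

lemma path_metric_eqI:
  assumes "x \<in> mspace (path_metric T)" "y \<in> mspace (path_metric T)"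
    and "\<And>t. t \<in> {0..T} \<Longrightarrow> x t = y t"
  shows "x = y"
  using assms by (auto simp: mspace_path_metric_iff intro: extensionalityI)

lemma restrict_in_path_metric:
  "continuous_on {0..T} x \<Longrightarrow> restrict x {0..T} \<in> mspace (path_metric T)"
  by (simp add: mspace_path_metric_iff cong: continuous_on_cong_simp)

text \<open>Uniform continuity lets step functions with values in a countable dense set approximate
  every path; a path close to each step function is then chosen.\<close>

lemma separable_space_path_metric:
  fixes T :: real
  assumes T: "T \<ge> 0"
  shows "separable_space (mtopology_of
    (path_metric T :: (real \<Rightarrow> 'a::{real_normed_vector,second_countable_topology}) metric))"
proof -
  let ?m = "path_metric T :: (real \<Rightarrow> 'a) metric"
  obtain D :: "'a set" where D: "countable D" "\<And>U. open U \<Longrightarrow> U \<noteq> {} \<Longrightarrow> \<exists>d\<in>D. d \<in> U"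
    using countable_dense_exists by metis
  \<comment> \<open>A triple consists of a mesh 1/(n+1), an accuracy 1/(j+1) and the list of values
    of a step function. With values in \<open>D\<close> there are countably many triples.\<close>
  define S where "S = (\<lambda>(n::nat, j::nat, xs). {y \<in> mspace ?m.
    \<forall>t\<in>{0..T}. norm (y t - xs ! nat \<lfloor>real (Suc n) * t\<rfloor>) \<le> 1 / real (Suc j)})"
  define Q where "Q = {q \<in> UNIV \<times> UNIV \<times> lists D. S q \<noteq> {}}"
  define y where "y q = (SOME y. y \<in> S q)" for q
  have y: "y q \<in> S q" if "q \<in> Q" for q
    using that unfolding y_def Q_def by (simp add: some_in_eq)
  have "countable (y ` Q)"
    using D(1) by (auto simp: Q_def intro!: countable_image countable_Collect)
  moreover have "y ` Q \<subseteq> mspace ?m"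
    using y by (force simp: S_def split: prod.splits)
  moreover have "\<exists>d\<in>y ` Q. mdist ?m x d < r" if x: "x \<in> mspace ?m" and r: "r > 0" for x r
  proof -
    obtain j where j: "1 / real (Suc j) < r / 2"
      using reals_Archimedean[of "r / 2"] r by (auto simp: inverse_eq_divide)
    define e where "e = 1 / (2 * real (Suc j))"
    have e: "e > 0" "e + e = 1 / real (Suc j)"
      by (simp_all add: e_def field_simps)
    have "uniformly_continuous_on {0..T} x"
      using x by (intro compact_uniformly_continuous) (auto simp: mspace_path_metric_iff)
    then obtain \<delta> where \<delta>: "\<delta> > 0"
      "\<And>s t. s \<in> {0..T} \<Longrightarrow> t \<in> {0..T} \<Longrightarrow> dist s t < \<delta> \<Longrightarrow> dist (x s) (x t) < e"
      using e(1) unfolding uniformly_continuous_on_def by metis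
    obtain n where n: "1 / real (Suc n) < \<delta>"
      using reals_Archimedean[of \<delta>] \<delta> by (auto simp: inverse_eq_divide)
    define n' where "n' = real (Suc n)"
    have n': "n' > 0" "1 / n' < \<delta>"
      using n by (auto simp: n'_def)
    have "\<exists>d\<in>D. dist (x (real k / n')) d < e" for k
      using D(2)[of "ball (x (real k / n')) e"] e by auto
    then obtain v where v: "\<And>k. v k \<in> D" "\<And>k. dist (x (real k / n')) (v k) < e"
      by metis
    \<comment> \<open>The time \<open>T\<close> itself falls into the cell with number
      \<open>nat \<lfloor>n' * T\<rfloor>\<close>, hence the \<open>Suc\<close> in the length of the
      list.\<close>
    define xs where "xs = map v [0..<Suc (nat \<lfloor>n' * T\<rfloor>)]"
    have near: "norm (x t - xs ! nat \<lfloor>n' * t\<rfloor>) \<le> 1 / real (Suc j)" if t: "t \<in> {0..T}" for t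
    proof -
      define k where "k = nat \<lfloor>n' * t\<rfloor>"
      have "k \<le> nat \<lfloor>n' * T\<rfloor>"
        unfolding k_def using t n' by (intro nat_mono floor_mono mult_left_mono) auto
      then have xs: "xs ! k = v k"
        by (simp add: xs_def del: upt_Suc)
      have "real k \<le> n' * t" "n' * t < real k + 1"
        unfolding k_def using t n' by (auto simp: of_nat_nat)
      then have k: "real k / n' \<le> t" "t < (real k + 1) / n'"
        using n' by (simp_all add: pos_divide_le_eq pos_less_divide_eq mult.commute)
      then have "t - real k / n' < 1 / n'"
        by (simp add: add_divide_distrib)
      with k n' have "dist (x t) (x (real k / n')) < e"
        using t by (intro \<delta>(2)) (auto simp: dist_real_def)
      then have "dist (x t) (v k) < e + e"
        using v(2)[of k] dist_triangle[of "x t" "v k" "x (real k / n')"] by linarith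
      then show ?thesis
        using xs e by (simp add: k_def dist_norm)
    qed
    have xS: "x \<in> S (n, j, xs)"
      using near x by (auto simp: S_def n'_def)
    have Q: "(n, j, xs) \<in> Q"
      using xS v by (auto simp: Q_def xs_def)
    have yS: "y (n, j, xs) \<in> S (n, j, xs)"
      using y[OF Q] .
    have "mdist ?m x (y (n, j, xs)) = sup_dist T x (y (n, j, xs))"
      using xS yS by (intro mdist_path_metric T) (auto simp: S_def)
    also have "\<dots> \<le> 1 / real (Suc j) + 1 / real (Suc j)"
    proof (rule sup_norm_le[OF T])
      fix t assume t: "t \<in> {0..T}"
      let ?c = "xs ! nat \<lfloor>real (Suc n) * t\<rfloor>"
      have "norm (x t - ?c) \<le> 1 / real (Suc j)" "norm (y (n, j, xs) t - ?c) \<le> 1 / real (Suc j)"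
        using xS yS t unfolding S_def by blast+
      moreover have "norm (x t - y (n, j, xs) t) \<le> norm (x t - ?c) + norm (y (n, j, xs) t - ?c)"
        using norm_triangle_ineq4[of "x t - ?c" "y (n, j, xs) t - ?c"] by simp
      ultimately show "norm (x t - y (n, j, xs) t) \<le> 1 / real (Suc j) + 1 / real (Suc j)"
        by linarith
    qed
    also have "\<dots> < r"
      using j by linarith
    finally show ?thesis
      using Q by blast
  qed
  ultimately show ?thesis
    unfolding separable_space_mtopology_of_iff by (intro exI[of _ "y ` Q"] conjI ballI allI impI)
qed

lemma borel_measurable_path_eval:
  fixes T :: real
  assumes "t \<in> {0..T}"
  shows "(\<lambda>x. x t) \<in> path_borel T \<rightarrow>\<^sub>M (borel :: 'a::euclidean_space measure)"
proof -
  have "Lipschitz_continuous_map (path_metric T) euclidean_metric (\<lambda>x. x t :: 'a)"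
    unfolding Lipschitz_continuous_map_def
  proof (intro conjI exI ballI)
    fix x y :: "real \<Rightarrow> 'a" assume xy: "x \<in> mspace (path_metric T)" "y \<in> mspace (path_metric T)"
    have "norm (x t - y t) \<le> sup_dist T x y"
      using assms xy
      by (intro norm_le_sup_norm[of T "\<lambda>t. x t - y t"] continuous_on_diff)
        (auto simp: mspace_path_metric_iff)
    then show "mdist euclidean_metric (x t) (y t) \<le> 1 * mdist (path_metric T) x y"
      using assms xy by (simp add: mdist_path_metric dist_norm)
  qed auto
  then show ?thesis
    using measurable_borel_metric_Lipschitz by (force simp: borel_metric_euclidean)
qed

lemma measurable_path_eval :
  fixes X :: "'w \<Rightarrow> real \<Rightarrow> 'a::euclidean_space"
  assumes "X \<in> M \<rightarrow>\<^sub>M path_borel T" "t \<in> {0..T}"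
  shows "(\<lambda>\<omega>. X \<omega> t) \<in> borel_measurable M"
  using measurable_compose[OF assms(1) borel_measurable_path_eval[OF assms(2)]] .

lemma measurable_path_borel_space:
  "X \<in> M \<rightarrow>\<^sub>M path_borel T \<Longrightarrow> \<omega> \<in> space M \<Longrightarrow> X \<omega> \<in> mspace (path_metric T)"
  using measurable_space[of X M "path_borel T" \<omega>] by simp

lemma measurable_path_borel_continuous:
  "X \<in> M \<rightarrow>\<^sub>M path_borel T \<Longrightarrow> \<omega> \<in> space M \<Longrightarrow> continuous_on {0..T} (X \<omega>)"
  using measurable_path_borel_space[of X M T \<omega>] by (simp add: mspace_path_metric_iff)

text \<open>The converse of \<open>measurable_path_eval\<close>: distances to a fixed path are
  measurable by \<open>borel_measurable_sup_norm\<close>, and separability passes from distances to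
  all Borel sets. Measurability of path-valued maps is thereby checked one time at a time.\<close>

lemma measurable_path_borelI:
  fixes X :: "'w \<Rightarrow> real \<Rightarrow> 'a::euclidean_space"
  assumes T: "T \<ge> 0"
    and X: "\<And>\<omega>. \<omega> \<in> space M \<Longrightarrow> X \<omega> \<in> mspace (path_metric T)"
    and meas: "\<And>t. t \<in> {0..T} \<Longrightarrow> (\<lambda>\<omega>. X \<omega> t) \<in> borel_measurable M"
  shows "X \<in> M \<rightarrow>\<^sub>M path_borel T"
proof (rule measurable_borel_metricI)
  show "X \<in> space M \<rightarrow> mspace (path_metric T)"
    using X by auto
  fix y :: "real \<Rightarrow> 'a" assume y: "y \<in> mspace (path_metric T)"
  have "(\<lambda>\<omega>. sup_dist T y (X \<omega>)) \<in> borel_measurable M"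
    using y X
    by (intro borel_measurable_sup_norm T borel_measurable_diff meas continuous_on_diff)
      (auto simp: mspace_path_metric_iff)
  then show "(\<lambda>\<omega>. mdist (path_metric T) y (X \<omega>)) \<in> borel_measurable M"
    using y X T by (simp add: mdist_path_metric cong: measurable_cong)
qed (rule separable_space_path_metric[OF T])

lemma borel_measurable_sup_norm_diff:
  fixes X Y :: "'w \<Rightarrow> real \<Rightarrow> 'a::euclidean_space"
  assumes "T \<ge> 0" "X \<in> M \<rightarrow>\<^sub>M path_borel T" "Y \<in> M \<rightarrow>\<^sub>M path_borel T"
  shows "(\<lambda>\<omega>. sup_dist T (X \<omega>) (Y \<omega>)) \<in> borel_measurable M"
  using assms
  by (intro borel_measurable_sup_norm borel_measurable_diff continuous_on_diff)
    (auto intro: measurable_path_borel_continuous measurable_path_eval)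

section \<open>The space of initial values and driving paths\<close>

lemma measurable_fst_input: "fst \<in> borel_metric (input_metric T) \<rightarrow>\<^sub>M borel"
  using measurable_borel_metric_Lipschitz[OF Lipschitz_continuous_map_projections(1), of euclidean_metric "path_metric T"]
  by (simp add: borel_metric_euclidean)

lemma measurable_snd_input: "snd \<in> borel_metric (input_metric T) \<rightarrow>\<^sub>M path_borel T"
  using measurable_borel_metric_Lipschitz[OF Lipschitz_continuous_map_projections(2), of euclidean_metric "path_metric T"]
  by simp

lemma separable_space_input_metric:
  fixes T :: real
  assumes T: "T \<ge> 0"
  shows "separable_space (mtopology_of (input_metric T :: ('a \<times> (real \<Rightarrow> 'a::euclidean_space)) metric))"
proof -
  let ?P = "path_metric T :: (real \<Rightarrow> 'a) metric"
  obtain C :: "'a set" where C: "countable C" "\<And>x r. r > 0 \<Longrightarrow> \<exists>d\<in>C. dist x d < r"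
  proof -
    obtain C :: "'a set" where C: "countable C" "\<And>U. open U \<Longrightarrow> U \<noteq> {} \<Longrightarrow> \<exists>d\<in>C. d \<in> U"
      using countable_dense_exists by metis
    have "\<exists>d\<in>C. dist x d < r" if "r > 0" for x r
      using C(2)[of "ball x r"] that by auto
    with C(1) that show ?thesis by blast
  qed
  obtain D where D: "countable D" "D \<subseteq> mspace ?P"
    "\<And>x r. x \<in> mspace ?P \<Longrightarrow> r > 0 \<Longrightarrow> \<exists>d\<in>D. mdist ?P x d < r"
    using separable_space_path_metric[OF T, where 'a='a]
    unfolding separable_space_mtopology_of_iff by metis
  show ?thesis
    unfolding separable_space_mtopology_of_iff
  proof (intro exI[of _ "C \<times> D"] conjI ballI allI impI)
    fix x :: "'a \<times> (real \<Rightarrow> 'a)" and r :: real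
    assume x: "x \<in> mspace (input_metric T)" and r: "r > 0"
    obtain c where c: "c \<in> C" "dist (fst x) c < r / 2"
      using C(2)[of "r / 2" "fst x"] r by auto
    obtain d where d: "d \<in> D" "mdist ?P (snd x) d < r / 2"
      using D(3)[of "snd x" "r / 2"] r x by auto
    interpret Metric_space12 UNIV dist "mspace ?P" "mdist ?P"
      by (simp add: Metric_space12_def Met_TC.Metric_space_axioms)
    have "prod_dist dist (mdist ?P) (fst x, snd x) (c, d) \<le> dist (fst x) c + mdist ?P (snd x) d"
      using x d D by (intro prod_metric_le_components) auto
    then show "\<exists>d\<in>C \<times> D. mdist (input_metric T) x d < r"
      using c d by (intro bexI[of _ "(c, d)"]) auto
  qed (use C D in auto)
qed

lemma borel_measurable_input_dist:
  fixes X Y :: "'w \<Rightarrow> real \<Rightarrow> 'a::euclidean_space"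
  assumes T: "T \<ge> 0" and [measurable]: "f \<in> M \<rightarrow>\<^sub>M borel" "g \<in> M \<rightarrow>\<^sub>M borel"
    and X: "X \<in> M \<rightarrow>\<^sub>M path_borel T" and Y: "Y \<in> M \<rightarrow>\<^sub>M path_borel T"
  shows "(\<lambda>\<omega>. mdist (input_metric T) (f \<omega>, X \<omega>) (g \<omega>, Y \<omega>)) \<in> borel_measurable M"
proof -
  have [measurable]: "(\<lambda>\<omega>. sup_dist T (X \<omega>) (Y \<omega>)) \<in> borel_measurable M"
    by (intro borel_measurable_sup_norm_diff T X Y)
  have "(\<lambda>\<omega>. sqrt ((dist (f \<omega>) (g \<omega>))\<^sup>2 + (sup_dist T (X \<omega>) (Y \<omega>))\<^sup>2)) \<in> borel_measurable M"
    by measurable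
  moreover have "mdist (input_metric T) (f \<omega>, X \<omega>) (g \<omega>, Y \<omega>) =
      sqrt ((dist (f \<omega>) (g \<omega>))\<^sup>2 + (sup_dist T (X \<omega>) (Y \<omega>))\<^sup>2)" if "\<omega> \<in> space M" for \<omega>
    using T measurable_path_borel_space[OF X that] measurable_path_borel_space[OF Y that]
    by (simp add: prod_dist_def mdist_path_metric)
  ultimately show ?thesis
    by (simp cong: measurable_cong)
qed

text \<open>The target carries the Borel sets of the product metric, which could a priori exceed the
  product sigma-algebra. Separability closes the gap.\<close>

lemma measurable_input_pair:
  fixes X :: "'w \<Rightarrow> real \<Rightarrow> 'a::euclidean_space"
  assumes T: "T \<ge> 0" and f: "f \<in> M \<rightarrow>\<^sub>M borel" and X: "X \<in> M \<rightarrow>\<^sub>M path_borel T"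
  shows "(\<lambda>\<omega>. (f \<omega>, X \<omega>)) \<in> M \<rightarrow>\<^sub>M borel_metric (input_metric T)"
proof (rule measurable_borel_metricI[OF separable_space_input_metric[OF T]])
  show "(\<lambda>\<omega>. (f \<omega>, X \<omega>)) \<in> space M \<rightarrow> mspace (input_metric T)"
    using measurable_path_borel_space[OF X] by auto
  fix y :: "'a \<times> (real \<Rightarrow> 'a)" assume "y \<in> mspace (input_metric T)"
  then show "(\<lambda>\<omega>. mdist (input_metric T) y (f \<omega>, X \<omega>)) \<in> borel_measurable M"
    using borel_measurable_input_dist[OF T _ f _ X, of "\<lambda>_. fst y" "\<lambda>_. snd y"] by auto
qed

text \<open>Measurability is with respect to the product sigma-algebra because this is where
  couplings are defined.\<close>

lemma borel_measurable_mdist_input_metric: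
  fixes T :: real
  assumes T: "T \<ge> 0"
  shows "(\<lambda>(x, y). mdist (input_metric T) x y) \<in> borel_measurable
    (borel_metric (input_metric T) \<Otimes>\<^sub>M borel_metric (input_metric T :: ('a \<times> (real \<Rightarrow> 'a::euclidean_space)) metric))"
proof -
  let ?E = "borel_metric (input_metric T :: ('a \<times> (real \<Rightarrow> 'a)) metric)"
  note [measurable] = measurable_fst_input[of T] measurable_snd_input[of T]
  have "(\<lambda>\<omega>. mdist (input_metric T) (fst (fst \<omega>), snd (fst \<omega>)) (fst (snd \<omega>), snd (snd \<omega>)))
    \<in> borel_measurable (?E \<Otimes>\<^sub>M ?E)"
    by (intro borel_measurable_input_dist T) measurable
  then show ?thesis
    by (simp add: case_prod_beta)
qed

section \<open>The Wasserstein metric\<close>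

abbreviation moment :: "real \<Rightarrow> 'w measure \<Rightarrow> ('w \<Rightarrow> real) \<Rightarrow> ennreal" where
  "moment p M f \<equiv> \<integral>\<^sup>+\<omega>. ennreal (f \<omega> powr p) \<partial>M"

text \<open>\<open>distr\<close> depends on its target only through the measurable sets, so both
  marginals can be formed in the common space \<open>S\<close>.\<close>

lemma couplings_iff:
  assumes "sets \<mu> = sets S" "sets \<nu> = sets S"
  shows "\<gamma> \<in> couplings \<mu> \<nu> \<longleftrightarrow>
    sets \<gamma> = sets (S \<Otimes>\<^sub>M S) \<and> distr \<gamma> S fst = \<mu> \<and> distr \<gamma> S snd = \<nu>"
proof -
  have "sets (\<mu> \<Otimes>\<^sub>M \<nu>) = sets (S \<Otimes>\<^sub>M S)"
    using assms by (intro sets_pair_measure_cong)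
  moreover have "distr \<gamma> \<mu> fst = distr \<gamma> S fst" "distr \<gamma> \<nu> snd = distr \<gamma> S snd"
    using assms by (auto intro!: distr_cong)
  ultimately show ?thesis
    by (simp add: couplings_def)
qed

lemma couplings_swap:
  assumes "\<gamma> \<in> couplings \<mu> \<nu>"
  shows "distr \<gamma> (\<nu> \<Otimes>\<^sub>M \<mu>) (\<lambda>(x, y). (y, x)) \<in> couplings \<nu> \<mu>"
proof -
  have [measurable_cong]: "sets \<gamma> = sets (\<mu> \<Otimes>\<^sub>M \<nu>)"
    using assms by (simp add: couplings_def)
  have "distr (distr \<gamma> (\<nu> \<Otimes>\<^sub>M \<mu>) (\<lambda>(x, y). (y, x))) \<nu> fst = distr \<gamma> \<nu> snd"
    by (subst distr_distr) (auto simp: comp_def case_prod_beta)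
  moreover have "distr (distr \<gamma> (\<nu> \<Otimes>\<^sub>M \<mu>) (\<lambda>(x, y). (y, x))) \<mu> snd = distr \<gamma> \<mu> fst"
    by (subst distr_distr) (auto simp: comp_def case_prod_beta)
  ultimately show ?thesis
    using assms by (simp add: couplings_def)
qed

text \<open>For an arbitrary integrand one inequality of the transformation formula survives: the
  integral is a supremum over simple functions below \<open>f\<close>, and each of them can be
  pulled back. This bounds transport costs for a general metric whose distance need not be jointly
  measurable.\<close>

lemma nn_integral_distr_le:
  assumes T: "T \<in> M \<rightarrow>\<^sub>M N"
  shows "(\<integral>\<^sup>+x. f x \<partial>distr M N T) \<le> (\<integral>\<^sup>+x. f (T x) \<partial>M)"
  unfolding nn_integral_def[of "distr M N T"]
proof (safe intro!: SUP_least)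
  fix s assume s: "simple_function (distr M N T) s" "s \<le> f"
  have "integral\<^sup>S (distr M N T) s = (\<integral>\<^sup>+x. s x \<partial>distr M N T)"
    using s by (simp add: nn_integral_eq_simple_integral)
  also have "\<dots> = (\<integral>\<^sup>+x. s (T x) \<partial>M)"
    using borel_measurable_simple_function[OF s(1)] by (intro nn_integral_distr T) auto
  also have "\<dots> \<le> (\<integral>\<^sup>+x. f (T x) \<partial>M)"
    using s by (intro nn_integral_mono) (simp add: le_fun_def)
  finally show "integral\<^sup>S (distr M N T) s \<le> (\<integral>\<^sup>+x. f (T x) \<partial>M)" .
qed

abbreviation coupling_cost :: "real \<Rightarrow> 'a metric \<Rightarrow> ('a \<times> 'a) measure \<Rightarrow> ennreal" where
  "coupling_cost p m \<gamma> \<equiv> \<integral>\<^sup>+(x, y). ennreal (mdist m x y powr p) \<partial>\<gamma>"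

lemma wasserstein_powr:
  assumes "p \<ge> 1"
  shows "wasserstein p m \<mu> \<nu> powr p = enn2real (INF \<gamma>\<in>couplings \<mu> \<nu>. coupling_cost p m \<gamma>)"
  using assms by (simp add: wasserstein_def powr_powr)

lemma wasserstein_nonneg: "wasserstein p m \<mu> \<nu> \<ge> 0"
  by (simp add: wasserstein_def)

text \<open>Valid also for infinite costs: \<open>enn2real\<close> sends infinity to 0 and therefore
  never increases the infimum.\<close>

lemma wasserstein_le_cost:
  assumes "p \<ge> 1" "\<gamma> \<in> couplings \<mu> \<nu>"
  shows "ennreal (wasserstein p m \<mu> \<nu> powr p) \<le> coupling_cost p m \<gamma>"
proof -
  have "ennreal (enn2real x) \<le> x" for x
    by (cases x) auto
  then have "ennreal (wasserstein p m \<mu> \<nu> powr p) \<le> (INF \<gamma>\<in>couplings \<mu> \<nu>. coupling_cost p m \<gamma>)"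
    unfolding wasserstein_powr[OF assms(1)] .
  also have "\<dots> \<le> coupling_cost p m \<gamma>"
    using assms(2) by (rule INF_lower)
  finally show ?thesis .
qed

lemma wasserstein_commute: "wasserstein p m \<mu> \<nu> = wasserstein p m \<nu> \<mu>"
proof -
  have le: "(INF \<gamma>\<in>couplings \<nu> \<mu>. coupling_cost p m \<gamma>) \<le> (INF \<gamma>\<in>couplings \<mu> \<nu>. coupling_cost p m \<gamma>)"
    for \<mu> \<nu> :: "'a measure"
  proof (intro INF_greatest)
    fix \<gamma> assume \<gamma>: "\<gamma> \<in> couplings \<mu> \<nu>"
    then have [measurable_cong]: "sets \<gamma> = sets (\<mu> \<Otimes>\<^sub>M \<nu>)"
      by (simp add: couplings_def)
    let ?\<gamma>' = "distr \<gamma> (\<nu> \<Otimes>\<^sub>M \<mu>) (\<lambda>(x, y). (y, x))"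
    have "coupling_cost p m ?\<gamma>' \<le> (\<integral>\<^sup>+z. (case (case z of (x, y) \<Rightarrow> (y, x)) of
        (x, y) \<Rightarrow> ennreal (mdist m x y powr p)) \<partial>\<gamma>)"
      by (intro nn_integral_distr_le) measurable
    also have "\<dots> = coupling_cost p m \<gamma>"
      by (intro nn_integral_cong) (auto simp: mdist_commute)
    finally show "(INF \<gamma>\<in>couplings \<nu> \<mu>. coupling_cost p m \<gamma>) \<le> coupling_cost p m \<gamma>"
      using couplings_swap[OF \<gamma>] by (intro INF_lower2)
  qed
  show ?thesis
    unfolding wasserstein_def using le[of \<mu> \<nu>] le[of \<nu> \<mu>] by simp
qed

lemma distr_pair_in_couplings:
  assumes [measurable]: "f \<in> M \<rightarrow>\<^sub>M S" "g \<in> M \<rightarrow>\<^sub>M S"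
  shows "distr M (S \<Otimes>\<^sub>M S) (\<lambda>\<omega>. (f \<omega>, g \<omega>)) \<in> couplings (distr M S f) (distr M S g)"
  by (subst couplings_iff[of _ S]) (auto simp: distr_distr comp_def)

text \<open>Two random variables on one space couple their laws. Every upper bound on a Wasserstein
  distance below, for time marginals as well as for laws of paths, comes from this.\<close>

lemma wasserstein_distr_le:
  assumes p: "p \<ge> 1" and [measurable]: "f \<in> M \<rightarrow>\<^sub>M S" "g \<in> M \<rightarrow>\<^sub>M S"
  shows "ennreal (wasserstein p m (distr M S f) (distr M S g) powr p)
    \<le> moment p M (\<lambda>\<omega>. mdist m (f \<omega>) (g \<omega>))"
proof -
  have "ennreal (wasserstein p m (distr M S f) (distr M S g) powr p)
    \<le> coupling_cost p m (distr M (S \<Otimes>\<^sub>M S) (\<lambda>\<omega>. (f \<omega>, g \<omega>)))"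
    by (intro wasserstein_le_cost p distr_pair_in_couplings) auto
  also have "\<dots> \<le> (\<integral>\<^sup>+\<omega>. (case (f \<omega>, g \<omega>) of (x, y) \<Rightarrow> ennreal (mdist m x y powr p)) \<partial>M)"
    by (intro nn_integral_distr_le) measurable
  finally show ?thesis
    by simp
qed

lemma pair_measure_in_couplings:
  assumes "prob_space \<mu>" "prob_space \<nu>"
  shows "\<mu> \<Otimes>\<^sub>M \<nu> \<in> couplings \<mu> \<nu>"
proof -
  interpret \<mu>: prob_space \<mu> by fact
  interpret \<nu>: prob_space \<nu> by fact
  interpret pair_prob_space \<mu> \<nu> ..
  have swap: "\<mu> \<Otimes>\<^sub>M \<nu> = distr (\<nu> \<Otimes>\<^sub>M \<mu>) (\<mu> \<Otimes>\<^sub>M \<nu>) (\<lambda>(x, y). (y, x))"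
    by (rule distr_pair_swap)
  have "distr (\<mu> \<Otimes>\<^sub>M \<nu>) \<nu> snd = distr (\<nu> \<Otimes>\<^sub>M \<mu>) \<nu> (snd \<circ> (\<lambda>(x, y). (y, x)))"
    by (subst swap, subst distr_distr) auto
  also have "snd \<circ> (\<lambda>(x, y). (y, x)) = (fst :: 'b \<times> 'a \<Rightarrow> 'b)"
    by auto
  also have "distr (\<nu> \<Otimes>\<^sub>M \<mu>) \<nu> fst = \<nu>"
    by (rule \<mu>.distr_pair_fst)
  finally show ?thesis
    by (simp add: couplings_def \<nu>.distr_pair_fst)
qed

text \<open>The triangle inequality through a fixed point splits the cost into two terms, each of
  which sees only one marginal.\<close>

lemma coupling_cost_finite:
  fixes m :: "'a metric"
  assumes p: "p \<ge> 1" and S: "sets \<mu> = sets S" "sets \<nu> = sets S" "space S = mspace m"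
    and \<gamma>: "\<gamma> \<in> couplings \<mu> \<nu>" and o: "o' \<in> mspace m"
    and [measurable]: "(\<lambda>x. mdist m o' x) \<in> borel_measurable S"
    and fin: "moment p \<mu> (\<lambda>x. mdist m o' x) < \<infinity>"
      "moment p \<nu> (\<lambda>x. mdist m o' x) < \<infinity>"
  shows "coupling_cost p m \<gamma> < \<infinity>"
proof -
  have [measurable_cong]: "sets \<gamma> = sets (S \<Otimes>\<^sub>M S)"
    and marg: "distr \<gamma> S fst = \<mu>" "distr \<gamma> S snd = \<nu>"
    using \<gamma> couplings_iff[OF S(1,2)] by auto
  have sp: "space \<gamma> = mspace m \<times> mspace m"
    using sets_eq_imp_space_eq[OF \<open>sets \<gamma> = sets (S \<Otimes>\<^sub>M S)\<close>] S(3) by (simp add: space_pair_measure)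
  have "coupling_cost p m \<gamma> \<le> (\<integral>\<^sup>+z. ennreal (2 powr p) * (ennreal (mdist m o' (fst z) powr p)
      + ennreal (mdist m o' (snd z) powr p)) \<partial>\<gamma>)"
  proof (rule nn_integral_mono)
    fix z assume "z \<in> space \<gamma>"
    then have z: "fst z \<in> mspace m" "snd z \<in> mspace m"
      unfolding sp by (simp_all add: mem_Times_iff)
    have "mdist m (fst z) (snd z) \<le> mdist m o' (fst z) + mdist m o' (snd z)"
      using mdist_triangle[OF z(1) o z(2)] mdist_commute[of m "fst z" o'] by simp
    then have "mdist m (fst z) (snd z) powr p \<le> (mdist m o' (fst z) + mdist m o' (snd z)) powr p"
      using p by (intro powr_mono2) auto
    also have "\<dots> \<le> 2 powr p * (mdist m o' (fst z) powr p + mdist m o' (snd z) powr p)"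
      using p by (intro powr_add_le) auto
    finally have "ennreal (mdist m (fst z) (snd z) powr p) \<le>
        ennreal (2 powr p * (mdist m o' (fst z) powr p + mdist m o' (snd z) powr p))"
      by (rule ennreal_leI)
    then show "(case z of (x, y) \<Rightarrow> ennreal (mdist m x y powr p)) \<le>
        ennreal (2 powr p) * (ennreal (mdist m o' (fst z) powr p) + ennreal (mdist m o' (snd z) powr p))"
      by (simp add: case_prod_beta ennreal_mult' ennreal_plus)
  qed
  also have "\<dots> = ennreal (2 powr p) * (moment p \<gamma> (\<lambda>z. mdist m o' (fst z))
      + moment p \<gamma> (\<lambda>z. mdist m o' (snd z)))"
    by (simp add: nn_integral_cmult nn_integral_add)
  also have "\<dots> < \<infinity>"
  proof -
    have "moment p \<gamma> (\<lambda>z. mdist m o' (fst z)) = moment p \<mu> (\<lambda>x. mdist m o' x)"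
      by (subst marg(1)[symmetric], subst nn_integral_distr) auto
    moreover have "moment p \<gamma> (\<lambda>z. mdist m o' (snd z)) = moment p \<nu> (\<lambda>x. mdist m o' x)"
      by (subst marg(2)[symmetric], subst nn_integral_distr) auto
    ultimately show ?thesis
      using fin by (simp add: ennreal_mult_less_top)
  qed
  finally show ?thesis .
qed

text \<open>Lower bounds on \<open>wasserstein\<close> require a finite infimum, since
  \<open>enn2real\<close> would turn an infinite one into 0. The coupling
  \<open>\<gamma>\<^sub>0\<close> is the witness of finiteness.\<close>

lemma le_wasserstein_powr:
  assumes p: "p \<ge> 1" and c: "c > 0"
    and le: "\<And>\<gamma>. \<gamma> \<in> couplings \<mu> \<nu> \<Longrightarrow> ennreal a \<le> ennreal c * coupling_cost p m \<gamma>"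
    and fin: "\<gamma>\<^sub>0 \<in> couplings \<mu> \<nu>" "coupling_cost p m \<gamma>\<^sub>0 < \<infinity>"
  shows "a \<le> c * wasserstein p m \<mu> \<nu> powr p"
proof (cases "a \<le> 0")
  case True
  then show ?thesis
    using c by (intro order_trans[OF True]) auto
next
  case a: False
  let ?I = "INF \<gamma>\<in>couplings \<mu> \<nu>. coupling_cost p m \<gamma>"
  have div: "ennreal (a / c) \<le> x" if "ennreal a \<le> ennreal c * x" for x
  proof (cases x)
    case (real r)
    then show ?thesis
      using that a c by (simp add: ennreal_mult[symmetric] ennreal_le_iff pos_divide_le_eq mult.commute)
  qed simp
  have "ennreal (a / c) \<le> ?I"
    using le by (intro INF_greatest div)
  moreover have "?I < \<infinity>"
    using INF_lower[OF fin(1), of "coupling_cost p m"] fin(2) by simp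
  ultimately have "a / c \<le> enn2real ?I"
    using a c by (cases ?I) auto
  then show ?thesis
    using c by (simp add: wasserstein_powr[OF p] pos_divide_le_eq mult.commute)
qed

lemma exists_coupling_cost_less:
  assumes p: "p \<ge> 1" and w: "wasserstein p m \<mu> \<nu> < w"
    and fin: "\<gamma>\<^sub>0 \<in> couplings \<mu> \<nu>" "coupling_cost p m \<gamma>\<^sub>0 < \<infinity>"
  obtains \<gamma> where "\<gamma> \<in> couplings \<mu> \<nu>" "coupling_cost p m \<gamma> < ennreal (w powr p)"
proof -
  let ?I = "INF \<gamma>\<in>couplings \<mu> \<nu>. coupling_cost p m \<gamma>"
  have "?I < \<infinity>"
    using INF_lower[OF fin(1), of "coupling_cost p m"] fin(2) by simp
  moreover have "enn2real ?I < w powr p"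
    unfolding wasserstein_powr[OF p, symmetric] using w p
    by (intro powr_less_mono2 wasserstein_nonneg) auto
  ultimately have "?I < ennreal (w powr p)"
    by (cases ?I) (auto simp: ennreal_less_iff)
  then show ?thesis
    using that by (auto simp: INF_less_iff)
qed

text \<open>Convexity of the power is applied to positive arguments. If one argument is 0, the claim
  reduces to s^p \<le> s for s in [0,1].\<close>

lemma powr_convex_combination:
  fixes x y t p :: real
  assumes p: "p \<ge> 1" and "x \<ge> 0" "y \<ge> 0" "0 \<le> t" "t \<le> 1"
  shows "((1 - t) * x + t * y) powr p \<le> (1 - t) * x powr p + t * y powr p"
proof -
  have scale: "(s * z) powr p \<le> s * z powr p" if "0 \<le> s" "s \<le> 1" "z \<ge> 0" for s z
  proof -
    have "s powr p \<le> s powr 1"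
      using that p by (intro powr_mono') auto
    then show ?thesis
      using that by (simp add: powr_mult mult_right_mono)
  qed
  consider "x = 0" | "y = 0" | "x > 0" "y > 0"
    using assms by linarith
  then show ?thesis
  proof cases
    case 3
    then show ?thesis
      using convex_onD[OF powr_convex[OF p], of t x y] assms by simp
  qed (use scale[of t y] scale[of "1 - t" x] assms p in auto)
qed

text \<open>By convexity, applied to the weighted combination
  \<open>A/(A+B) \<cdot> (f/A) + B/(A+B) \<cdot> (g/B)\<close>.\<close>

lemma nn_integral_Minkowski:
  fixes f g :: "'w \<Rightarrow> real"
  assumes p: "p \<ge> 1" and [measurable]: "f \<in> borel_measurable M" "g \<in> borel_measurable M"
    and nn: "\<And>\<omega>. \<omega> \<in> space M \<Longrightarrow> f \<omega> \<ge> 0" "\<And>\<omega>. \<omega> \<in> space M \<Longrightarrow> g \<omega> \<ge> 0" and AB: "A > 0" "B > 0"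
    and f: "moment p M f \<le> ennreal (A powr p)"
    and g: "moment p M g \<le> ennreal (B powr p)"
  shows "moment p M (\<lambda>\<omega>. f \<omega> + g \<omega>) \<le> ennreal ((A + B) powr p)"
proof -
  define c where "c = (A + B) powr p"
  define t where "t = B / (A + B)"
  have t: "0 \<le> t" "t \<le> 1" "1 - t = A / (A + B)"
    using AB by (auto simp: t_def field_simps)
  have c: "c \<ge> 0"
    by (simp add: c_def)
  \<comment> \<open>The denominators are the given bounds on the two moments, so that after
    integration only c(1-t) + ct = c remains.\<close>
  define k l where "k = c * (1 - t) / A powr p" and "l = c * t / B powr p"
  have kl: "k \<ge> 0" "l \<ge> 0"
    using c t(1,2) by (auto simp: k_def l_def)
  have pw: "(f \<omega> + g \<omega>) powr p \<le> k * f \<omega> powr p + l * g \<omega> powr p" if \<omega>: "\<omega> \<in> space M" for \<omega>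
  proof -
    note nn = nn[OF \<omega>]
    have "(A + B) * (1 - t) = A" "(A + B) * t = B"
      unfolding t(3) using AB by (auto simp: t_def)
    then have "f \<omega> + g \<omega> = (A + B) * ((1 - t) * (f \<omega> / A) + t * (g \<omega> / B))"
      using AB by (simp add: distrib_left mult.assoc[symmetric])
    then have "(f \<omega> + g \<omega>) powr p = c * ((1 - t) * (f \<omega> / A) + t * (g \<omega> / B)) powr p"
      using AB nn t by (simp add: c_def powr_mult)
    also have "\<dots> \<le> c * ((1 - t) * (f \<omega> / A) powr p + t * (g \<omega> / B) powr p)"
      using AB nn t c by (intro mult_left_mono powr_convex_combination p) auto
    also have "\<dots> = k * f \<omega> powr p + l * g \<omega> powr p"
      using AB nn by (simp add: powr_divide algebra_simps k_def l_def)
    finally show ?thesis .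
  qed
  have "moment p M (\<lambda>\<omega>. f \<omega> + g \<omega>) \<le>
    (\<integral>\<^sup>+\<omega>. ennreal k * ennreal (f \<omega> powr p) + ennreal l * ennreal (g \<omega> powr p) \<partial>M)"
    using pw kl
    by (intro nn_integral_mono) (simp add: ennreal_mult'[symmetric] ennreal_plus[symmetric] del: ennreal_plus)
  also have "\<dots> = ennreal k * moment p M f
       + ennreal l * moment p M g"
    by (simp add: nn_integral_cmult nn_integral_add)
  also have "\<dots> \<le> ennreal k * ennreal (A powr p) + ennreal l * ennreal (B powr p)"
    using f g by (intro add_mono mult_left_mono) auto
  also have "\<dots> = ennreal (k * A powr p + l * B powr p)"
    using kl by (simp add: ennreal_mult'[symmetric] ennreal_plus[symmetric] del: ennreal_plus)
  also have "k * A powr p + l * B powr p = c * (1 - t) + c * t"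
    using AB by (simp add: k_def l_def)
  also have "\<dots> = c"
    by (simp add: algebra_simps)
  finally show ?thesis
    by (simp add: c_def)
qed

section \<open>Metric axioms on the Wasserstein space\<close>

lemma wasserstein_spaceD:
  assumes "\<mu> \<in> wasserstein_space p"
  shows "sets \<mu> = sets borel" "prob_space \<mu>" "moment p \<mu> norm < \<infinity>"
  using assms by (auto simp: wasserstein_space_def integrable_iff_bounded)

lemma wasserstein_spaceI:
  assumes "sets \<mu> = sets borel" "prob_space \<mu>" "moment p \<mu> norm < \<infinity>"
  shows "\<mu> \<in> wasserstein_space p"
  using assms by (auto simp: wasserstein_space_def integrable_iff_bounded cong: measurable_cong_sets)

lemma wasserstein_space_coupling:
  assumes "p \<ge> 1" "\<mu> \<in> wasserstein_space p" "\<nu> \<in> wasserstein_space p"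
  shows "\<mu> \<Otimes>\<^sub>M \<nu> \<in> couplings \<mu> \<nu>" "coupling_cost p euclidean_metric (\<mu> \<Otimes>\<^sub>M \<nu>) < \<infinity>"
proof -
  show c: "\<mu> \<Otimes>\<^sub>M \<nu> \<in> couplings \<mu> \<nu>"
    using assms by (intro pair_measure_in_couplings wasserstein_spaceD)
  show "coupling_cost p euclidean_metric (\<mu> \<Otimes>\<^sub>M \<nu>) < \<infinity>"
    using assms wasserstein_spaceD(1,3)[OF assms(2)] wasserstein_spaceD(1,3)[OF assms(3)]
    by (intro coupling_cost_finite[where S = borel and o' = 0, OF _ _ _ _ c]) auto
qed

text \<open>Conditionally on the cell of a countable partition containing the middle coordinate, the two
  couplings are made independent. This glues them up to the size of the cells and avoids
  disintegration of measures.\<close>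

lemma coupling_glue:
  fixes \<mu> \<nu> \<rho> :: "'a::{metric_space,second_countable_topology} measure"
  assumes sets: "sets \<mu> = sets borel" "sets \<nu> = sets borel" "sets \<rho> = sets borel"
    and prob: "prob_space \<mu>" "prob_space \<nu>" "prob_space \<rho>"
    and \<gamma>: "\<gamma>\<^sub>1 \<in> couplings \<mu> \<nu>" "\<gamma>\<^sub>2 \<in> couplings \<nu> \<rho>" and e: "e > 0"
  obtains \<sigma> where "sets \<sigma> = sets ((borel \<Otimes>\<^sub>M borel) \<Otimes>\<^sub>M (borel \<Otimes>\<^sub>M borel))"
    "distr \<sigma> (borel \<Otimes>\<^sub>M borel) fst = \<gamma>\<^sub>1" "distr \<sigma> (borel \<Otimes>\<^sub>M borel) snd = \<gamma>\<^sub>2"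
    "AE z in \<sigma>. dist (snd (fst z)) (fst (snd z)) \<le> e"
proof -
  obtain D :: "'a set" where D: "countable D" "\<And>U. open U \<Longrightarrow> U \<noteq> {} \<Longrightarrow> \<exists>d\<in>D. d \<in> U"
    using countable_dense_exists by metis
  have "D \<noteq> {}"
    using D(2)[of UNIV] by auto
  define d where "d = from_nat_into D"
  \<comment> \<open>The index of the cell of \<open>y\<close>: the first dense point within e/2.
    Points of one cell are then at distance at most e.\<close>
  define T where "T y = (LEAST n. dist y (d n) < e / 2)" for y
  have T: "dist y (d (T y)) < e / 2" for y
    unfolding T_def
  proof (rule LeastI_ex)
    obtain x where "x \<in> D" "dist y x < e / 2"
      using D(2)[of "ball y (e / 2)"] e by auto
    then show "\<exists>n. dist y (d n) < e / 2"
      unfolding d_def using from_nat_into_surj[OF D(1)] by metis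
  qed
  have near: "dist y y' \<le> e" if "T y = T y'" for y y'
    using T[of y] T[of y'] dist_triangle2[of y y' "d (T y)"] that by simp
  have [measurable]: "T \<in> borel \<rightarrow>\<^sub>M count_space UNIV"
    unfolding T_def by measurable
  note [measurable_cong] = sets
  have s1[measurable_cong]: "sets \<gamma>\<^sub>1 = sets (borel \<Otimes>\<^sub>M borel)" and m1: "distr \<gamma>\<^sub>1 borel snd = \<nu>"
      "distr \<gamma>\<^sub>1 borel fst = \<mu>"
    using couplings_iff[OF sets(1,2)] \<gamma> by auto
  have s2[measurable_cong]: "sets \<gamma>\<^sub>2 = sets (borel \<Otimes>\<^sub>M borel)" and m2: "distr \<gamma>\<^sub>2 borel fst = \<nu>"
    using couplings_iff[OF sets(2,3)] \<gamma> by auto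
  have "prob_space \<gamma>\<^sub>1" "prob_space \<gamma>\<^sub>2"
    using prob_space_distrD[of fst \<gamma>\<^sub>1 borel] prob_space_distrD[of fst \<gamma>\<^sub>2 borel] prob m1 m2
    by simp_all
  interpret \<nu>: prob_space \<nu> by fact
  interpret \<gamma>1: prob_space \<gamma>\<^sub>1 by fact
  interpret \<gamma>2: prob_space \<gamma>\<^sub>2 by fact
  interpret pair_prob_space \<gamma>\<^sub>1 \<gamma>\<^sub>2 ..
  define q where "q n = emeasure \<nu> {y. T y = n}" for n
  have [measurable]: "{y. T y = n} \<in> sets borel" for n
    using measurable_sets[OF \<open>T \<in> borel \<rightarrow>\<^sub>M count_space UNIV\<close>, of "{n}"] by (simp add: vimage_def)
  \<comment> \<open>The density of the glued measure with respect to the product of the couplings.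
    Both middle coordinates have law \<open>\<nu>\<close>, so \<open>q n\<close> is the mass of cell
    \<open>n\<close> under either coupling and its reciprocal normalises. The reciprocal is infinite
    on cells of mass 0, which \<open>pos\<close> shows to be negligible.\<close>
  define h where "h z = (if T (snd (fst z)) = T (fst (snd z)) then 1 / q (T (snd (fst z))) else 0)"
    for z :: "('a \<times> 'a) \<times> ('a \<times> 'a)"
  have [measurable]: "h \<in> borel_measurable (\<gamma>\<^sub>1 \<Otimes>\<^sub>M \<gamma>\<^sub>2)"
  proof -
    have [measurable]: "(\<lambda>y. real (T y)) \<in> borel_measurable borel" "(\<lambda>y. 1 / q (T y)) \<in> borel_measurable borel"
      by (rule measurable_compose[of T borel "count_space UNIV"]; simp)+
    have h_eq: "h = (\<lambda>z. if real (T (snd (fst z))) = real (T (fst (snd z))) then 1 / q (T (snd (fst z))) else 0)"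
      by (auto simp: h_def)
    show ?thesis
      unfolding h_eq by measurable
  qed
  \<comment> \<open>With one coupling held fixed, integrating the density over the other gives 1.
    This is why both couplings are recovered as marginals.\<close>
  have fiber: "(\<integral>\<^sup>+v. (if n = T (f v) then 1 / q n else 0) \<partial>\<gamma>) = 1"
    if [measurable]: "f \<in> \<gamma> \<rightarrow>\<^sub>M borel" and \<nu>: "distr \<gamma> borel f = \<nu>" and q: "q n \<noteq> 0" for \<gamma> :: "('a \<times> 'a) measure" and f n
  proof -
    have "(\<integral>\<^sup>+v. (if n = T (f v) then 1 / q n else 0) \<partial>\<gamma>) = (\<integral>\<^sup>+v. 1 / q n * indicator {y. T y = n} (f v) \<partial>\<gamma>)"
      by (intro nn_integral_cong) (auto simp: indicator_def)
    also have "\<dots> = (\<integral>\<^sup>+y. 1 / q n * indicator {y. T y = n} y \<partial>\<nu>)"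
      by (subst \<nu>[symmetric], subst nn_integral_distr) auto
    also have "\<dots> = 1 / q n * q n"
      by (subst nn_integral_cmult_indicator) (auto simp: q_def sets)
    also have "\<dots> = 1"
    proof -
      have "q n < \<top>"
        unfolding q_def by (simp add: less_top[symmetric])
      then show ?thesis
        using ennreal_divide_self[OF q] by (simp add: ennreal_divide_times)
    qed
    finally show ?thesis .
  qed
  have pos: "AE y in \<nu>. q (T y) \<noteq> 0"
  proof -
    have "AE y in \<nu>. q n = 0 \<longrightarrow> T y \<noteq> n" for n
    proof (cases "q n = 0")
      case True
      then show ?thesis
        by (intro AE_I[of _ _ "{y. T y = n}"]) (auto simp: q_def sets)
    qed simp
    then have "AE y in \<nu>. \<forall>n. q n = 0 \<longrightarrow> T y \<noteq> n"
      by (simp add: AE_all_countable)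
    then show ?thesis
      by eventually_elim auto
  qed
  have pos1: "AE u in \<gamma>\<^sub>1. q (T (snd u)) \<noteq> 0"
  proof (rule AE_distrD[of snd _ borel])
    show "AE y in distr \<gamma>\<^sub>1 borel snd. q (T y) \<noteq> 0"
      unfolding m1 by (rule pos)
  qed measurable
  have pos2: "AE u in \<gamma>\<^sub>2. q (T (fst u)) \<noteq> 0"
  proof (rule AE_distrD[of fst _ borel])
    show "AE y in distr \<gamma>\<^sub>2 borel fst. q (T y) \<noteq> 0"
      unfolding m2 by (rule pos)
  qed measurable
  define \<sigma> where "\<sigma> = density (\<gamma>\<^sub>1 \<Otimes>\<^sub>M \<gamma>\<^sub>2) h"
  have s\<sigma>: "sets \<sigma> = sets ((borel \<Otimes>\<^sub>M borel) \<Otimes>\<^sub>M (borel \<Otimes>\<^sub>M borel))"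
    unfolding \<sigma>_def using s1 s2 by (auto intro: sets_pair_measure_cong)
  note [measurable_cong] = s\<sigma>
  have h1: "h (u, v) = (if T (snd u) = T (fst v) then 1 / q (T (snd u)) else 0)" for u v
    by (auto simp: h_def)
  have 1: "distr \<sigma> (borel \<Otimes>\<^sub>M borel) fst = \<gamma>\<^sub>1"
  proof (rule measure_eqI)
    fix A assume "A \<in> sets (distr \<sigma> (borel \<Otimes>\<^sub>M borel) fst)"
    then have [measurable]: "A \<in> sets (borel \<Otimes>\<^sub>M borel)"
      by simp
    have "emeasure (distr \<sigma> (borel \<Otimes>\<^sub>M borel) fst) A = (\<integral>\<^sup>+z. indicator A (fst z) \<partial>\<sigma>)"
      by (simp add: nn_integral_indicator[symmetric] nn_integral_distr del: nn_integral_indicator)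
    also have "\<dots> = (\<integral>\<^sup>+z. h z * indicator A (fst z) \<partial>(\<gamma>\<^sub>1 \<Otimes>\<^sub>M \<gamma>\<^sub>2))"
      unfolding \<sigma>_def by (subst nn_integral_density) auto
    also have "\<dots> = (\<integral>\<^sup>+u. \<integral>\<^sup>+v. h (u, v) * indicator A u \<partial>\<gamma>\<^sub>2 \<partial>\<gamma>\<^sub>1)"
      by (subst \<gamma>2.nn_integral_fst[symmetric]) auto
    also have "\<dots> = (\<integral>\<^sup>+u. (\<integral>\<^sup>+v. h (u, v) \<partial>\<gamma>\<^sub>2) * indicator A u \<partial>\<gamma>\<^sub>1)"
      by (intro nn_integral_cong nn_integral_multc) measurable
    also have "\<dots> = (\<integral>\<^sup>+u. indicator A u \<partial>\<gamma>\<^sub>1)"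
      using pos1 by (intro nn_integral_cong_AE, eventually_elim) (simp add: h1 fiber m2)
    finally show "emeasure (distr \<sigma> (borel \<Otimes>\<^sub>M borel) fst) A = emeasure \<gamma>\<^sub>1 A"
      by simp
  qed (simp add: s1)
  have 2: "distr \<sigma> (borel \<Otimes>\<^sub>M borel) snd = \<gamma>\<^sub>2"
  proof (rule measure_eqI)
    fix A assume "A \<in> sets (distr \<sigma> (borel \<Otimes>\<^sub>M borel) snd)"
    then have [measurable]: "A \<in> sets (borel \<Otimes>\<^sub>M borel)"
      by simp
    have h2: "h (u, v) = (if T (fst v) = T (snd u) then 1 / q (T (fst v)) else 0)" for u v
      by (auto simp: h_def)
    have "emeasure (distr \<sigma> (borel \<Otimes>\<^sub>M borel) snd) A = (\<integral>\<^sup>+z. indicator A (snd z) \<partial>\<sigma>)"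
      by (simp add: nn_integral_indicator[symmetric] nn_integral_distr del: nn_integral_indicator)
    also have "\<dots> = (\<integral>\<^sup>+z. h z * indicator A (snd z) \<partial>(\<gamma>\<^sub>1 \<Otimes>\<^sub>M \<gamma>\<^sub>2))"
      unfolding \<sigma>_def by (subst nn_integral_density) auto
    also have "\<dots> = (\<integral>\<^sup>+v. \<integral>\<^sup>+u. h (u, v) * indicator A v \<partial>\<gamma>\<^sub>1 \<partial>\<gamma>\<^sub>2)"
      by (subst nn_integral_snd[symmetric]) auto
    also have "\<dots> = (\<integral>\<^sup>+v. (\<integral>\<^sup>+u. h (u, v) \<partial>\<gamma>\<^sub>1) * indicator A v \<partial>\<gamma>\<^sub>2)"
      by (intro nn_integral_cong nn_integral_multc) measurable
    also have "\<dots> = (\<integral>\<^sup>+v. indicator A v \<partial>\<gamma>\<^sub>2)"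
      using pos2 by (intro nn_integral_cong_AE, eventually_elim) (simp add: h2 fiber m1)
    finally show "emeasure (distr \<sigma> (borel \<Otimes>\<^sub>M borel) snd) A = emeasure \<gamma>\<^sub>2 A"
      by simp
  qed (simp add: s2)
  have "AE z in \<sigma>. dist (snd (fst z)) (fst (snd z)) \<le> e"
    unfolding \<sigma>_def using near by (subst AE_density) (auto simp: h_def)
  with s\<sigma> 1 2 show ?thesis
    by (rule that)
qed

text \<open>Gluing two nearly optimal couplings leaves a mismatch of at most e/3 in the middle.
  Minkowski's inequality adds this to the two costs, each optimal up to e/3, for a total error of
  e.\<close>

lemma wasserstein_triangle:
  fixes \<mu> \<nu> \<rho> :: "'a::euclidean_space measure"
  assumes p: "p \<ge> 1"
    and ws: "\<mu> \<in> wasserstein_space p" "\<nu> \<in> wasserstein_space p" "\<rho> \<in> wasserstein_space p"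
  shows "wasserstein p euclidean_metric \<mu> \<rho>
    \<le> wasserstein p euclidean_metric \<mu> \<nu> + wasserstein p euclidean_metric \<nu> \<rho>" (is "?a \<le> ?b + ?c")
proof (rule field_le_epsilon)
  fix e :: real assume e: "e > 0"
  note D = wasserstein_spaceD
  obtain \<gamma>\<^sub>1 where \<gamma>1: "\<gamma>\<^sub>1 \<in> couplings \<mu> \<nu>" "coupling_cost p euclidean_metric \<gamma>\<^sub>1 < ennreal ((?b + e / 3) powr p)"
    using exists_coupling_cost_less[OF p _ wasserstein_space_coupling[OF p ws(1,2)], of "?b + e / 3"] e by auto
  obtain \<gamma>\<^sub>2 where \<gamma>2: "\<gamma>\<^sub>2 \<in> couplings \<nu> \<rho>" "coupling_cost p euclidean_metric \<gamma>\<^sub>2 < ennreal ((?c + e / 3) powr p)"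
    using exists_coupling_cost_less[OF p _ wasserstein_space_coupling[OF p ws(2,3)], of "?c + e / 3"] e by auto
  obtain \<sigma> where s[measurable_cong]: "sets \<sigma> = sets ((borel \<Otimes>\<^sub>M borel) \<Otimes>\<^sub>M (borel \<Otimes>\<^sub>M borel))"
    and \<sigma>: "distr \<sigma> (borel \<Otimes>\<^sub>M borel) fst = \<gamma>\<^sub>1" "distr \<sigma> (borel \<Otimes>\<^sub>M borel) snd = \<gamma>\<^sub>2"
    "AE z in \<sigma>. dist (snd (fst z)) (fst (snd z)) \<le> e / 3"
    using coupling_glue[OF D(1)[OF ws(1)] D(1)[OF ws(2)] D(1)[OF ws(3)]
        D(2)[OF ws(1)] D(2)[OF ws(2)] D(2)[OF ws(3)] \<gamma>1(1) \<gamma>2(1), of "e / 3"] e by auto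
  have m1: "distr \<gamma>\<^sub>1 borel fst = \<mu>" and m2: "distr \<gamma>\<^sub>2 borel snd = \<rho>"
    using couplings_iff[OF D(1)[OF ws(1)] D(1)[OF ws(2)]] couplings_iff[OF D(1)[OF ws(2)] D(1)[OF ws(3)]]
      \<gamma>1 \<gamma>2 by auto
  have d1: "distr \<sigma> borel (\<lambda>z. fst (fst z)) = \<mu>"
    unfolding m1[symmetric] \<sigma>(1)[symmetric] by (subst distr_distr) (auto simp: comp_def)
  have d2: "distr \<sigma> borel (\<lambda>z. snd (snd z)) = \<rho>"
    unfolding m2[symmetric] \<sigma>(2)[symmetric] by (subst distr_distr) (auto simp: comp_def)
  have "prob_space \<sigma>"
    using D(2)[OF ws(1)] d1 by (intro prob_space_distrD[of "\<lambda>z. fst (fst z)" _ borel]) auto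
  interpret prob_space \<sigma> by fact
  have i1: "moment p \<sigma> (\<lambda>z. dist (fst (fst z)) (snd (fst z))) \<le> ennreal ((?b + e / 3) powr p)"
  proof -
    have "moment p \<sigma> (\<lambda>z. dist (fst (fst z)) (snd (fst z))) = coupling_cost p euclidean_metric \<gamma>\<^sub>1"
      unfolding \<sigma>(1)[symmetric] by (subst nn_integral_distr) (auto simp: case_prod_beta)
    then show ?thesis
      using \<gamma>1(2) by simp
  qed
  have i2: "moment p \<sigma> (\<lambda>z. dist (fst (snd z)) (snd (snd z))) \<le> ennreal ((?c + e / 3) powr p)"
  proof -
    have "moment p \<sigma> (\<lambda>z. dist (fst (snd z)) (snd (snd z))) = coupling_cost p euclidean_metric \<gamma>\<^sub>2"
      unfolding \<sigma>(2)[symmetric] by (subst nn_integral_distr) (auto simp: case_prod_beta)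
    then show ?thesis
      using \<gamma>2(2) by simp
  qed
  have i3: "moment p \<sigma> (\<lambda>z. dist (snd (fst z)) (fst (snd z))) \<le> ennreal ((e / 3) powr p)"
  proof -
    have "moment p \<sigma> (\<lambda>z. dist (snd (fst z)) (fst (snd z))) \<le> moment p \<sigma> (\<lambda>z. e / 3)"
      by (intro nn_integral_mono_AE eventually_mono[OF \<sigma>(3)] ennreal_leI powr_mono2)
        (use p in auto)
    then show ?thesis
      by (simp add: emeasure_space_1)
  qed
  have pos: "?b + e / 3 > 0" "?c + e / 3 > 0"
    using e wasserstein_nonneg[of p euclidean_metric \<mu> \<nu>] wasserstein_nonneg[of p euclidean_metric \<nu> \<rho>]
    by linarith+
  have "ennreal (?a powr p) \<le> moment p \<sigma> (\<lambda>z. dist (fst (fst z)) (snd (snd z)))"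
    using wasserstein_distr_le[OF p, of "\<lambda>z. fst (fst z)" \<sigma> borel "\<lambda>z. snd (snd z)" euclidean_metric]
    unfolding d1 d2 by simp
  also have "\<dots> \<le> moment p \<sigma> (\<lambda>z. dist (fst (fst z)) (snd (fst z)) +
      (dist (snd (fst z)) (fst (snd z)) + dist (fst (snd z)) (snd (snd z))))"
  proof (intro nn_integral_mono ennreal_leI powr_mono2)
    fix z :: "('a \<times> 'a) \<times> 'a \<times> 'a"
    show "dist (fst (fst z)) (snd (snd z)) \<le> dist (fst (fst z)) (snd (fst z)) +
      (dist (snd (fst z)) (fst (snd z)) + dist (fst (snd z)) (snd (snd z)))"
      by metric
  qed (use p in auto)
  also have "\<dots> \<le> ennreal ((?b + e / 3 + (e / 3 + (?c + e / 3))) powr p)"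
    using i1 i2 i3 pos e by (intro nn_integral_Minkowski p) auto
  finally have le: "?a powr p \<le> (?b + ?c + e) powr p"
    by (simp add: algebra_simps)
  show "?a \<le> ?b + ?c + e"
  proof (rule ccontr)
    assume "\<not> ?a \<le> ?b + ?c + e"
    then have "(?b + ?c + e) powr p < ?a powr p"
      using p pos e by (intro powr_less_mono2) auto
    with le show False
      by simp
  qed
qed

lemma wasserstein_self:
  assumes p: "p \<ge> 1" and "sets \<mu> = sets borel"
  shows "wasserstein p euclidean_metric \<mu> \<mu> = 0"
proof -
  have id: "distr \<mu> borel (\<lambda>x. x) = \<mu>"
    using assms by (intro distr_id2) auto
  have "ennreal (wasserstein p euclidean_metric \<mu> \<mu> powr p) \<le> 0"
    using wasserstein_distr_le[OF p, of "\<lambda>x. x" \<mu> borel "\<lambda>x. x" euclidean_metric] assms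
    by (simp add: id measurable_ident_sets)
  then show ?thesis
    using p by simp
qed

text \<open>Markov's inequality for a coupling of small cost: mass starting in F either ends in a
  closed neighbourhood of F or travels farther than its width. The cost tends to 0 first, then the
  neighbourhoods shrink to F.\<close>

lemma wasserstein_eq_0_imp_closed_le:
  fixes \<mu> \<nu> :: "'a::euclidean_space measure"
  assumes p: "p \<ge> 1" and ws: "\<mu> \<in> wasserstein_space p" "\<nu> \<in> wasserstein_space p"
    and 0: "wasserstein p euclidean_metric \<mu> \<nu> = 0" and F: "closed F"
  shows "emeasure \<mu> F \<le> emeasure \<nu> F"
proof (cases "F = {}")
  case False
  note D = wasserstein_spaceD
  interpret \<nu>: prob_space \<nu> by (rule D[OF ws(2)])
  note [measurable_cong] = D(1)[OF ws(2)] D(1)[OF ws(1)]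
  have clF: "closed {x. infdist x F \<le> r}" for r
    by (intro closed_Collect_le continuous_intros)
  define G where "G n = {x. infdist x F \<le> 1 / real (Suc n)}" for n
  have [measurable]: "G n \<in> sets borel" "F \<in> sets borel" for n
    using clF F by (auto simp: G_def)
  have le: "emeasure \<mu> F \<le> emeasure \<nu> (G n)" for n
  proof (rule ennreal_le_epsilon)
    fix e :: real assume e: "e > 0"
    define \<delta> where "\<delta> = 1 / real (Suc n)"
    have \<delta>: "\<delta> > 0"
      by (simp add: \<delta>_def)
    \<comment> \<open>Chosen so that a cost below \<open>w powr p\<close>, divided by
      \<open>\<delta> powr p\<close> in Markov's inequality, is at most \<open>e\<close>.\<close>
    define w where "w = (e * \<delta> powr p) powr (1 / p)"
    have w: "w > 0" "w powr p = e * \<delta> powr p"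
      using e \<delta> p by (auto simp: w_def powr_powr)
    obtain \<gamma> where \<gamma>: "\<gamma> \<in> couplings \<mu> \<nu>" "coupling_cost p euclidean_metric \<gamma> < ennreal (w powr p)"
      using exists_coupling_cost_less[OF p _ wasserstein_space_coupling[OF p ws], of w] w 0 by auto
    have [measurable_cong]: "sets \<gamma> = sets (borel \<Otimes>\<^sub>M borel)"
      and marg: "distr \<gamma> borel fst = \<mu>" "distr \<gamma> borel snd = \<nu>"
      using \<gamma> couplings_iff[OF D(1)[OF ws(1)] D(1)[OF ws(2)]] by auto
    have "emeasure \<mu> F = (\<integral>\<^sup>+z. indicator F (fst z) \<partial>\<gamma>)"
      unfolding marg(1)[symmetric]
      by (simp add: nn_integral_indicator[symmetric] nn_integral_distr del: nn_integral_indicator)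
    also have "\<dots> \<le> (\<integral>\<^sup>+z. indicator (G n) (snd z)
        + ennreal (1 / \<delta> powr p) * ennreal (dist (fst z) (snd z) powr p) \<partial>\<gamma>)"
    proof (rule nn_integral_mono)
      fix z :: "'a \<times> 'a"
      show "indicator F (fst z) \<le> indicator (G n) (snd z)
        + ennreal (1 / \<delta> powr p) * ennreal (dist (fst z) (snd z) powr p)"
      proof (cases "fst z \<in> F \<and> snd z \<notin> G n")
        case True
        then have "infdist (snd z) F \<le> dist (snd z) (fst z)" "infdist (snd z) F > \<delta>"
          by (auto simp: G_def \<delta>_def intro: infdist_le)
        then have "\<delta> powr p \<le> dist (fst z) (snd z) powr p"
          using \<delta> p by (intro powr_mono2) (auto simp: dist_commute)
        then have "1 \<le> ennreal (1 / \<delta> powr p * dist (fst z) (snd z) powr p)"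
          using \<delta> by (simp add: pos_le_divide_eq)
        then show ?thesis
          using True by (simp add: ennreal_mult'[symmetric])
      qed (auto simp: indicator_def)
    qed
    also have "\<dots> = emeasure \<nu> (G n) + ennreal (1 / \<delta> powr p) * coupling_cost p euclidean_metric \<gamma>"
    proof -
      have "(\<integral>\<^sup>+z. indicator (G n) (snd z) \<partial>\<gamma>) = emeasure \<nu> (G n)"
        unfolding marg(2)[symmetric]
        by (simp add: nn_integral_indicator[symmetric] nn_integral_distr del: nn_integral_indicator)
      then show ?thesis
        by (simp add: nn_integral_add nn_integral_cmult case_prod_beta')
    qed
    also have "\<dots> \<le> emeasure \<nu> (G n) + ennreal (1 / \<delta> powr p) * ennreal (w powr p)"
      using \<gamma>(2) by (intro add_left_mono mult_left_mono) auto
    also have "ennreal (1 / \<delta> powr p) * ennreal (w powr p) = ennreal e"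
      using w \<delta> by (simp add: ennreal_mult'[symmetric])
    finally show "emeasure \<mu> F \<le> emeasure \<nu> (G n) + ennreal e" .
  qed
  have "(\<Inter>n. G n) = F"
  proof (intro equalityI subsetI)
    fix x assume x: "x \<in> (\<Inter>n. G n)"
    have "infdist x F \<le> 0"
    proof (rule field_le_epsilon)
      fix e :: real assume "e > 0"
      then obtain n where "1 / real (Suc n) < e"
        using reals_Archimedean[of e] by (auto simp: inverse_eq_divide)
      then show "infdist x F \<le> 0 + e"
        using x unfolding G_def by (smt (verit, best) INT_E UNIV_I mem_Collect_eq)
    qed
    then show "x \<in> F"
      using in_closed_iff_infdist_zero[OF F False] infdist_nonneg[of x F] by auto
  qed (auto simp: G_def)
  moreover have "(INF n. emeasure \<nu> (G n)) = emeasure \<nu> (\<Inter>n. G n)"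
  proof (rule INF_emeasure_decseq)
    show "decseq G"
      unfolding G_def
    proof (rule decseq_SucI, safe)
      fix n x assume "infdist x F \<le> 1 / real (Suc (Suc n))"
      also have "\<dots> \<le> 1 / real (Suc n)"
        by (simp add: field_simps)
      finally show "infdist x F \<le> 1 / real (Suc n)" .
    qed
  qed auto
  ultimately show ?thesis
    using INF_greatest[of UNIV "emeasure \<mu> F" "\<lambda>n. emeasure \<nu> (G n)"] le by simp
qed simp

lemma wasserstein_eq_0_imp_eq:
  fixes \<mu> \<nu> :: "'a::euclidean_space measure"
  assumes p: "p \<ge> 1" and ws: "\<mu> \<in> wasserstein_space p" "\<nu> \<in> wasserstein_space p"
    and 0: "wasserstein p euclidean_metric \<mu> \<nu> = 0"
  shows "\<mu> = \<nu>"
proof (rule measure_eqI_generator_eq[where E = "{F. closed F}" and \<Omega> = UNIV and A = "\<lambda>_. UNIV"])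
  note D = wasserstein_spaceD
  interpret \<mu>: prob_space \<mu> by (rule D[OF ws(1)])
  have "sets borel = sigma_sets UNIV {F :: 'a set. closed F}"
    unfolding borel_eq_closed by simp
  then show "sets \<mu> = sigma_sets UNIV {F. closed F}" "sets \<nu> = sigma_sets UNIV {F. closed F}"
    using D(1)[OF ws(1)] D(1)[OF ws(2)] by simp_all
  show "emeasure \<mu> UNIV \<noteq> \<infinity>" for i :: nat
    by simp
  fix F :: "'a set" assume "F \<in> {F. closed F}"
  then show "emeasure \<mu> F = emeasure \<nu> F"
    using wasserstein_eq_0_imp_closed_le[OF p ws 0]
      wasserstein_eq_0_imp_closed_le[OF p ws(2,1)] 0
    by (intro antisym) (auto simp: wasserstein_commute[of _ _ \<nu>])
qed (auto simp: Int_stable_def)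

text \<open>The definition of \<open>Metric_space.mopen\<close> can only be unfolded under the hypothesis
  \<open>Metric_space\<close>, so measurability into \<open>wasserstein_borel\<close> needs all the metric axioms.\<close>

lemma Metric_space_wasserstein:
  assumes p: "p \<ge> 1"
  shows "Metric_space (wasserstein_space p :: 'a::euclidean_space measure set)
    (wasserstein p euclidean_metric)"
proof
  fix \<mu> \<nu> \<rho> :: "'a measure"
  show "wasserstein p euclidean_metric \<mu> \<nu> \<ge> 0"
    by (rule wasserstein_nonneg)
  show "wasserstein p euclidean_metric \<mu> \<nu> = wasserstein p euclidean_metric \<nu> \<mu>"
    by (rule wasserstein_commute)
  assume \<mu>\<nu>: "\<mu> \<in> wasserstein_space p" "\<nu> \<in> wasserstein_space p"
  then show "(wasserstein p euclidean_metric \<mu> \<nu> = 0) = (\<mu> = \<nu>)"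
    using wasserstein_eq_0_imp_eq[OF p \<mu>\<nu>] wasserstein_self[OF p] wasserstein_spaceD(1) by blast
  assume "\<rho> \<in> wasserstein_space p"
  with \<mu>\<nu> show "wasserstein p euclidean_metric \<mu> \<rho>
      \<le> wasserstein p euclidean_metric \<mu> \<nu> + wasserstein p euclidean_metric \<nu> \<rho>"
    by (intro wasserstein_triangle p)
qed

text \<open>A continuous curve is Borel. Continuity is expressed by distances to the value at each
  time, as the Wasserstein space is a metric space on a set of measures and not a topological
  type.\<close>

lemma measurable_wasserstein_borel:
  fixes \<mu> :: "real \<Rightarrow> 'a::euclidean_space measure"
  assumes p: "p \<ge> 1" and ws: "\<And>t. t \<in> S \<Longrightarrow> \<mu> t \<in> wasserstein_space p"
    and cont: "\<And>t. t \<in> S \<Longrightarrow> ((\<lambda>s. wasserstein p euclidean_metric (\<mu> t) (\<mu> s)) \<longlongrightarrow> 0) (at t within S)"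
  shows "\<mu> \<in> restrict_space borel S \<rightarrow>\<^sub>M wasserstein_borel p"
  unfolding wasserstein_borel_def
proof (rule measurable_measure_of)
  interpret Metric_space "wasserstein_space p :: 'a measure set" "wasserstein p euclidean_metric"
    by (rule Metric_space_wasserstein[OF p])
  show "{U. mopen U} \<subseteq> Pow (wasserstein_space p)"
    by (auto simp: mopen_def)
  show "\<mu> \<in> space (restrict_space borel S) \<rightarrow> wasserstein_space p"
    using ws by (auto simp: space_restrict_space)
  fix U :: "'a measure set" assume "U \<in> {U. mopen U}"
  then have U: "mopen U"
    by simp
  have "openin (top_of_set S) {s \<in> S. \<mu> s \<in> U}"
    unfolding openin_euclidean_subtopology_iff
  proof safe
    fix t assume t: "t \<in> S" "\<mu> t \<in> U"
    then obtain r where r: "r > 0" "mball (\<mu> t) r \<subseteq> U"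
      using U unfolding mopen_def by blast
    have "\<forall>\<^sub>F s in at t within S. wasserstein p euclidean_metric (\<mu> t) (\<mu> s) < r"
      using order_tendstoD(2)[OF cont[OF t(1)] r(1)] .
    then obtain d where d: "d > 0"
      "\<And>s. s \<in> S \<Longrightarrow> s \<noteq> t \<Longrightarrow> dist s t < d \<Longrightarrow> wasserstein p euclidean_metric (\<mu> t) (\<mu> s) < r"
      unfolding eventually_at by blast
    have "\<mu> s \<in> U" if "s \<in> S" "dist s t < d" for s
    proof (cases "s = t")
      case False
      then have "\<mu> s \<in> mball (\<mu> t) r"
        using d(2)[OF that(1) False that(2)] ws t that by simp
      then show ?thesis
        using r by blast
    qed (use t in simp)
    then show "\<exists>e>0. \<forall>s\<in>S. dist s t < e \<longrightarrow> s \<in> {s \<in> S. \<mu> s \<in> U}"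
      using d(1) by blast
  qed
  then obtain V where "open V" "{s \<in> S. \<mu> s \<in> U} = S \<inter> V"
    by (auto simp: openin_open)
  moreover have "\<mu> -` U \<inter> space (restrict_space borel S) = {s \<in> S. \<mu> s \<in> U}"
    by (auto simp: space_restrict_space)
  ultimately show "\<mu> -` U \<inter> space (restrict_space borel S) \<in> sets (restrict_space borel S)"
    by (auto simp: sets_restrict_space)
qed

section \<open>Exponentially weighted estimates\<close>

text \<open>The Bielecki norm. It is equivalent to the supremum norm, with constants 1 and exp(cT),
  but integration in time is a contraction for it once c is large.\<close>

definition weighted_norm :: "real \<Rightarrow> real \<Rightarrow> (real \<Rightarrow> 'a::real_normed_vector) \<Rightarrow> real" where
  "weighted_norm c T x = sup_norm T (\<lambda>t. exp (- (c * t)) *\<^sub>R x t)"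

lemma continuous_on_weighted:
  "continuous_on S x \<Longrightarrow> continuous_on S (\<lambda>t. exp (- (c * t)) *\<^sub>R (x t :: 'a::real_normed_vector))"
  by (intro continuous_intros)

lemma norm_le_weighted_norm:
  assumes "continuous_on {0..T} x" "t \<in> {0..T}"
  shows "norm (x t) \<le> weighted_norm c T x * exp (c * t)"
  using norm_le_sup_norm[OF continuous_on_weighted[OF assms(1)] assms(2), of c]
  by (simp add: weighted_norm_def exp_minus field_simps)

lemma weighted_norm_le:
  assumes "T \<ge> 0" "\<And>t. t \<in> {0..T} \<Longrightarrow> norm (x t) \<le> B * exp (c * t)"
  shows "weighted_norm c T x \<le> B"
  unfolding weighted_norm_def
  using assms by (intro sup_norm_le) (auto simp: exp_minus field_simps)

lemma weighted_norm_nonneg: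
  assumes "T \<ge> 0" "continuous_on {0..T} x"
  shows "weighted_norm c T x \<ge> 0"
  unfolding weighted_norm_def using assms by (intro sup_norm_nonneg continuous_on_weighted)

lemma weighted_norm_le_sup_norm:
  assumes "T \<ge> 0" "c \<ge> 0" "continuous_on {0..T} x"
  shows "weighted_norm c T x \<le> sup_norm T x"
proof (rule weighted_norm_le[OF assms(1)])
  fix t assume t: "t \<in> {0..T}"
  have "norm (x t) \<le> sup_norm T x"
    by (rule norm_le_sup_norm[OF assms(3) t])
  also have "\<dots> \<le> sup_norm T x * exp (c * t)"
    using sup_norm_nonneg[OF assms(1,3)] assms t by (simp add: mult_le_cancel_left1)
  finally show "norm (x t) \<le> sup_norm T x * exp (c * t)" .
qed

lemma sup_norm_le_weighted_norm:
  assumes "T \<ge> 0" "c \<ge> 0" "continuous_on {0..T} x"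
  shows "sup_norm T x \<le> exp (c * T) * weighted_norm c T x"
proof (rule sup_norm_le[OF assms(1)])
  fix t assume t: "t \<in> {0..T}"
  have "norm (x t) \<le> weighted_norm c T x * exp (c * t)"
    by (rule norm_le_weighted_norm[OF assms(3) t])
  also have "\<dots> \<le> weighted_norm c T x * exp (c * T)"
    using weighted_norm_nonneg[OF assms(1,3)] assms t by (intro mult_left_mono) (auto intro: mult_left_mono)
  finally show "norm (x t) \<le> exp (c * T) * weighted_norm c T x"
    by (simp add: mult.commute)
qed

lemma borel_measurable_weighted_norm_diff:
  fixes X Y :: "'w \<Rightarrow> real \<Rightarrow> 'a::euclidean_space"
  assumes T: "T \<ge> 0" and X: "X \<in> M \<rightarrow>\<^sub>M path_borel T" and Y: "Y \<in> M \<rightarrow>\<^sub>M path_borel T"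
  shows "(\<lambda>\<omega>. weighted_norm c T (\<lambda>t. X \<omega> t - Y \<omega> t)) \<in> borel_measurable M"
  unfolding weighted_norm_def
proof (rule borel_measurable_sup_norm[OF T])
  fix \<omega> assume "\<omega> \<in> space M"
  then show "continuous_on {0..T} (\<lambda>t. exp (- (c * t)) *\<^sub>R (X \<omega> t - Y \<omega> t))"
    using X Y by (intro continuous_on_weighted continuous_on_diff) (auto intro: measurable_path_borel_continuous)
next
  fix t assume t: "t \<in> {0..T}"
  have [measurable]: "(\<lambda>\<omega>. X \<omega> t) \<in> borel_measurable M" "(\<lambda>\<omega>. Y \<omega> t) \<in> borel_measurable M"
    using measurable_path_eval[OF X t] measurable_path_eval[OF Y t] by auto
  show "(\<lambda>\<omega>. exp (- (c * t)) *\<^sub>R (X \<omega> t - Y \<omega> t)) \<in> borel_measurable M"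
    by measurable
qed

text \<open>The gain from the weight: integrating exp(cs) up to time t costs a factor 1/c that does
  not depend on t. Hence no restriction to short time intervals arises.\<close>

lemma norm_set_integral_le_exp:
  fixes f :: "real \<Rightarrow> 'a::euclidean_space"
  assumes t: "t \<ge> 0" and c: "c > 0" and B: "B \<ge> 0" and f: "set_integrable lborel {0..t} f"
    and bound: "\<And>s. s \<in> {0..t} \<Longrightarrow> norm (f s) \<le> B * exp (c * s)"
  shows "norm (LBINT s:{0..t}. f s) \<le> B / c * exp (c * t)"
proof -
  have exp: "set_integrable lborel {0..t} (\<lambda>s. B * exp (c * s))"
    by (intro borel_integrable_atLeastAtMost' continuous_intros)
  have "norm (LBINT s:{0..t}. f s) \<le> (LBINT s:{0..t}. norm (f s))"
    by (rule set_integral_norm_bound[OF f])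
  also have "\<dots> \<le> (LBINT s:{0..t}. B * exp (c * s))"
    using bound by (intro set_integral_mono set_integrable_norm f exp) auto
  also have "\<dots> = integral {0..t} (\<lambda>s. B * exp (c * s))"
    by (rule set_borel_integral_eq_integral[OF exp])
  also have "\<dots> = B / c * exp (c * t) - B / c * exp (c * 0)"
    using t c by (intro integral_unique fundamental_theorem_of_calculus)
      (auto intro!: derivative_eq_intros simp: has_real_derivative_iff_has_vector_derivative[symmetric])
  also have "\<dots> \<le> B / c * exp (c * t)"
    using B c by simp
  finally show ?thesis .
qed

section \<open>Lipschitz drifts and flows of laws\<close>

abbreviation marginal :: "'w measure \<Rightarrow> ('w \<Rightarrow> real \<Rightarrow> 'a::euclidean_space) \<Rightarrow> real \<Rightarrow> 'a measure" where
  "marginal M X t \<equiv> distr M borel (\<lambda>\<omega>. X \<omega> t)"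

text \<open>The Lipschitz condition is taken in linear form instead of with p-th powers, since it is
  integrated along single paths. It compares values at equal times only; the dependence on time is
  controlled by \<open>b_integrable\<close>.\<close>

locale lipschitz_drift =
  fixes T p L :: real and b :: "real \<Rightarrow> 'a::euclidean_space \<Rightarrow> 'a measure \<Rightarrow> 'a"
  assumes T: "T > 0" and p: "p \<ge> 1" and L: "L \<ge> 0"
    and b_measurable: "(\<lambda>(t, x, \<mu>). b t x \<mu>) \<in>
      restrict_space borel {0..T} \<Otimes>\<^sub>M borel \<Otimes>\<^sub>M wasserstein_borel p \<rightarrow>\<^sub>M borel"
    and b_lipschitz: "\<And>t x x' \<mu> \<mu>'. t \<in> {0..T} \<Longrightarrow>
      \<mu> \<in> wasserstein_space p \<Longrightarrow> \<mu>' \<in> wasserstein_space p \<Longrightarrow>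
      norm (b t x \<mu> - b t x' \<mu>')
        \<le> L * (norm (x - x') + wasserstein p euclidean_metric \<mu> \<mu>')"
    and b_integrable: "set_integrable lborel {0..T} (\<lambda>t. b t 0 (return borel 0))"
begin

lemma T0: "T \<ge> 0"
  using T by simp

abbreviation wdist :: "'a measure \<Rightarrow> 'a measure \<Rightarrow> real" where
  "wdist \<equiv> wasserstein p euclidean_metric"

text \<open>With this exponential weight, the drift is a contraction with factor \<open>L / rate \<le> 1/8\<close> in
  each of its two arguments.\<close>

definition rate :: real where
  "rate = 8 * L + 1"

lemma rate: "rate > 0" "L / rate \<le> 1 / 8"
  using L by (auto simp: rate_def field_simps)

abbreviation wdiff :: "(real \<Rightarrow> 'a) \<Rightarrow> (real \<Rightarrow> 'a) \<Rightarrow> real" where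
  "wdiff x y \<equiv> weighted_norm rate T (\<lambda>t. x t - y t)"

lemma integral_diff_le:
  fixes f g :: "real \<Rightarrow> 'a"
  assumes t: "t \<ge> 0" and f: "set_integrable lborel {0..t} f" and g: "set_integrable lborel {0..t} g"
    and D: "D \<ge> 0"
    and bound: "\<And>s. s \<in> {0..t} \<Longrightarrow> norm (f s - g s) \<le> L * (D * exp (rate * s))"
  shows "norm ((LBINT s:{0..t}. f s) - (LBINT s:{0..t}. g s)) \<le> D / 8 * exp (rate * t)"
proof -
  have "(LBINT s:{0..t}. f s) - (LBINT s:{0..t}. g s) = (LBINT s:{0..t}. f s - g s)"
    by (rule set_integral_diff(2)[OF f g, symmetric])
  also have "norm \<dots> \<le> L * D / rate * exp (rate * t)"
    using bound D L rate
    by (intro norm_set_integral_le_exp t set_integral_diff(1)[OF f g]) (auto simp: mult.assoc)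
  also have "L * D / rate = D * (L / rate)"
    by simp
  also have "D * (L / rate) * exp (rate * t) \<le> D * (1 / 8) * exp (rate * t)"
    using D rate by (intro mult_right_mono mult_left_mono) auto
  finally show ?thesis
    by simp
qed

text \<open>A deterministic estimate in which \<open>V\<close> stands for the weighted distance of
  the two flows of laws. With D the weighted distance of the paths and A that of the inputs, D \<le>
  A + (D + V)/8; D is finite, so it can be absorbed, and rounding the constants up gives the claim.
  This takes the place of Gronwall's inequality.\<close>

lemma path_stability:
  fixes x y w w' f g :: "real \<Rightarrow> 'a"
  assumes cont: "continuous_on {0..T} x" "continuous_on {0..T} y"
      "continuous_on {0..T} w" "continuous_on {0..T} w'"
    and f: "\<And>t. t \<in> {0..T} \<Longrightarrow> set_integrable lborel {0..t} f"
    and g: "\<And>t. t \<in> {0..T} \<Longrightarrow> set_integrable lborel {0..t} g"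
    and x: "\<And>t. t \<in> {0..T} \<Longrightarrow> x t = z + (LBINT s:{0..t}. f s) + w t"
    and y: "\<And>t. t \<in> {0..T} \<Longrightarrow> y t = z' + (LBINT s:{0..t}. g s) + w' t"
    and V: "V \<ge> 0"
    and fg: "\<And>s. s \<in> {0..T} \<Longrightarrow> norm (f s - g s) \<le> L * (norm (x s - y s) + V * exp (rate * s))"
  shows "wdiff x y \<le> 2 * (norm (z - z') + sup_dist T w w') + V / 4"
proof -
  define D where "D = wdiff x y"
  define A where "A = norm (z - z') + sup_dist T w w'"
  have cd: "continuous_on {0..T} (\<lambda>t. x t - y t)" "continuous_on {0..T} (\<lambda>t. w t - w' t)"
    using cont by (auto intro: continuous_on_diff)
  have D0: "D \<ge> 0"
    unfolding D_def by (rule weighted_norm_nonneg[OF T0 cd(1)])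
  have A0: "A \<ge> 0"
    unfolding A_def using sup_norm_nonneg[OF T0 cd(2)] by simp
  have "D \<le> A + (D + V) / 8"
    unfolding D_def
  proof (rule weighted_norm_le[OF T0], fold D_def)
    fix t assume t: "t \<in> {0..T}"
    have "norm ((LBINT s:{0..t}. f s) - (LBINT s:{0..t}. g s)) \<le> (D + V) / 8 * exp (rate * t)"
    proof (rule integral_diff_le)
      fix s assume "s \<in> {0..t}"
      then have s: "s \<in> {0..T}"
        using t by auto
      have "norm (f s - g s) \<le> L * (norm (x s - y s) + V * exp (rate * s))"
        by (rule fg[OF s])
      also have "\<dots> \<le> L * (D * exp (rate * s) + V * exp (rate * s))"
        using norm_le_weighted_norm[OF cd(1) s, of rate] L
        by (intro mult_left_mono add_right_mono) (auto simp: D_def)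
      finally show "norm (f s - g s) \<le> L * ((D + V) * exp (rate * s))"
        by (simp add: distrib_right)
    qed (use t f g D0 V in auto)
    moreover have "norm (w t - w' t) \<le> sup_dist T w w'"
      by (rule norm_le_sup_norm[OF cd(2) t])
    moreover have "x t - y t = (z - z') + ((LBINT s:{0..t}. f s) - (LBINT s:{0..t}. g s)) + (w t - w' t)"
      using x[OF t] y[OF t] by simp
    then have "norm (x t - y t) \<le> norm (z - z') + norm ((LBINT s:{0..t}. f s) - (LBINT s:{0..t}. g s))
        + norm (w t - w' t)"
      by (metis norm_triangle_le add_right_mono norm_triangle_ineq)
    moreover have "A \<le> A * exp (rate * t)"
      using A0 t rate by (simp add: mult_le_cancel_left1)
    ultimately show "norm (x t - y t) \<le> (A + (D + V) / 8) * exp (rate * t)"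
      unfolding distrib_right[of A] unfolding A_def by linarith
  qed
  then have "8 * D \<le> 8 * A + (D + V)"
    by (simp add: field_simps)
  with A0 V have "D \<le> 2 * A + V / 4"
    by simp
  then show ?thesis
    by (simp add: D_def A_def)
qed

text \<open>What is needed to integrate the drift along a continuous path. Boundedness is measured
  from the Dirac mass at 0 because \<open>b_integrable\<close> controls the drift there.\<close>

definition flow :: "(real \<Rightarrow> 'a measure) \<Rightarrow> bool" where
  "flow \<mu> \<longleftrightarrow> (\<forall>t\<in>{0..T}. \<mu> t \<in> wasserstein_space p) \<and>
    \<mu> \<in> restrict_space borel {0..T} \<rightarrow>\<^sub>M wasserstein_borel p \<and>
    (\<exists>B. \<forall>t\<in>{0..T}. wdist (\<mu> t) (return borel 0) \<le> B)"

lemma return_in_wasserstein_space: "return borel (0 :: 'a) \<in> wasserstein_space p"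
  by (intro wasserstein_spaceI prob_space_return) (auto simp: nn_integral_return)

text \<open>The Lipschitz condition dominates the drift by the integrable function |b(s, 0,
  \<delta>_0)| plus a constant, as path and flow are bounded. Measurability of the integrand is the
  place where the flow has to be measurable into \<open>wasserstein_borel p\<close>.\<close>

lemma drift_integrable:
  assumes \<mu>: "flow \<mu>" and x: "continuous_on {0..T} x"
  shows "set_integrable lborel {0..T} (\<lambda>s. b s (x s) (\<mu> s))"
proof -
  obtain B where B: "\<And>t. t \<in> {0..T} \<Longrightarrow> wdist (\<mu> t) (return borel 0) \<le> B"
    using \<mu> unfolding flow_def by blast
  have [measurable]: "\<mu> \<in> restrict_space borel {0..T} \<rightarrow>\<^sub>M wasserstein_borel p"
    using \<mu> by (simp add: flow_def)
  have [measurable]: "x \<in> borel_measurable (restrict_space borel {0..T})"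
    by (rule borel_measurable_continuous_on_restrict[OF x])
  have "(\<lambda>s. (s, x s, \<mu> s)) \<in> restrict_space borel {0..T} \<rightarrow>\<^sub>M
      restrict_space borel {0..T} \<Otimes>\<^sub>M borel \<Otimes>\<^sub>M wasserstein_borel p"
    by measurable
  from measurable_compose[OF this b_measurable]
  have m: "(\<lambda>s. b s (x s) (\<mu> s)) \<in> borel_measurable (restrict_space borel {0..T})"
    by simp
  have "set_integrable lborel {0..T} (\<lambda>s. norm (b s 0 (return borel 0)) + L * (sup_norm T x + B))"
    by (intro set_integral_add set_integrable_norm b_integrable borel_integrable_atLeastAtMost') auto
  then show ?thesis
  proof (rule set_integrable_bound)
    show "set_borel_measurable lborel {0..T} (\<lambda>s. b s (x s) (\<mu> s))"
      using m by (simp add: set_borel_measurable_def borel_measurable_restrict_space_iff)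
    show "AE s in lborel. s \<in> {0..T} \<longrightarrow>
        norm (b s (x s) (\<mu> s)) \<le> norm (norm (b s 0 (return borel 0)) + L * (sup_norm T x + B))"
    proof (intro AE_I2 impI)
      fix s assume s: "s \<in> {0..T}"
      have "norm (b s (x s) (\<mu> s) - b s 0 (return borel 0)) \<le> L * (norm (x s - 0) + wdist (\<mu> s) (return borel 0))"
        using \<mu> s unfolding flow_def by (intro b_lipschitz return_in_wasserstein_space) blast+
      also have "\<dots> \<le> L * (sup_norm T x + B)"
        using norm_le_sup_norm[OF x s] B[OF s] L by (intro mult_left_mono add_mono) auto
      finally have "norm (b s (x s) (\<mu> s)) \<le> norm (b s 0 (return borel 0)) + L * (sup_norm T x + B)"
        using norm_triangle_sub[of "b s (x s) (\<mu> s)" "b s 0 (return borel 0)"] by linarith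
      then show "norm (b s (x s) (\<mu> s)) \<le> norm (norm (b s 0 (return borel 0)) + L * (sup_norm T x + B))"
        by simp
    qed
  qed
qed

text \<open>The space L^p(\<Omega>, C_T).\<close>

definition process :: "'w measure \<Rightarrow> ('w \<Rightarrow> real \<Rightarrow> 'a) \<Rightarrow> bool" where
  "process M X \<longleftrightarrow> X \<in> M \<rightarrow>\<^sub>M path_borel T \<and>
    moment p M (\<lambda>\<omega>. sup_norm T (X \<omega>)) < \<infinity>"

lemma wdist_marginal_le:
  assumes X: "X \<in> M \<rightarrow>\<^sub>M path_borel T" and Y: "Y \<in> M \<rightarrow>\<^sub>M path_borel T" and s: "s \<in> {0..T}" "t \<in> {0..T}"
  shows "ennreal (wdist (marginal M X s) (marginal M Y t) powr p)
    \<le> moment p M (\<lambda>\<omega>. norm (X \<omega> s - Y \<omega> t))"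
  using wasserstein_distr_le[OF p measurable_path_eval[OF X s(1)] measurable_path_eval[OF Y s(2)], of euclidean_metric]
  by (simp add: dist_norm)

lemma borel_measurable_process_sup_norm:
  assumes "X \<in> M \<rightarrow>\<^sub>M path_borel T"
  shows "(\<lambda>\<omega>. sup_norm T (X \<omega> :: real \<Rightarrow> 'a)) \<in> borel_measurable M"
  using assms by (intro borel_measurable_sup_norm T0)
    (auto intro: measurable_path_borel_continuous measurable_path_eval)

lemma marginal_in_wasserstein_space:
  assumes M: "prob_space M" and X: "process M X" and t: "t \<in> {0..T}"
  shows "marginal M X t \<in> wasserstein_space p"
proof (rule wasserstein_spaceI)
  interpret prob_space M by fact
  have Xm: "X \<in> M \<rightarrow>\<^sub>M path_borel T"
    using X by (simp add: process_def)
  have [measurable]: "(\<lambda>\<omega>. X \<omega> t) \<in> borel_measurable M"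
    by (rule measurable_path_eval[OF Xm t])
  show "prob_space (marginal M X t)"
    by (rule prob_space_distr) measurable
  have "moment p (marginal M X t) (\<lambda>x. norm x) = moment p M (\<lambda>\<omega>. norm (X \<omega> t))"
    by (subst nn_integral_distr) auto
  also have "\<dots> \<le> moment p M (\<lambda>\<omega>. sup_norm T (X \<omega>))"
    using p Xm t
    by (intro nn_integral_mono ennreal_leI powr_mono2) (auto intro!: norm_le_sup_norm measurable_path_borel_continuous)
  also have "\<dots> < \<infinity>"
    using X by (simp add: process_def)
  finally show "moment p (marginal M X t) (\<lambda>x. norm x) < \<infinity>" .
qed simp

lemma wdist_le_powr_inverse:
  assumes "ennreal (wdist \<mu> \<nu> powr p) \<le> I" "I < \<infinity>"
  shows "wdist \<mu> \<nu> \<le> enn2real I powr (1 / p)"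
proof -
  have "wdist \<mu> \<nu> powr p \<le> enn2real I"
    using assms by (cases I) auto
  then have "(wdist \<mu> \<nu> powr p) powr (1 / p) \<le> enn2real I powr (1 / p)"
    using p by (intro powr_mono2) auto
  then show ?thesis
    using p by (simp add: powr_powr wasserstein_nonneg)
qed

text \<open>The paths are continuous in time and dominated by their supremum, which has a p-th
  moment. Dominated convergence makes the marginals continuous for W_p, and continuity gives
  measurability.\<close>

lemma process_flow:
  assumes M: "prob_space M" and X: "process M X"
  shows "flow (marginal M X)"
  unfolding flow_def
proof (intro conjI ballI)
  interpret prob_space M by fact
  have Xm: "X \<in> M \<rightarrow>\<^sub>M path_borel T"
    using X by (simp add: process_def)
  note ev[measurable] = measurable_path_eval[OF Xm]
  note sup[measurable] = borel_measurable_process_sup_norm[OF Xm]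
  have le_sup: "norm (X \<omega> t) \<le> sup_norm T (X \<omega>)" if "\<omega> \<in> space M" "t \<in> {0..T}" for \<omega> t
    by (rule norm_le_sup_norm[OF measurable_path_borel_continuous[OF Xm that(1)] that(2)])
  let ?I = "\<integral>\<^sup>+\<omega>. ennreal (sup_norm T (X \<omega>) powr p) \<partial>M"
  have fin: "?I < \<infinity>"
    using X by (simp add: process_def)
  show ws: "marginal M X t \<in> wasserstein_space p" if "t \<in> {0..T}" for t
    by (rule marginal_in_wasserstein_space[OF M X that])
  show "\<exists>B. \<forall>t\<in>{0..T}. wdist (marginal M X t) (return borel 0) \<le> B"
  proof (intro exI ballI)
    fix t assume t: "t \<in> {0..T}"
    have "ennreal (wdist (marginal M X t) (return borel 0) powr p) \<le> moment p M (\<lambda>\<omega>. norm (X \<omega> t))"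
      using wasserstein_distr_le[OF p ev[OF t], of "\<lambda>_. 0" euclidean_metric] by (simp add: distr_const)
    also have "\<dots> \<le> ?I"
      using p t by (intro nn_integral_mono ennreal_leI powr_mono2 le_sup) auto
    finally show "wdist (marginal M X t) (return borel 0) \<le> enn2real ?I powr (1 / p)"
      using fin by (rule wdist_le_powr_inverse)
  qed
  show "marginal M X \<in> restrict_space borel {0..T} \<rightarrow>\<^sub>M wasserstein_borel p"
  proof (rule measurable_wasserstein_borel[OF p ws])
    fix t assume t: "t \<in> {0..T}"
    show "((\<lambda>s. wdist (marginal M X t) (marginal M X s)) \<longlongrightarrow> 0) (at t within {0..T})"
      \<comment> \<open>Sequences of times, because dominated convergence is a statement about
        sequences.\<close>
      unfolding tendsto_at_iff_sequentially
    proof (intro allI impI)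
      fix \<tau> :: "nat \<Rightarrow> real" assume \<tau>: "\<forall>n. \<tau> n \<in> {0..T} - {t}" "\<tau> \<longlonglongrightarrow> t"
      have \<tau>T: "\<tau> n \<in> {0..T}" for n
        using \<tau> by auto
      note [measurable] = ev[OF t] ev[OF \<tau>T]
      define J where "J n = moment p M (\<lambda>\<omega>. norm (X \<omega> t - X \<omega> (\<tau> n)))" for n
      have "J \<longlonglongrightarrow> (\<integral>\<^sup>+\<omega>. 0 \<partial>M)"
        unfolding J_def
      proof (rule nn_integral_dominated_convergence)
        show "AE \<omega> in M. ennreal (norm (X \<omega> t - X \<omega> (\<tau> n)) powr p)
            \<le> ennreal (2 powr p) * ennreal (sup_norm T (X \<omega>) powr p)" for n
        proof (intro AE_I2)
          fix \<omega> assume \<omega>: "\<omega> \<in> space M"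
          have "norm (X \<omega> t - X \<omega> (\<tau> n)) \<le> 2 * sup_norm T (X \<omega>)"
            using norm_triangle_ineq4[of "X \<omega> t" "X \<omega> (\<tau> n)"] le_sup[OF \<omega> t] le_sup[OF \<omega> \<tau>T[of n]] by linarith
          then have "norm (X \<omega> t - X \<omega> (\<tau> n)) powr p \<le> (2 * sup_norm T (X \<omega>)) powr p"
            using p by (intro powr_mono2) auto
          also have "\<dots> = 2 powr p * sup_norm T (X \<omega>) powr p"
            using order_trans[OF norm_ge_zero le_sup[OF \<omega> t]] by (simp add: powr_mult)
          finally show "ennreal (norm (X \<omega> t - X \<omega> (\<tau> n)) powr p)
            \<le> ennreal (2 powr p) * ennreal (sup_norm T (X \<omega>) powr p)"
            by (simp add: ennreal_mult'[symmetric])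
        qed
        show "(\<integral>\<^sup>+\<omega>. ennreal (2 powr p) * ennreal (sup_norm T (X \<omega>) powr p) \<partial>M) < \<infinity>"
          using fin by (simp add: nn_integral_cmult ennreal_mult_less_top)
        show "AE \<omega> in M. (\<lambda>n. ennreal (norm (X \<omega> t - X \<omega> (\<tau> n)) powr p)) \<longlonglongrightarrow> 0"
        proof (intro AE_I2)
          fix \<omega> assume \<omega>: "\<omega> \<in> space M"
          have "(\<lambda>n. X \<omega> (\<tau> n)) \<longlonglongrightarrow> X \<omega> t"
            using continuous_on_tendsto_compose[OF measurable_path_borel_continuous[OF Xm \<omega>] \<tau>(2) t] \<tau>T by simp
          then have "(\<lambda>n. norm (X \<omega> t - X \<omega> (\<tau> n))) \<longlonglongrightarrow> norm (X \<omega> t - X \<omega> t)"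
            by (intro tendsto_intros)
          then have "(\<lambda>n. norm (X \<omega> t - X \<omega> (\<tau> n)) powr p) \<longlonglongrightarrow> norm (X \<omega> t - X \<omega> t) powr p"
            using p by (intro tendsto_powr2) auto
          then show "(\<lambda>n. ennreal (norm (X \<omega> t - X \<omega> (\<tau> n)) powr p)) \<longlonglongrightarrow> 0"
            using tendsto_ennrealI[of _ 0 sequentially] by simp
        qed
      qed measurable
      then have J: "J \<longlonglongrightarrow> 0"
        by simp
      have le: "ennreal (wdist (marginal M X t) (marginal M X (\<tau> n)) powr p) \<le> J n" for n
        unfolding J_def by (rule wdist_marginal_le[OF Xm Xm t \<tau>T])
      have "(\<lambda>n. ennreal (wdist (marginal M X t) (marginal M X (\<tau> n)) powr p)) \<longlonglongrightarrow> 0"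
        by (rule tendsto_sandwich[OF _ _ tendsto_const J]) (auto simp: le)
      then have "(\<lambda>n. wdist (marginal M X t) (marginal M X (\<tau> n)) powr p) \<longlonglongrightarrow> 0"
        by (intro tendsto_ennrealD[where x = 0]) auto
      then have "(\<lambda>n. (wdist (marginal M X t) (marginal M X (\<tau> n)) powr p) powr (1 / p)) \<longlonglongrightarrow> 0 powr (1 / p)"
        using p by (intro tendsto_powr2) auto
      then show "((\<lambda>s. wdist (marginal M X t) (marginal M X s)) \<circ> \<tau>) \<longlonglongrightarrow> 0"
        using p by (simp add: powr_powr wasserstein_nonneg comp_def)
    qed
  qed
qed

end

section \<open>Finiteness of p-th moments\<close>

lemma powr_le_imp_le:
  fixes a b p :: real
  assumes "a powr p \<le> b powr p" "b \<ge> 0" "p > 0"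
  shows "a \<le> b"
  using powr_less_mono2[of p b a] assms by (cases "a \<le> b") auto

text \<open>\<open>V\<close> is the p-norm belonging to the moment \<open>I\<close>. The pathwise
  estimates take it as a real parameter.\<close>

lemma finite_ennreal_eq_powr:
  fixes p :: real
  assumes "p > 0" "I < \<infinity>"
  obtains V where "V \<ge> 0" "ennreal (V powr p) = I"
proof (cases I)
  case (real r)
  then show ?thesis
    using assms(1) that[of "r powr (1 / p)"] by (simp add: powr_powr)
qed (use assms in simp)

lemma nn_integral_powr_add_finite:
  fixes f g :: "'w \<Rightarrow> real"
  assumes [measurable]: "f \<in> borel_measurable M" "g \<in> borel_measurable M"
    and nn: "\<And>\<omega>. \<omega> \<in> space M \<Longrightarrow> f \<omega> \<ge> 0" "\<And>\<omega>. \<omega> \<in> space M \<Longrightarrow> g \<omega> \<ge> 0" and p: "p \<ge> 0"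
    and fin: "moment p M f < \<infinity>" "moment p M g < \<infinity>"
  shows "moment p M (\<lambda>\<omega>. f \<omega> + g \<omega>) < \<infinity>"
proof -
  have "moment p M (\<lambda>\<omega>. f \<omega> + g \<omega>)
    \<le> (\<integral>\<^sup>+\<omega>. ennreal (2 powr p) * (ennreal (f \<omega> powr p) + ennreal (g \<omega> powr p)) \<partial>M)"
    using powr_add_le[OF nn p]
    by (intro nn_integral_mono) (simp add: ennreal_mult'[symmetric] ennreal_plus[symmetric] del: ennreal_plus)
  also have "\<dots> = ennreal (2 powr p) * (moment p M f + moment p M g)"
    by (simp add: nn_integral_cmult nn_integral_add)
  also have "\<dots> < \<infinity>"
    using fin by (simp add: ennreal_mult_less_top)
  finally show ?thesis .
qed

lemma nn_integral_powr_cmult_finite: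
  fixes f :: "'w \<Rightarrow> real"
  assumes [measurable]: "f \<in> borel_measurable M"
    and nn: "\<And>\<omega>. \<omega> \<in> space M \<Longrightarrow> f \<omega> \<ge> 0" and c: "c \<ge> 0"
    and fin: "moment p M f < \<infinity>"
  shows "moment p M (\<lambda>\<omega>. c * f \<omega>) < \<infinity>"
proof -
  have "moment p M (\<lambda>\<omega>. c * f \<omega>) = (\<integral>\<^sup>+\<omega>. ennreal (c powr p) * ennreal (f \<omega> powr p) \<partial>M)"
    using nn c by (intro nn_integral_cong) (simp add: powr_mult ennreal_mult'[symmetric])
  also have "\<dots> < \<infinity>"
    using fin by (simp add: nn_integral_cmult ennreal_mult_less_top)
  finally show ?thesis .
qed

lemma nn_integral_powr_mono_finite:
  fixes f g :: "'w \<Rightarrow> real"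
  assumes "p \<ge> 0" "moment p M g < \<infinity>"
    and "AE \<omega> in M. 0 \<le> f \<omega> \<and> f \<omega> \<le> g \<omega>"
  shows "moment p M f < \<infinity>"
proof -
  have "moment p M f \<le> moment p M g"
    by (intro nn_integral_mono_AE eventually_mono[OF assms(3)] ennreal_leI powr_mono2)
      (use assms(1) in auto)
  with assms(2) show ?thesis
    by simp
qed

lemma sup_norm_triangle:
  fixes x y :: "real \<Rightarrow> 'a::real_normed_vector"
  assumes "T \<ge> 0" "continuous_on {0..T} x" "continuous_on {0..T} y"
  shows "sup_dist T x y \<le> sup_norm T x + sup_norm T y"
proof (rule sup_norm_le[OF assms(1)])
  fix t assume t: "t \<in> {0..T}"
  show "norm (x t - y t) \<le> sup_norm T x + sup_norm T y"
    using norm_triangle_ineq4[of "x t" "y t"] norm_le_sup_norm[OF assms(2) t] norm_le_sup_norm[OF assms(3) t]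
    by linarith
qed

lemma sup_norm_triangle_sub:
  fixes x y :: "real \<Rightarrow> 'a::real_normed_vector"
  assumes "T \<ge> 0" "continuous_on {0..T} x" "continuous_on {0..T} y"
  shows "sup_norm T x \<le> sup_norm T y + sup_dist T x y"
proof (rule sup_norm_le[OF assms(1)])
  fix t assume t: "t \<in> {0..T}"
  show "norm (x t) \<le> sup_norm T y + sup_dist T x y"
    using norm_triangle_sub[of "x t" "y t"] norm_le_sup_norm[OF assms(3) t]
      norm_le_sup_norm[OF continuous_on_diff[OF assms(2,3)] t]
    by linarith
qed

section \<open>Stability and uniqueness of solutions\<close>

context lipschitz_drift
begin

lemma p_pos: "p > 0"
  using p by simp

abbreviation solution where
  "solution \<equiv> mckean_vlasov_solution p T b"

definition input :: "'w measure \<Rightarrow> ('w \<Rightarrow> 'a) \<Rightarrow> ('w \<Rightarrow> real \<Rightarrow> 'a) \<Rightarrow> bool" where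
  "input M \<zeta> w \<longleftrightarrow> \<zeta> \<in> borel_measurable M \<and> moment p M (\<lambda>\<omega>. norm (\<zeta> \<omega>)) < \<infinity> \<and> process M w"

text \<open>The distance of two inputs in the norm |x| + \<parallel>\<gamma>\<parallel>, the form in
  which they enter the integral equation. It is related to the product metric in
  \<open>gap_le_mdist\<close>.\<close>

definition gap :: "'a \<Rightarrow> (real \<Rightarrow> 'a) \<Rightarrow> 'a \<Rightarrow> (real \<Rightarrow> 'a) \<Rightarrow> real" where
  "gap z w z' w' = norm (z - z') + sup_dist T w w'"

lemma process_measurable: "process M X \<Longrightarrow> X \<in> M \<rightarrow>\<^sub>M path_borel T"
  by (simp add: process_def)

lemma process_continuous: "process M X \<Longrightarrow> \<omega> \<in> space M \<Longrightarrow> continuous_on {0..T} (X \<omega>)"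
  by (intro measurable_path_borel_continuous process_measurable)

lemma process_sup_norm_nonneg: "process M X \<Longrightarrow> \<omega> \<in> space M \<Longrightarrow> sup_norm T (X \<omega>) \<ge> 0"
  by (intro sup_norm_nonneg T0 process_continuous)

lemma wdiff_nonneg: "continuous_on {0..T} x \<Longrightarrow> continuous_on {0..T} y \<Longrightarrow> wdiff x y \<ge> 0"
  by (intro weighted_norm_nonneg T0 continuous_on_diff)

text \<open>Finiteness is what later permits a multiple of this moment to be absorbed into the
  left-hand side.\<close>

lemma wdiff_finite:
  assumes X: "process M X" and Y: "process M Y"
  shows "moment p M (\<lambda>\<omega>. wdiff (X \<omega>) (Y \<omega>)) < \<infinity>"
proof (rule nn_integral_powr_mono_finite)
  show "moment p M (\<lambda>\<omega>. sup_norm T (X \<omega>) + sup_norm T (Y \<omega>)) < \<infinity>"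
    using X Y p
    by (intro nn_integral_powr_add_finite process_sup_norm_nonneg borel_measurable_process_sup_norm
        process_measurable) (auto simp: process_def)
  show "AE \<omega> in M. 0 \<le> wdiff (X \<omega>) (Y \<omega>) \<and>
      wdiff (X \<omega>) (Y \<omega>) \<le> sup_norm T (X \<omega>) + sup_norm T (Y \<omega>)"
  proof (intro AE_I2 conjI)
    fix \<omega> assume \<omega>: "\<omega> \<in> space M"
    note c = process_continuous[OF X \<omega>] process_continuous[OF Y \<omega>]
    show "0 \<le> wdiff (X \<omega>) (Y \<omega>)"
      by (rule wdiff_nonneg[OF c])
    have "wdiff (X \<omega>) (Y \<omega>) \<le> sup_dist T (X \<omega>) (Y \<omega>)"
      using rate by (intro weighted_norm_le_sup_norm T0 continuous_on_diff c) auto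
    also have "\<dots> \<le> sup_norm T (X \<omega>) + sup_norm T (Y \<omega>)"
      by (rule sup_norm_triangle[OF T0 c])
    finally show "wdiff (X \<omega>) (Y \<omega>) \<le> sup_norm T (X \<omega>) + sup_norm T (Y \<omega>)" .
  qed
qed (use p in simp)

text \<open>The values of the two processes at time t couple the marginals, and the factor exp(rate
  t) undoes the weight. The distance of the laws thus has the growth in time that the pathwise
  estimates accept.\<close>

lemma wdist_marginal_le_wdiff:
  assumes X: "X \<in> M \<rightarrow>\<^sub>M path_borel T" and Y: "Y \<in> M \<rightarrow>\<^sub>M path_borel T" and t: "t \<in> {0..T}"
    and V: "V \<ge> 0" "moment p M (\<lambda>\<omega>. wdiff (X \<omega>) (Y \<omega>)) \<le> ennreal (V powr p)"
  shows "wdist (marginal M X t) (marginal M Y t) \<le> V * exp (rate * t)"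
proof (rule powr_le_imp_le[of _ p])
  have [measurable]: "(\<lambda>\<omega>. wdiff (X \<omega>) (Y \<omega>)) \<in> borel_measurable M"
    by (rule borel_measurable_weighted_norm_diff[OF T0 X Y])
  have "ennreal (wdist (marginal M X t) (marginal M Y t) powr p)
    \<le> moment p M (\<lambda>\<omega>. norm (X \<omega> t - Y \<omega> t))"
    by (rule wdist_marginal_le[OF X Y t t])
  also have "\<dots> \<le> (\<integral>\<^sup>+\<omega>. ennreal (exp (rate * t) powr p) * ennreal (wdiff (X \<omega>) (Y \<omega>) powr p) \<partial>M)"
  proof (rule nn_integral_mono)
    fix \<omega> assume \<omega>: "\<omega> \<in> space M"
    note c = measurable_path_borel_continuous[OF X \<omega>] measurable_path_borel_continuous[OF Y \<omega>]
    have "norm (X \<omega> t - Y \<omega> t) powr p \<le> (wdiff (X \<omega>) (Y \<omega>) * exp (rate * t)) powr p"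
      using p norm_le_weighted_norm[OF continuous_on_diff[OF c] t, of rate] by (intro powr_mono2) auto
    also have "\<dots> = exp (rate * t) powr p * wdiff (X \<omega>) (Y \<omega>) powr p"
      using wdiff_nonneg[OF c] by (simp add: powr_mult)
    finally show "ennreal (norm (X \<omega> t - Y \<omega> t) powr p)
        \<le> ennreal (exp (rate * t) powr p) * ennreal (wdiff (X \<omega>) (Y \<omega>) powr p)"
      by (simp add: ennreal_mult'[symmetric])
  qed
  also have "\<dots> = ennreal (exp (rate * t) powr p) * moment p M (\<lambda>\<omega>. wdiff (X \<omega>) (Y \<omega>))"
    by (rule nn_integral_cmult) measurable
  also have "\<dots> \<le> ennreal (exp (rate * t) powr p) * ennreal (V powr p)"
    by (intro mult_left_mono V) auto
  also have "\<dots> = ennreal ((V * exp (rate * t)) powr p)"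
    using V by (simp add: powr_mult ennreal_mult'[symmetric] mult.commute)
  finally show "wdist (marginal M X t) (marginal M Y t) powr p \<le> (V * exp (rate * t)) powr p"
    by simp
qed (use V p in auto)

lemma borel_measurable_gap:
  assumes "input M \<zeta> w" "input M \<zeta>' w'"
  shows "(\<lambda>\<omega>. gap (\<zeta> \<omega>) (w \<omega>) (\<zeta>' \<omega>) (w' \<omega>)) \<in> borel_measurable M"
proof -
  have [measurable]: "\<zeta> \<in> borel_measurable M" "\<zeta>' \<in> borel_measurable M"
    using assms by (simp_all add: input_def)
  have [measurable]: "(\<lambda>\<omega>. sup_dist T (w \<omega>) (w' \<omega>)) \<in> borel_measurable M"
    using assms by (intro borel_measurable_sup_norm_diff T0 process_measurable) (simp_all add: input_def)
  show ?thesis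
    unfolding gap_def by measurable
qed

lemma gap_nonneg: "continuous_on {0..T} w \<Longrightarrow> continuous_on {0..T} w' \<Longrightarrow> gap z w z' w' \<ge> 0"
  unfolding gap_def by (intro add_nonneg_nonneg sup_norm_nonneg T0 continuous_on_diff) auto

text \<open>The flow of marginals of a solution is deterministic, so all paths can be compared with a
  single one. This yields the moment of the supremum although only the marginals of a solution
  are assumed to have moments.\<close>

lemma solution_process:
  assumes M: "prob_space M" and in0: "input M \<zeta> w" and sol: "solution M \<zeta> w X"
  shows "process M X"
proof -
  interpret prob_space M by fact
  have X: "X \<in> M \<rightarrow>\<^sub>M path_borel T"
    and ws: "\<And>t. t \<in> {0..T} \<Longrightarrow> marginal M X t \<in> wasserstein_space p"
    using sol by (auto simp: mckean_vlasov_solution_def)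
  have \<zeta>[measurable]: "\<zeta> \<in> borel_measurable M" and w: "process M w"
    and fin: "moment p M (\<lambda>\<omega>. norm (\<zeta> \<omega>)) < \<infinity>"
    using in0 by (auto simp: input_def)
  define P where "P \<omega> \<longleftrightarrow> \<omega> \<in> space M \<and> (\<forall>t\<in>{0..T}.
      set_integrable lborel {0..t} (\<lambda>s. b s (X \<omega> s) (marginal M X s)) \<and>
      X \<omega> t = \<zeta> \<omega> + (LBINT s:{0..t}. b s (X \<omega> s) (marginal M X s)) + w \<omega> t)" for \<omega>
  have P: "AE \<omega> in M. P \<omega>"
    using sol AE_space[of M] unfolding mckean_vlasov_solution_def P_def by auto
  obtain \<omega>\<^sub>0 where \<omega>0: "P \<omega>\<^sub>0"
  proof (rule ccontr)
    assume "\<not> thesis"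
    with that have "\<not> P \<omega>" for \<omega>
      by blast
    with P have "AE \<omega> in M. False"
      by simp
    then show False
      by simp
  qed
  define c where "c = sup_norm T (X \<omega>\<^sub>0) + exp (rate * T) * (2 * (norm (\<zeta> \<omega>\<^sub>0) + sup_norm T (w \<omega>\<^sub>0)))"
  define k where "k = 2 * exp (rate * T)"
  have sp0: "\<omega>\<^sub>0 \<in> space M"
    using \<omega>0 by (simp add: P_def)
  have c0: "c \<ge> 0"
    unfolding c_def using process_sup_norm_nonneg[OF w sp0]
      sup_norm_nonneg[OF T0 measurable_path_borel_continuous[OF X sp0]] by simp
  have bound: "sup_norm T (X \<omega>) \<le> c + k * (norm (\<zeta> \<omega>) + sup_norm T (w \<omega>))" if \<omega>: "P \<omega>" for \<omega>
  proof -
    have sp: "\<omega> \<in> space M"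
      using \<omega> by (simp add: P_def)
    note cX = measurable_path_borel_continuous[OF X sp] measurable_path_borel_continuous[OF X sp0]
    note cw = process_continuous[OF w sp] process_continuous[OF w sp0]
    \<comment> \<open>Both paths are driven by the same flow, hence \<open>V\<close> = 0.
      Integrability of the drift is taken from the notion of solution: \<open>process_flow\<close>
      cannot be used before the moment of the supremum is known.\<close>
    have "wdiff (X \<omega>) (X \<omega>\<^sub>0) \<le> 2 * (norm (\<zeta> \<omega> - \<zeta> \<omega>\<^sub>0) + sup_dist T (w \<omega>) (w \<omega>\<^sub>0)) + 0 / 4"
    proof (rule path_stability[OF cX cw, where f = "\<lambda>s. b s (X \<omega> s) (marginal M X s)"
          and g = "\<lambda>s. b s (X \<omega>\<^sub>0 s) (marginal M X s)"])
      fix s assume s: "s \<in> {0..T}"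
      show "norm (b s (X \<omega> s) (marginal M X s) - b s (X \<omega>\<^sub>0 s) (marginal M X s))
          \<le> L * (norm (X \<omega> s - X \<omega>\<^sub>0 s) + 0 * exp (rate * s))"
        using b_lipschitz[OF s ws[OF s] ws[OF s]] wasserstein_self[OF p, of "marginal M X s"] by simp
    qed (use \<omega> \<omega>0 in \<open>auto simp: P_def\<close>)
    also have "\<dots> \<le> 2 * ((norm (\<zeta> \<omega>) + norm (\<zeta> \<omega>\<^sub>0)) + (sup_norm T (w \<omega>) + sup_norm T (w \<omega>\<^sub>0)))"
      using norm_triangle_ineq4[of "\<zeta> \<omega>" "\<zeta> \<omega>\<^sub>0"] sup_norm_triangle[OF T0 cw] by simp
    finally have *: "wdiff (X \<omega>) (X \<omega>\<^sub>0) \<le> \<dots>" .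
    have "sup_norm T (X \<omega>) \<le> sup_norm T (X \<omega>\<^sub>0) + sup_dist T (X \<omega>) (X \<omega>\<^sub>0)"
      by (rule sup_norm_triangle_sub[OF T0 cX])
    also have "\<dots> \<le> sup_norm T (X \<omega>\<^sub>0) + exp (rate * T) * wdiff (X \<omega>) (X \<omega>\<^sub>0)"
      using rate by (intro add_left_mono sup_norm_le_weighted_norm T0 continuous_on_diff cX) auto
    also have "\<dots> \<le> sup_norm T (X \<omega>\<^sub>0) + exp (rate * T) *
        (2 * ((norm (\<zeta> \<omega>) + norm (\<zeta> \<omega>\<^sub>0)) + (sup_norm T (w \<omega>) + sup_norm T (w \<omega>\<^sub>0))))"
      by (intro add_left_mono mult_left_mono *) simp
    also have "\<dots> = c + k * (norm (\<zeta> \<omega>) + sup_norm T (w \<omega>))"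
      by (simp add: c_def k_def algebra_simps)
    finally show ?thesis .
  qed
  note [measurable] = borel_measurable_process_sup_norm[OF process_measurable[OF w]]
  have "moment p M (\<lambda>\<omega>. sup_norm T (X \<omega>)) < \<infinity>"
  proof (rule nn_integral_powr_mono_finite)
    show "AE \<omega> in M. 0 \<le> sup_norm T (X \<omega>) \<and> sup_norm T (X \<omega>) \<le> c + k * (norm (\<zeta> \<omega>) + sup_norm T (w \<omega>))"
      using P
    proof eventually_elim
      case (elim \<omega>)
      then show ?case
        using bound sup_norm_nonneg[OF T0 measurable_path_borel_continuous[OF X]] by (auto simp: P_def)
    qed
    have nn: "norm (\<zeta> \<omega>) + sup_norm T (w \<omega>) \<ge> 0" if "\<omega> \<in> space M" for \<omega>
      using process_sup_norm_nonneg[OF w that] by simp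
    have "moment p M (\<lambda>\<omega>. norm (\<zeta> \<omega>) + sup_norm T (w \<omega>)) < \<infinity>"
      using fin w p process_sup_norm_nonneg[OF w]
      by (intro nn_integral_powr_add_finite) (auto simp: process_def)
    then have "moment p M (\<lambda>\<omega>. k * (norm (\<zeta> \<omega>) + sup_norm T (w \<omega>))) < \<infinity>"
      using nn by (intro nn_integral_powr_cmult_finite) (auto simp: k_def)
    then show "moment p M (\<lambda>\<omega>. c + k * (norm (\<zeta> \<omega>) + sup_norm T (w \<omega>))) < \<infinity>"
      using p c0 nn
      by (intro nn_integral_powr_add_finite) (auto simp: k_def emeasure_space_1)
  qed (use p in simp)
  then show ?thesis
    using X by (simp add: process_def)
qed

text \<open>Let V be the p-norm of the weighted distance. Pathwise, this distance is at most 2 gap +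
  V/4. Taking p-th moments gives V^p \<le> 4^p E gap^p + V^p / 2, and the last term is
  absorbed.\<close>

lemma solution_stability:
  assumes M: "prob_space M" and in1: "input M \<zeta> w" and in2: "input M \<zeta>' w'"
    and X: "solution M \<zeta> w X" and Y: "solution M \<zeta>' w' Y"
  shows "moment p M (\<lambda>\<omega>. wdiff (X \<omega>) (Y \<omega>))
    \<le> ennreal (2 * 4 powr p) * moment p M (\<lambda>\<omega>. gap (\<zeta> \<omega>) (w \<omega>) (\<zeta>' \<omega>) (w' \<omega>))"
    (is "?D \<le> _ * ?A")
proof -
  interpret prob_space M by fact
  note pX = solution_process[OF M in1 X] and pY = solution_process[OF M in2 Y]
  note mX = process_measurable[OF pX] and mY = process_measurable[OF pY]
  have w: "process M w" "process M w'"
    using in1 in2 by (auto simp: input_def)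
  let ?a = "\<lambda>\<omega>. gap (\<zeta> \<omega>) (w \<omega>) (\<zeta>' \<omega>) (w' \<omega>)"
  have [measurable]: "?a \<in> borel_measurable M"
    by (rule borel_measurable_gap[OF in1 in2])
  obtain V where V: "V \<ge> 0" "ennreal (V powr p) = ?D"
    by (rule finite_ennreal_eq_powr[OF p_pos wdiff_finite[OF pX pY]])
  have wd: "wdist (marginal M X s) (marginal M Y s) \<le> V * exp (rate * s)" if "s \<in> {0..T}" for s
    by (rule wdist_marginal_le_wdiff[OF mX mY that V(1)]) (simp add: V(2))
  have eqX: "AE \<omega> in M. \<forall>t\<in>{0..T}.
      set_integrable lborel {0..t} (\<lambda>s. b s (X \<omega> s) (marginal M X s)) \<and>
      X \<omega> t = \<zeta> \<omega> + (LBINT s:{0..t}. b s (X \<omega> s) (marginal M X s)) + w \<omega> t"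
    using X by (simp add: mckean_vlasov_solution_def)
  have eqY: "AE \<omega> in M. \<forall>t\<in>{0..T}.
      set_integrable lborel {0..t} (\<lambda>s. b s (Y \<omega> s) (marginal M Y s)) \<and>
      Y \<omega> t = \<zeta>' \<omega> + (LBINT s:{0..t}. b s (Y \<omega> s) (marginal M Y s)) + w' \<omega> t"
    using Y by (simp add: mckean_vlasov_solution_def)
  have le: "AE \<omega> in M. wdiff (X \<omega>) (Y \<omega>) \<le> 2 * ?a \<omega> + V / 4 \<and> \<omega> \<in> space M"
    using eqX eqY AE_space
  proof eventually_elim
    case (elim \<omega>)
    note \<omega> = elim(3)
    show ?case
      unfolding gap_def
    proof (intro conjI path_stability[where f = "\<lambda>s. b s (X \<omega> s) (marginal M X s)"
          and g = "\<lambda>s. b s (Y \<omega> s) (marginal M Y s)"])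
      fix s assume s: "s \<in> {0..T}"
      have "norm (b s (X \<omega> s) (marginal M X s) - b s (Y \<omega> s) (marginal M Y s))
        \<le> L * (norm (X \<omega> s - Y \<omega> s) + wdist (marginal M X s) (marginal M Y s))"
        using s by (intro b_lipschitz marginal_in_wasserstein_space M pX pY)
      also have "\<dots> \<le> L * (norm (X \<omega> s - Y \<omega> s) + V * exp (rate * s))"
        using wd[OF s] L by (intro mult_left_mono add_left_mono) auto
      finally show "norm (b s (X \<omega> s) (marginal M X s) - b s (Y \<omega> s) (marginal M Y s))
        \<le> L * (norm (X \<omega> s - Y \<omega> s) + V * exp (rate * s))" .
    qed (use elim V in \<open>simp_all add: process_continuous[OF pX] process_continuous[OF pY]
        process_continuous[OF w(1)] process_continuous[OF w(2)]\<close>)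
  qed
  have "?D \<le> (\<integral>\<^sup>+\<omega>. ennreal (4 powr p) * ennreal (?a \<omega> powr p) + ennreal (V powr p / 2) \<partial>M)"
  proof (intro nn_integral_mono_AE eventually_mono[OF le])
    fix \<omega> assume "wdiff (X \<omega>) (Y \<omega>) \<le> 2 * ?a \<omega> + V / 4 \<and> \<omega> \<in> space M"
    then have *: "wdiff (X \<omega>) (Y \<omega>) \<le> 2 * ?a \<omega> + V / 4" and \<omega>: "\<omega> \<in> space M"
      by auto
    have a0: "?a \<omega> \<ge> 0"
      by (intro gap_nonneg process_continuous[OF _ \<omega>] w)
    have "wdiff (X \<omega>) (Y \<omega>) powr p \<le> (2 * ?a \<omega> + V / 4) powr p"
      using * p \<omega> by (intro powr_mono2 wdiff_nonneg) (auto intro: process_continuous pX pY)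
    also have "\<dots> \<le> 2 powr p * ((2 * ?a \<omega>) powr p + (V / 4) powr p)"
      using a0 V p by (intro powr_add_le) auto
    also have "\<dots> = (2 * 2) powr p * ?a \<omega> powr p + (2 / 4) powr p * V powr p"
      using a0 V by (simp only: powr_mult powr_divide zero_le_numeral) (simp add: algebra_simps powr_mult powr_divide)
    also have "\<dots> \<le> 4 powr p * ?a \<omega> powr p + (1 / 2) * V powr p"
    proof -
      \<comment> \<open>The factor 2^p from \<open>powr_add_le\<close> meets (V/4)^p. As p \<ge> 1,
        the result is at most V^p / 2; this is the reason for the contraction factor 1/8 in the
        choice of \<open>rate\<close>.\<close>
      have "(2 / 4 :: real) powr p \<le> (1 / 2) powr 1"
        using powr_mono'[OF p, of "1 / 2"] by simp
      then show ?thesis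
        by (intro add_mono mult_right_mono) auto
    qed
    finally have "ennreal (wdiff (X \<omega>) (Y \<omega>) powr p) \<le> ennreal (4 powr p * ?a \<omega> powr p + (1 / 2) * V powr p)"
      by (rule ennreal_leI)
    then show "ennreal (wdiff (X \<omega>) (Y \<omega>) powr p) \<le> ennreal (4 powr p) * ennreal (?a \<omega> powr p) + ennreal (V powr p / 2)"
      by (simp add: ennreal_mult' ennreal_plus)
  qed
  also have "\<dots> = ennreal (4 powr p) * ?A + ennreal (V powr p / 2)"
    by (simp add: nn_integral_add nn_integral_cmult emeasure_space_1)
  finally have *: "ennreal (V powr p) \<le> ennreal (4 powr p) * ?A + ennreal (V powr p / 2)"
    by (simp add: V)
  show ?thesis
  \<comment> \<open>An infinite right-hand side makes the claim trivial. In the finite case the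
    inequality becomes one between reals, where subtraction is possible.\<close>
  proof (cases ?A)
    case (real r)
    then have "ennreal (V powr p) \<le> ennreal (4 powr p * r + V powr p / 2)"
      using * by (simp add: ennreal_mult' ennreal_plus)
    then have "V powr p \<le> 4 powr p * r + V powr p / 2"
      using real by (subst (asm) ennreal_le_iff) auto
    then have "V powr p \<le> 2 * 4 powr p * r"
      by simp
    then have "ennreal (V powr p) \<le> ennreal (2 * 4 powr p * r)"
      by (rule ennreal_leI)
    then show ?thesis
      using real by (simp add: V(2)[symmetric] ennreal_mult')
  qed (simp add: ennreal_mult_top)
qed

text \<open>The first factor passes from the weighted norm back to the supremum norm; the second is
  the constant of \<open>solution_stability\<close>.\<close>

definition stab_const :: real where
  "stab_const = exp (rate * T) powr p * (2 * 4 powr p)"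

lemma solution_stability_sup:
  assumes M: "prob_space M" and in1: "input M \<zeta> w" and in2: "input M \<zeta>' w'"
    and X: "solution M \<zeta> w X" and Y: "solution M \<zeta>' w' Y"
  shows "moment p M (\<lambda>\<omega>. sup_dist T (X \<omega>) (Y \<omega>))
    \<le> ennreal stab_const * moment p M (\<lambda>\<omega>. gap (\<zeta> \<omega>) (w \<omega>) (\<zeta>' \<omega>) (w' \<omega>))"
proof -
  note pX = solution_process[OF M in1 X] and pY = solution_process[OF M in2 Y]
  have [measurable]: "(\<lambda>\<omega>. wdiff (X \<omega>) (Y \<omega>)) \<in> borel_measurable M"
    by (intro borel_measurable_weighted_norm_diff T0 process_measurable pX pY)
  have "moment p M (\<lambda>\<omega>. sup_dist T (X \<omega>) (Y \<omega>))
    \<le> (\<integral>\<^sup>+\<omega>. ennreal (exp (rate * T) powr p) * ennreal (wdiff (X \<omega>) (Y \<omega>) powr p) \<partial>M)"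
  proof (rule nn_integral_mono)
    fix \<omega> assume \<omega>: "\<omega> \<in> space M"
    have c: "continuous_on {0..T} (\<lambda>t. X \<omega> t - Y \<omega> t)"
      by (intro continuous_on_diff process_continuous[OF _ \<omega>] pX pY)
    have "sup_dist T (X \<omega>) (Y \<omega>) powr p \<le> (exp (rate * T) * wdiff (X \<omega>) (Y \<omega>)) powr p"
      using p rate by (intro powr_mono2 sup_norm_le_weighted_norm sup_norm_nonneg T0 c) auto
    also have "\<dots> = exp (rate * T) powr p * wdiff (X \<omega>) (Y \<omega>) powr p"
      using weighted_norm_nonneg[OF T0 c] by (simp add: powr_mult)
    finally show "ennreal (sup_dist T (X \<omega>) (Y \<omega>) powr p)
        \<le> ennreal (exp (rate * T) powr p) * ennreal (wdiff (X \<omega>) (Y \<omega>) powr p)"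
      by (simp add: ennreal_mult'[symmetric])
  qed
  also have "\<dots> = ennreal (exp (rate * T) powr p) * moment p M (\<lambda>\<omega>. wdiff (X \<omega>) (Y \<omega>))"
    by (rule nn_integral_cmult) measurable
  also have "\<dots> \<le> ennreal (exp (rate * T) powr p) * (ennreal (2 * 4 powr p) *
      moment p M (\<lambda>\<omega>. gap (\<zeta> \<omega>) (w \<omega>) (\<zeta>' \<omega>) (w' \<omega>)))"
    by (intro mult_left_mono solution_stability[OF M in1 in2 X Y]) simp
  finally show ?thesis
    by (simp add: stab_const_def ennreal_mult' mult.assoc)
qed

text \<open>Stability with equal inputs, for which the gap vanishes identically.\<close>

lemma solution_unique:
  assumes M: "prob_space M" and inp: "input M \<zeta> w"
    and X: "solution M \<zeta> w X" and Y: "solution M \<zeta> w Y"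
  shows "AE \<omega> in M. X \<omega> = Y \<omega>"
proof -
  note pX = solution_process[OF M inp X] and pY = solution_process[OF M inp Y]
  have "gap z v z v = 0" for z v
    using T0 by (simp add: gap_def sup_norm_def)
  then have 0: "moment p M (\<lambda>\<omega>. sup_dist T (X \<omega>) (Y \<omega>)) = 0"
    using solution_stability_sup[OF M inp inp X Y] p by simp
  have [measurable]: "(\<lambda>\<omega>. sup_dist T (X \<omega>) (Y \<omega>)) \<in> borel_measurable M"
    by (intro borel_measurable_sup_norm_diff T0 process_measurable pX pY)
  have "AE \<omega> in M. ennreal (sup_dist T (X \<omega>) (Y \<omega>) powr p) = 0 \<and> \<omega> \<in> space M"
    using 0 AE_space[of M] by (subst (asm) nn_integral_0_iff_AE) auto
  then show ?thesis
  proof eventually_elim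
    case (elim \<omega>)
    then have \<omega>: "\<omega> \<in> space M" and s0: "sup_dist T (X \<omega>) (Y \<omega>) = 0"
      by (auto simp: ennreal_eq_0_iff)
    have c: "continuous_on {0..T} (\<lambda>t. X \<omega> t - Y \<omega> t)"
      by (intro continuous_on_diff process_continuous[OF _ \<omega>] pX pY)
    show ?case
    proof (rule path_metric_eqI)
      show "X \<omega> \<in> mspace (path_metric T)" "Y \<omega> \<in> mspace (path_metric T)"
        using \<omega> by (intro measurable_path_borel_space process_measurable pX pY; simp)+
      fix t assume "t \<in> {0..T}"
      then show "X \<omega> t = Y \<omega> t"
        using norm_le_sup_norm[OF c, of t] s0 by simp
    qed
  qed
qed

section \<open>Change of the probability space\<close>

lemma marginal_transfer:
  assumes \<phi>: "\<phi> \<in> M \<rightarrow>\<^sub>M M'" and M': "distr M M' \<phi> = M'" and X: "X \<in> M' \<rightarrow>\<^sub>M path_borel T"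
    and t: "t \<in> {0..T}"
  shows "marginal M (\<lambda>\<omega>. X (\<phi> \<omega>)) t = marginal M' X t"
proof -
  have "marginal M' X t = distr (distr M M' \<phi>) borel (\<lambda>\<omega>. X \<omega> t)"
    by (simp add: M')
  also have "\<dots> = marginal M (\<lambda>\<omega>. X (\<phi> \<omega>)) t"
    by (subst distr_distr[OF measurable_path_eval[OF X t] \<phi>]) (simp add: comp_def)
  finally show ?thesis ..
qed

text \<open>The equation is pathwise and sees the probability space only through the marginals, so a
  measure-preserving map pulls solutions back to solutions.\<close>

lemma solution_transfer:
  assumes \<phi>: "\<phi> \<in> M \<rightarrow>\<^sub>M M'" and M': "distr M M' \<phi> = M'" and sol: "solution M' \<zeta> w X"
  shows "solution M (\<lambda>\<omega>. \<zeta> (\<phi> \<omega>)) (\<lambda>\<omega>. w (\<phi> \<omega>)) (\<lambda>\<omega>. X (\<phi> \<omega>))"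
proof -
  have X: "X \<in> M' \<rightarrow>\<^sub>M path_borel T"
    using sol by (simp add: mckean_vlasov_solution_def)
  note marg = marginal_transfer[OF \<phi> M' X]
  have "AE \<omega> in distr M M' \<phi>. \<forall>t\<in>{0..T}.
      set_integrable lborel {0..t} (\<lambda>s. b s (X \<omega> s) (marginal M' X s)) \<and>
      X \<omega> t = \<zeta> \<omega> + (LBINT s:{0..t}. b s (X \<omega> s) (marginal M' X s)) + w \<omega> t"
    using sol unfolding M' by (simp add: mckean_vlasov_solution_def)
  from AE_distrD[OF \<phi> this]
  have ae: "AE \<omega> in M. \<forall>t\<in>{0..T}.
      set_integrable lborel {0..t} (\<lambda>s. b s (X (\<phi> \<omega>) s) (marginal M' X s)) \<and>
      X (\<phi> \<omega>) t = \<zeta> (\<phi> \<omega>) + (LBINT s:{0..t}. b s (X (\<phi> \<omega>) s) (marginal M' X s)) + w (\<phi> \<omega>) t" .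
  show ?thesis
    unfolding mckean_vlasov_solution_def
  proof (intro conjI ballI)
    show "(\<lambda>\<omega>. X (\<phi> \<omega>)) \<in> M \<rightarrow>\<^sub>M path_borel T"
      by (rule measurable_compose[OF \<phi> X])
    show "marginal M (\<lambda>\<omega>. X (\<phi> \<omega>)) t \<in> wasserstein_space p" if "t \<in> {0..T}" for t
      using sol that marg[OF that] by (auto simp: mckean_vlasov_solution_def)
    show "AE \<omega> in M. \<forall>t\<in>{0..T}.
      set_integrable lborel {0..t} (\<lambda>s. b s (X (\<phi> \<omega>) s) (marginal M (\<lambda>\<omega>. X (\<phi> \<omega>)) s)) \<and>
      X (\<phi> \<omega>) t = \<zeta> (\<phi> \<omega>) + (LBINT s:{0..t}. b s (X (\<phi> \<omega>) s) (marginal M (\<lambda>\<omega>. X (\<phi> \<omega>)) s)) + w (\<phi> \<omega>) t"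
      using ae
    proof eventually_elim
      case (elim \<omega>)
      show ?case
      proof
        fix t assume t: "t \<in> {0..T}"
        \<comment> \<open>The marginals are known to agree only for times in [0,T], so the
          integrands are compared after cutting off with the indicator.\<close>
        have "(\<lambda>s. indicator {0..t} s *\<^sub>R b s (X (\<phi> \<omega>) s) (marginal M (\<lambda>\<omega>. X (\<phi> \<omega>)) s)) =
            (\<lambda>s. indicator {0..t} s *\<^sub>R b s (X (\<phi> \<omega>) s) (marginal M' X s))"
          using t marg by (auto simp: fun_eq_iff indicator_def)
        with bspec[OF elim t] show "set_integrable lborel {0..t} (\<lambda>s. b s (X (\<phi> \<omega>) s) (marginal M (\<lambda>\<omega>. X (\<phi> \<omega>)) s)) \<and>
          X (\<phi> \<omega>) t = \<zeta> (\<phi> \<omega>) + (LBINT s:{0..t}. b s (X (\<phi> \<omega>) s) (marginal M (\<lambda>\<omega>. X (\<phi> \<omega>)) s)) + w (\<phi> \<omega>) t"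
          unfolding set_integrable_def set_lebesgue_integral_def by simp
      qed
    qed
  qed
qed

lemma process_transfer:
  assumes \<phi>: "\<phi> \<in> M \<rightarrow>\<^sub>M M'" and M': "distr M M' \<phi> = M'" and X: "process M' X"
  shows "process M (\<lambda>\<omega>. X (\<phi> \<omega>))"
proof -
  have "moment p M (\<lambda>\<omega>. sup_norm T (X (\<phi> \<omega>))) = moment p (distr M M' \<phi>) (\<lambda>\<omega>. sup_norm T (X \<omega>))"
    using borel_measurable_process_sup_norm[OF process_measurable[OF X]] \<phi>
    by (subst nn_integral_distr) auto
  then show ?thesis
    using X measurable_compose[OF \<phi>, of X] by (simp add: process_def M')
qed

lemma input_transfer:
  assumes \<phi>: "\<phi> \<in> M \<rightarrow>\<^sub>M M'" and M': "distr M M' \<phi> = M'" and inp: "input M' \<zeta> w"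
  shows "input M (\<lambda>\<omega>. \<zeta> (\<phi> \<omega>)) (\<lambda>\<omega>. w (\<phi> \<omega>))"
proof -
  have [measurable]: "\<zeta> \<in> borel_measurable M'"
    using inp by (simp add: input_def)
  have "moment p M (\<lambda>\<omega>. norm (\<zeta> (\<phi> \<omega>))) = moment p (distr M M' \<phi>) (\<lambda>\<omega>. norm (\<zeta> \<omega>))"
    using \<phi> by (subst nn_integral_distr) auto
  then show ?thesis
    using inp measurable_compose[OF \<phi>, of \<zeta>] process_transfer[OF \<phi> M', of w]
    by (simp add: input_def M')
qed

end

section \<open>Picard iteration\<close>

lemma continuous_on_set_integral:
  fixes f :: "real \<Rightarrow> 'a::euclidean_space"
  assumes f: "set_integrable lborel {0..T} f"
  shows "continuous_on {0..T} (\<lambda>t. LBINT s:{0..t}. f s)"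
proof -
  have "(LBINT s:{0..t}. f s) = integral {0..t} f" if "t \<in> {0..T}" for t
    using that by (intro set_borel_integral_eq_integral(2) set_integrable_subset[OF f]) auto
  moreover have "continuous_on {0..T} (\<lambda>t. integral {0..t} f)"
    by (intro indefinite_integral_continuous_1 set_borel_integral_eq_integral(1) f)
  ultimately show ?thesis
    by (simp cong: continuous_on_cong_simp)
qed

context lipschitz_drift
begin

lemma drift_integrable_subset:
  assumes "flow \<mu>" "continuous_on {0..T} x" "t \<in> {0..T}"
  shows "set_integrable lborel {0..t} (\<lambda>s. b s (x s) (\<mu> s))"
  using assms by (intro set_integrable_subset[OF drift_integrable[OF assms(1,2)]]) auto

lemma drift_integral_diff_le:
  assumes \<mu>: "flow \<mu>" and \<nu>: "flow \<nu>" and x: "continuous_on {0..T} x" and y: "continuous_on {0..T} y"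
    and t: "t \<in> {0..T}" and D: "D \<ge> 0"
    and le: "\<And>s. s \<in> {0..T} \<Longrightarrow> norm (x s - y s) + wdist (\<mu> s) (\<nu> s) \<le> D * exp (rate * s)"
  shows "norm ((LBINT s:{0..t}. b s (x s) (\<mu> s)) - (LBINT s:{0..t}. b s (y s) (\<nu> s))) \<le> D / 8 * exp (rate * t)"
proof (rule integral_diff_le)
  fix s assume "s \<in> {0..t}"
  then have s: "s \<in> {0..T}"
    using t by auto
  have "\<mu> s \<in> wasserstein_space p" "\<nu> s \<in> wasserstein_space p"
    using \<mu> \<nu> s unfolding flow_def by blast+
  then have "norm (b s (x s) (\<mu> s) - b s (y s) (\<nu> s)) \<le> L * (norm (x s - y s) + wdist (\<mu> s) (\<nu> s))"
    by (rule b_lipschitz[OF s])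
  also have "\<dots> \<le> L * (D * exp (rate * s))"
    by (intro mult_left_mono le s L)
  finally show "norm (b s (x s) (\<mu> s) - b s (y s) (\<nu> s)) \<le> L * (D * exp (rate * s))" .
qed (use t D in \<open>auto intro!: drift_integrable_subset \<mu> \<nu> x y\<close>)

lemma wdist_self: "flow \<mu> \<Longrightarrow> s \<in> {0..T} \<Longrightarrow> wdist (\<mu> s) (\<mu> s) = 0"
  by (intro wasserstein_self p wasserstein_spaceD[of _ p]) (auto simp: flow_def)

text \<open>For a fixed flow the integral is a Lipschitz function of the path, hence Borel on path
  space, and \<omega> enters only through the path.\<close>

lemma drift_integral_measurable:
  assumes \<mu>: "flow \<mu>" and X: "X \<in> M \<rightarrow>\<^sub>M path_borel T" and t: "t \<in> {0..T}"
  shows "(\<lambda>\<omega>. LBINT s:{0..t}. b s (X \<omega> s) (\<mu> s)) \<in> borel_measurable M"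
proof -
  have "Lipschitz_continuous_map (path_metric T) euclidean_metric (\<lambda>x. LBINT s:{0..t}. b s (x s) (\<mu> s))"
    unfolding Lipschitz_continuous_map_def
  proof (intro conjI exI ballI)
    fix x y :: "real \<Rightarrow> 'a" assume xy: "x \<in> mspace (path_metric T)" "y \<in> mspace (path_metric T)"
    then have c: "continuous_on {0..T} x" "continuous_on {0..T} y"
      by (simp_all add: mspace_path_metric_iff)
    note cd = continuous_on_diff[OF c]
    let ?D = "sup_dist T x y"
    have "norm ((LBINT s:{0..t}. b s (x s) (\<mu> s)) - (LBINT s:{0..t}. b s (y s) (\<mu> s))) \<le> ?D / 8 * exp (rate * t)"
    proof (rule drift_integral_diff_le[OF \<mu> \<mu> c t sup_norm_nonneg[OF T0 cd]])
      fix s assume s: "s \<in> {0..T}"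
      have "norm (x s - y s) \<le> ?D * 1"
        using norm_le_sup_norm[OF cd s] by simp
      also have "\<dots> \<le> ?D * exp (rate * s)"
        using s rate sup_norm_nonneg[OF T0 cd] by (intro mult_left_mono) auto
      finally show "norm (x s - y s) + wdist (\<mu> s) (\<mu> s) \<le> ?D * exp (rate * s)"
        by (simp add: wdist_self[OF \<mu> s])
    qed
    then show "mdist euclidean_metric (LBINT s:{0..t}. b s (x s) (\<mu> s)) (LBINT s:{0..t}. b s (y s) (\<mu> s))
        \<le> exp (rate * t) / 8 * mdist (path_metric T) x y"
      using mdist_path_metric[OF T0 xy] by (simp add: dist_norm mult.commute)
  qed auto
  from measurable_borel_metric_Lipschitz[OF this]
  have "(\<lambda>x. LBINT s:{0..t}. b s (x s) (\<mu> s)) \<in> path_borel T \<rightarrow>\<^sub>M borel"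
    by (simp add: borel_metric_euclidean)
  from measurable_compose[OF X this] show ?thesis .
qed

lemma drift_integral_continuous:
  assumes "flow \<mu>" "continuous_on {0..T} x"
  shows "continuous_on {0..T} (\<lambda>t. LBINT s:{0..t}. b s (x s) (\<mu> s))"
  by (intro continuous_on_set_integral drift_integrable assms)

text \<open>The reference flow for growth estimates: along it and the zero path the drift is the
  function in \<open>b_integrable\<close>.\<close>

lemma flow_const: "flow (\<lambda>_. return borel 0)"
  unfolding flow_def
proof (intro conjI ballI)
  have "return borel (0 :: 'a) \<in> space (wasserstein_borel p)"
    using return_in_wasserstein_space Metric_space_wasserstein[OF p, where 'a = 'a]
    by (subst wasserstein_borel_def, subst space_measure_of) (auto simp: Metric_space.mopen_def)
  then show "(\<lambda>_. return borel (0 :: 'a)) \<in> restrict_space borel {0..T} \<rightarrow>\<^sub>M wasserstein_borel p"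
    by simp
qed (auto simp: return_in_wasserstein_space)

text \<open>The restriction makes the values extensional, as elements of
  \<open>path_metric T\<close> have to be.\<close>

definition picard :: "'w measure \<Rightarrow> ('w \<Rightarrow> 'a) \<Rightarrow> ('w \<Rightarrow> real \<Rightarrow> 'a) \<Rightarrow> ('w \<Rightarrow> real \<Rightarrow> 'a) \<Rightarrow> 'w \<Rightarrow> real \<Rightarrow> 'a" where
  "picard M \<zeta> w X \<omega> =
     restrict (\<lambda>t. \<zeta> \<omega> + (LBINT s:{0..t}. b s (X \<omega> s) (marginal M X s)) + w \<omega> t) {0..T}"

lemma picard_process:
  assumes M: "prob_space M" and inp: "input M \<zeta> w" and X: "process M X"
  shows "process M (picard M \<zeta> w X)"
proof -
  interpret prob_space M by fact
  have \<zeta>[measurable]: "\<zeta> \<in> borel_measurable M" and w: "process M w"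
    and fin: "moment p M (\<lambda>\<omega>. norm (\<zeta> \<omega>)) < \<infinity>"
    using inp by (auto simp: input_def)
  note \<mu> = process_flow[OF M X]
  note mX = process_measurable[OF X] and mw = process_measurable[OF w]
  note [measurable] = borel_measurable_process_sup_norm[OF mX] borel_measurable_process_sup_norm[OF mw]
  have Pm: "picard M \<zeta> w X \<in> M \<rightarrow>\<^sub>M path_borel T"
  proof (rule measurable_path_borelI[OF T0])
    fix \<omega> assume \<omega>: "\<omega> \<in> space M"
    show "picard M \<zeta> w X \<omega> \<in> mspace (path_metric T)"
      unfolding picard_def
      by (intro restrict_in_path_metric continuous_on_add continuous_on_const drift_integral_continuous \<mu>
          process_continuous[OF X \<omega>] process_continuous[OF w \<omega>])
  next
    fix t assume t: "t \<in> {0..T}"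
    have [measurable]: "(\<lambda>\<omega>. w \<omega> t) \<in> borel_measurable M"
      by (rule measurable_path_eval[OF mw t])
    have [measurable]: "(\<lambda>\<omega>. LBINT s:{0..t}. b s (X \<omega> s) (marginal M X s)) \<in> borel_measurable M"
      by (rule drift_integral_measurable[OF \<mu> mX t])
    have "(\<lambda>\<omega>. \<zeta> \<omega> + (LBINT s:{0..t}. b s (X \<omega> s) (marginal M X s)) + w \<omega> t) \<in> borel_measurable M"
      by measurable
    then show "(\<lambda>\<omega>. picard M \<zeta> w X \<omega> t) \<in> borel_measurable M"
      using t by (simp add: picard_def)
  qed
  obtain B where B: "\<And>t. t \<in> {0..T} \<Longrightarrow> wdist (marginal M X t) (return borel 0) \<le> B"
    using \<mu> unfolding flow_def by blast
  have B0: "B \<ge> 0"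
    using B[of 0] T0 wasserstein_nonneg[of p euclidean_metric "marginal M X 0" "return borel 0"] by simp
  \<comment> \<open>The integrated drift along the zero path and the Dirac flow. It does not depend
    on \<omega>, so the growth bound follows from the difference estimate applied to
    \<open>X\<close> and this reference.\<close>
  define F where "F t = (LBINT s:{0..t}. b s 0 (return borel 0))" for t
  have cF: "continuous_on {0..T} F"
    unfolding F_def by (intro continuous_on_set_integral b_integrable)
  define k where "k = exp (rate * T) / 8"
  have k0: "k \<ge> 0"
    by (simp add: k_def)
  define c where "c = sup_norm T F + k * B"
  have c0: "c \<ge> 0"
    unfolding c_def using B0 k0 sup_norm_nonneg[OF T0 cF] by simp
  have bound: "sup_norm T (picard M \<zeta> w X \<omega>) \<le> norm (\<zeta> \<omega>) + (sup_norm T (w \<omega>) + (c + k * sup_norm T (X \<omega>)))"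
    if \<omega>: "\<omega> \<in> space M" for \<omega>
  proof (rule sup_norm_le[OF T0])
    fix t assume t: "t \<in> {0..T}"
    note cX = process_continuous[OF X \<omega>]
    let ?D = "sup_norm T (X \<omega>) + B"
    have D0: "?D \<ge> 0"
      using B0 process_sup_norm_nonneg[OF X \<omega>] by simp
    have "norm ((LBINT s:{0..t}. b s (X \<omega> s) (marginal M X s)) - F t) \<le> ?D / 8 * exp (rate * t)"
      unfolding F_def
    proof (rule drift_integral_diff_le[where y = "\<lambda>_. 0", OF \<mu> flow_const cX _ t D0])
      fix s assume s: "s \<in> {0..T}"
      have "norm (X \<omega> s - 0) + wdist (marginal M X s) (return borel 0) \<le> ?D * 1"
        using norm_le_sup_norm[OF cX s] B[OF s] by simp
      also have "\<dots> \<le> ?D * exp (rate * s)"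
        using s rate D0 by (intro mult_left_mono) auto
      finally show "norm (X \<omega> s - 0) + wdist (marginal M X s) (return borel 0) \<le> ?D * exp (rate * s)" .
    qed simp
    also have "\<dots> \<le> ?D / 8 * exp (rate * T)"
      using D0 rate t by (intro mult_left_mono) auto
    also have "\<dots> = k * B + k * sup_norm T (X \<omega>)"
      by (simp add: k_def field_simps)
    finally have "norm (LBINT s:{0..t}. b s (X \<omega> s) (marginal M X s)) \<le> c + k * sup_norm T (X \<omega>)"
      using norm_triangle_sub[of "LBINT s:{0..t}. b s (X \<omega> s) (marginal M X s)" "F t"]
        norm_le_sup_norm[OF cF t] by (simp add: c_def)
    moreover have "norm (w \<omega> t) \<le> sup_norm T (w \<omega>)"
      by (rule norm_le_sup_norm[OF process_continuous[OF w \<omega>] t])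
    ultimately show "norm (picard M \<zeta> w X \<omega> t) \<le> norm (\<zeta> \<omega>) + (sup_norm T (w \<omega>) + (c + k * sup_norm T (X \<omega>)))"
      using norm_triangle_ineq[of "\<zeta> \<omega> + (LBINT s:{0..t}. b s (X \<omega> s) (marginal M X s))" "w \<omega> t"]
        norm_triangle_ineq[of "\<zeta> \<omega>" "LBINT s:{0..t}. b s (X \<omega> s) (marginal M X s)"] t
      by (simp add: picard_def)
  qed
  have "moment p M (\<lambda>\<omega>. sup_norm T (picard M \<zeta> w X \<omega>)) < \<infinity>"
  proof (rule nn_integral_powr_mono_finite)
    have nn: "0 \<le> k * sup_norm T (X \<omega>)" "0 \<le> sup_norm T (w \<omega>)" if "\<omega> \<in> space M" for \<omega>
      using process_sup_norm_nonneg[OF X that] process_sup_norm_nonneg[OF w that] k0 by auto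
    have 1: "moment p M (\<lambda>\<omega>. k * sup_norm T (X \<omega>)) < \<infinity>"
      using X k0 process_sup_norm_nonneg[OF X] by (intro nn_integral_powr_cmult_finite) (auto simp: process_def)
    have 2: "moment p M (\<lambda>\<omega>. c) < \<infinity>"
      by (simp add: emeasure_space_1)
    have 3: "moment p M (\<lambda>\<omega>. sup_norm T (w \<omega>)) < \<infinity>"
      using w by (simp add: process_def)
    show "moment p M (\<lambda>\<omega>. norm (\<zeta> \<omega>) + (sup_norm T (w \<omega>) + (c + k * sup_norm T (X \<omega>)))) < \<infinity>"
      using p nn c0
      by (intro nn_integral_powr_add_finite 1 2 3 fin) (auto intro!: add_nonneg_nonneg)
    show "AE \<omega> in M. 0 \<le> sup_norm T (picard M \<zeta> w X \<omega>) \<and>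
      sup_norm T (picard M \<zeta> w X \<omega>) \<le> norm (\<zeta> \<omega>) + (sup_norm T (w \<omega>) + (c + k * sup_norm T (X \<omega>)))"
      by (intro AE_I2 conjI bound sup_norm_nonneg T0 measurable_path_borel_continuous[OF Pm])
  qed (use p in simp)
  with Pm show ?thesis
    by (simp add: process_def)
qed

text \<open>Initial value and noise cancel, which leaves the difference of the drifts. For a single
  \<omega> this is not yet a contraction, because \<open>V\<close> involves all of the probability
  space; it becomes one together with the resulting bound on the p-norms.\<close>

lemma picard_contraction:
  assumes M: "prob_space M" and X: "process M X" and Y: "process M Y"
    and V: "V \<ge> 0" "moment p M (\<lambda>\<omega>. wdiff (X \<omega>) (Y \<omega>)) \<le> ennreal (V powr p)"
    and \<omega>: "\<omega> \<in> space M"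
  shows "wdiff (picard M \<zeta> w X \<omega>) (picard M \<zeta> w Y \<omega>) \<le> (wdiff (X \<omega>) (Y \<omega>) + V) / 8"
proof (rule weighted_norm_le[OF T0])
  fix t assume t: "t \<in> {0..T}"
  note c = process_continuous[OF X \<omega>] process_continuous[OF Y \<omega>]
  let ?D = "wdiff (X \<omega>) (Y \<omega>)"
  have "norm ((LBINT s:{0..t}. b s (X \<omega> s) (marginal M X s)) - (LBINT s:{0..t}. b s (Y \<omega> s) (marginal M Y s)))
      \<le> (?D + V) / 8 * exp (rate * t)"
  proof (rule drift_integral_diff_le[OF process_flow[OF M X] process_flow[OF M Y] c t])
    fix s assume s: "s \<in> {0..T}"
    show "norm (X \<omega> s - Y \<omega> s) + wdist (marginal M X s) (marginal M Y s) \<le> (?D + V) * exp (rate * s)"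
      using norm_le_weighted_norm[OF continuous_on_diff[OF c] s, of rate]
        wdist_marginal_le_wdiff[OF process_measurable[OF X] process_measurable[OF Y] s V]
      by (simp add: distrib_right)
  qed (use V wdiff_nonneg[OF c] in simp)
  then show "norm (picard M \<zeta> w X \<omega> t - picard M \<zeta> w Y \<omega> t) \<le> (?D + V) / 8 * exp (rate * t)"
    using t by (simp add: picard_def)
qed

lemma solution_if_picard_fixed:
  assumes M: "prob_space M" and X: "process M X"
    and fixed: "\<And>\<omega> t. \<omega> \<in> space M \<Longrightarrow> t \<in> {0..T} \<Longrightarrow> picard M \<zeta> w X \<omega> t = X \<omega> t"
  shows "solution M \<zeta> w X"
  unfolding mckean_vlasov_solution_def
proof (intro conjI ballI AE_I2)
  fix \<omega> t assume \<omega>: "\<omega> \<in> space M" and t: "t \<in> {0..T}"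
  show "set_integrable lborel {0..t} (\<lambda>s. b s (X \<omega> s) (marginal M X s))"
    by (intro drift_integrable_subset process_flow process_continuous[OF X \<omega>] M X t)
  show "X \<omega> t = \<zeta> \<omega> + (LBINT s:{0..t}. b s (X \<omega> s) (marginal M X s)) + w \<omega> t"
    using fixed[OF \<omega> t] t by (simp add: picard_def)
qed (auto intro: process_measurable[OF X] marginal_in_wasserstein_space[OF M X])

text \<open>The p-norms of successive differences are at most halved in each step, and these bounds
  feed the pathwise estimate D_(n+1) \<le> D_n / 8 + V_n / 8. The latter holds for every \<omega>,
  so the iterates converge uniformly on [0,T] for every \<omega>, without an exceptional null
  set.\<close>

lemma solution_exists:
  assumes M: "prob_space M" and inp: "input M \<zeta> w"
  obtains X where "solution M \<zeta> w X"
proof -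
  interpret prob_space M by fact
  define Z where "Z n = (picard M \<zeta> w ^^ n) (\<lambda>_. restrict (\<lambda>_. 0) {0..T})" for n
  have Z_Suc: "Z (Suc n) = picard M \<zeta> w (Z n)" for n
    by (simp add: Z_def)
  have Z0: "Z 0 \<omega> t = 0" if "t \<in> {0..T}" for \<omega> t
    using that by (simp add: Z_def)
  have Z: "process M (Z n)" for n
  proof (induction n)
    case 0
    have "Z 0 = (\<lambda>_. restrict (\<lambda>_. 0) {0..T})"
      by (simp add: Z_def)
    moreover have "sup_norm T (restrict (\<lambda>_. 0 :: 'a) {0..T}) = 0"
      using T0 by (simp add: sup_norm_def)
    moreover have "restrict (\<lambda>_. 0 :: 'a) {0..T} \<in> mspace (path_metric T)"
      by (intro restrict_in_path_metric continuous_on_const)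
    ultimately show ?case
      unfolding process_def by (simp del: restrict_apply)
  qed (simp add: Z_Suc picard_process[OF M inp])
  note cZ = process_continuous[OF Z]
  define D where "D n \<omega> = wdiff (Z (Suc n) \<omega>) (Z n \<omega>)" for n \<omega>
  have D0: "D n \<omega> \<ge> 0" if "\<omega> \<in> space M" for n \<omega>
    unfolding D_def by (intro wdiff_nonneg cZ that)
  have [measurable]: "D n \<in> borel_measurable M" for n
    unfolding D_def by (intro borel_measurable_weighted_norm_diff T0 process_measurable Z)
  obtain V' where V': "V' \<ge> 0" "ennreal (V' powr p) = moment p M (D 0)"
    unfolding D_def by (rule finite_ennreal_eq_powr[OF p_pos wdiff_finite[OF Z Z]])
  \<comment> \<open>The summand 1 keeps the bounds strictly positive, as
    \<open>nn_integral_Minkowski\<close> demands.\<close>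
  define V where "V n = (1 / 2) ^ n * (V' + 1)" for n
  have V0: "V n > 0" for n
    using V' by (simp add: V_def)
  have V_Suc: "V (Suc n) = V n / 2" for n
    by (simp add: V_def)
  have contr: "D (Suc n) \<omega> \<le> D n \<omega> / 8 + V n / 8"
    if le: "moment p M (D n) \<le> ennreal (V n powr p)" and \<omega>: "\<omega> \<in> space M" for n \<omega>
    using picard_contraction[OF M Z Z less_imp_le[OF V0] le[unfolded D_def] \<omega>, of \<zeta> w]
    by (simp add: D_def Z_Suc[symmetric] add_divide_distrib)
  have EV: "moment p M (D n) \<le> ennreal (V n powr p)" for n
  proof (induction n)
    case 0
    show ?case
      using V' p by (simp add: V'(2)[symmetric] V_def powr_mono2)
  next
    case (Suc n)
    have "moment p M (\<lambda>\<omega>. D n \<omega> / 8) = (\<integral>\<^sup>+\<omega>. ennreal ((1 / 8) powr p) * ennreal (D n \<omega> powr p) \<partial>M)"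
      by (intro nn_integral_cong) (simp add: D0 powr_divide ennreal_mult'[symmetric])
    also have "\<dots> = ennreal ((1 / 8) powr p) * moment p M (D n)"
      by (rule nn_integral_cmult) measurable
    also have "\<dots> \<le> ennreal ((1 / 8) powr p) * ennreal (V n powr p)"
      by (intro mult_left_mono Suc) simp
    also have "\<dots> = ennreal ((V n / 8) powr p)"
      using V0[of n] by (simp add: powr_divide ennreal_mult'[symmetric])
    finally have 1: "moment p M (\<lambda>\<omega>. D n \<omega> / 8) \<le> ennreal ((V n / 8) powr p)" .
    have "moment p M (\<lambda>\<omega>. D (Suc n) \<omega>) \<le> moment p M (\<lambda>\<omega>. D n \<omega> / 8 + V n / 8)"
      using p by (intro nn_integral_mono ennreal_leI powr_mono2 contr Suc D0) auto
    also have "\<dots> \<le> ennreal ((V n / 8 + V n / 8) powr p)"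
      using V0[of n] D0 by (intro nn_integral_Minkowski p 1) (auto simp: emeasure_space_1)
    also have "\<dots> \<le> ennreal (V (Suc n) powr p)"
      using V0[of n] p by (intro ennreal_leI powr_mono2) (auto simp: V_Suc)
    finally show ?case .
  qed
  \<comment> \<open>A single random variable with finite p-th moment that dominates all differences
    up to the factor 2^(-n). The recursion yields 2^(-n) R / 4, which is below 2^(-n-1) R.\<close>
  define R where "R \<omega> = D 0 \<omega> + V 0" for \<omega>
  have R0: "R \<omega> \<ge> 0" if "\<omega> \<in> space M" for \<omega>
    unfolding R_def using D0[OF that, of 0] V0[of 0] by simp
  have DR: "D n \<omega> \<le> (1 / 2) ^ n * R \<omega>" if \<omega>: "\<omega> \<in> space M" for n \<omega>
  proof (induction n)
    case (Suc n)
    have "V n \<le> (1 / 2) ^ n * R \<omega>"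
      unfolding R_def V_def using D0[OF \<omega>, of 0] V' by (intro mult_left_mono) auto
    with contr[OF EV \<omega>, of n] Suc have "D (Suc n) \<omega> \<le> (1 / 2) ^ n * R \<omega> / 8 + (1 / 2) ^ n * R \<omega> / 8"
      by linarith
    also have "\<dots> \<le> (1 / 2) ^ Suc n * R \<omega>"
      using R0[OF \<omega>] by simp
    finally show ?case .
  qed (use V0[of 0] in \<open>simp add: R_def\<close>)
  define c where "c = exp (rate * T)"
  have c0: "c > 0"
    by (simp add: c_def)
  have step: "norm (Z (Suc n) \<omega> t - Z n \<omega> t) \<le> (1 / 2) ^ n * (c * R \<omega>)"
    if \<omega>: "\<omega> \<in> space M" and t: "t \<in> {0..T}" for n \<omega> t
  proof -
    have "norm (Z (Suc n) \<omega> t - Z n \<omega> t) \<le> D n \<omega> * exp (rate * t)"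
      unfolding D_def by (intro norm_le_weighted_norm continuous_on_diff cZ \<omega> t)
    also have "\<dots> \<le> ((1 / 2) ^ n * R \<omega>) * c"
      unfolding c_def using R0[OF \<omega>] rate t by (intro mult_mono DR \<omega>) auto
    finally show ?thesis
      by (simp add: mult_ac)
  qed
  have dist_Z: "norm (Z (n + k) \<omega> t - Z n \<omega> t) \<le> (1 / 2) ^ n * (2 * c * R \<omega>)"
    if \<omega>: "\<omega> \<in> space M" and t: "t \<in> {0..T}" for n k \<omega> t
  proof -
    \<comment> \<open>The factor 1 - 2^(-k) comes from the finite geometric sum and makes the
      induction on \<open>k\<close> close.\<close>
    have "norm (Z (n + k) \<omega> t - Z n \<omega> t) \<le> (1 / 2) ^ n * (2 * c * R \<omega>) * (1 - (1 / 2) ^ k)"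
    proof (induction k)
      case (Suc k)
      have "norm (Z (n + Suc k) \<omega> t - Z n \<omega> t) \<le>
          norm (Z (Suc (n + k)) \<omega> t - Z (n + k) \<omega> t) + norm (Z (n + k) \<omega> t - Z n \<omega> t)"
        using norm_triangle_ineq[of "Z (Suc (n + k)) \<omega> t - Z (n + k) \<omega> t" "Z (n + k) \<omega> t - Z n \<omega> t"] by simp
      also have "\<dots> \<le> (1 / 2) ^ (n + k) * (c * R \<omega>) + (1 / 2) ^ n * (2 * c * R \<omega>) * (1 - (1 / 2) ^ k)"
        by (intro add_mono step[OF \<omega> t] Suc)
      also have "\<dots> = (1 / 2) ^ n * (2 * c * R \<omega>) * (1 - (1 / 2) ^ Suc k)"
        by (simp add: power_add algebra_simps)
      finally show ?case .
    qed simp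
    also have "\<dots> \<le> (1 / 2) ^ n * (2 * c * R \<omega>) * 1"
      using R0[OF \<omega>] c0 by (intro mult_left_mono) auto
    finally show ?thesis
      by simp
  qed
  \<comment> \<open>The limit is written as a telescoping series, starting from the zero path, so
    that the Weierstrass test gives uniform convergence.\<close>
  define X where "X \<omega> = restrict (\<lambda>t. \<Sum>i. Z (Suc i) \<omega> t - Z i \<omega> t) {0..T}" for \<omega>
  have unif: "uniform_limit {0..T} (\<lambda>n. Z n \<omega>) (X \<omega>) sequentially" if \<omega>: "\<omega> \<in> space M" for \<omega>
  proof -
    have "uniform_limit {0..T} (\<lambda>n t. \<Sum>i<n. Z (Suc i) \<omega> t - Z i \<omega> t)
        (\<lambda>t. \<Sum>i. Z (Suc i) \<omega> t - Z i \<omega> t) sequentially"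
      using step[OF \<omega>] by (rule Weierstrass_m_test) (auto intro!: summable_mult2 summable_geometric)
    moreover have "(\<Sum>i<n. Z (Suc i) \<omega> t - Z i \<omega> t) = Z n \<omega> t" if "t \<in> {0..T}" for n t
      using sum_lessThan_telescope[of "\<lambda>i. Z i \<omega> t" n] Z0[OF that] by simp
    ultimately show ?thesis
      by (subst (asm) uniform_limit_cong'[where g = "\<lambda>n. Z n \<omega>" and i = "X \<omega>"]) (auto simp: X_def)
  qed
  have lim: "(\<lambda>n. Z n \<omega> t) \<longlonglongrightarrow> X \<omega> t" if "\<omega> \<in> space M" "t \<in> {0..T}" for \<omega> t
    using tendsto_uniform_limitI[OF unif[OF that(1)] that(2)] .
  have X_path: "X \<omega> \<in> mspace (path_metric T)" if \<omega>: "\<omega> \<in> space M" for \<omega>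
  proof -
    have "continuous_on {0..T} (X \<omega>)"
      by (rule uniform_limit_theorem[OF _ unif[OF \<omega>]]) (simp_all add: cZ[OF \<omega>])
    then show ?thesis
      by (auto simp: mspace_path_metric_iff X_def)
  qed
  have mX: "X \<in> M \<rightarrow>\<^sub>M path_borel T"
  proof (rule measurable_path_borelI[OF T0 X_path])
    fix t assume t: "t \<in> {0..T}"
    show "(\<lambda>\<omega>. X \<omega> t) \<in> borel_measurable M"
      by (rule borel_measurable_LIMSEQ_metric[where f = "\<lambda>n \<omega>. Z n \<omega> t"])
        (auto intro: measurable_path_eval[OF process_measurable[OF Z] t] lim[OF _ t])
  qed
  note cX = measurable_path_borel_continuous[OF mX]
  have dist_X: "norm (X \<omega> t - Z n \<omega> t) \<le> (1 / 2) ^ n * (2 * c * R \<omega>)"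
    if \<omega>: "\<omega> \<in> space M" and t: "t \<in> {0..T}" for n \<omega> t
  proof (rule Lim_norm_ubound)
    show "(\<lambda>k. Z (n + k) \<omega> t - Z n \<omega> t) \<longlonglongrightarrow> X \<omega> t - Z n \<omega> t"
      using LIMSEQ_ignore_initial_segment[OF lim[OF \<omega> t], of n]
      by (intro tendsto_diff tendsto_const) (simp add: add.commute)
    show "\<forall>\<^sub>F k in sequentially. norm (Z (n + k) \<omega> t - Z n \<omega> t) \<le> (1 / 2) ^ n * (2 * c * R \<omega>)"
      by (simp add: dist_Z[OF \<omega> t])
  qed simp
  have R_fin: "moment p M (\<lambda>\<omega>. 2 * c * R \<omega>) < \<infinity>"
  proof (rule nn_integral_powr_cmult_finite)
    show "moment p M (\<lambda>\<omega>. R \<omega>) < \<infinity>"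
      unfolding R_def using D0 V0[of 0] p EV[of 0]
      by (intro nn_integral_powr_add_finite) (auto simp: emeasure_space_1 intro: order.strict_trans1 less_imp_le)
  qed (use R0 c0 in \<open>auto simp: R_def\<close>)
  have pX: "process M X"
  proof -
    have "moment p M (\<lambda>\<omega>. sup_norm T (X \<omega>)) < \<infinity>"
    proof (rule nn_integral_powr_mono_finite[OF _ R_fin])
      show "AE \<omega> in M. 0 \<le> sup_norm T (X \<omega>) \<and> sup_norm T (X \<omega>) \<le> 2 * c * R \<omega>"
        using dist_X[of _ _ 0] Z0 by (intro AE_I2 conjI sup_norm_nonneg sup_norm_le T0 cX) auto
    qed (use p in simp)
    with mX show ?thesis
      by (simp add: process_def)
  qed
  \<comment> \<open>After multiplication by 2^(-n), \<open>U\<close> bounds the p-norm of the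
    distance between \<open>X\<close> and the n-th iterate, and thereby the distance of their
    flows.\<close>
  obtain U where U: "U \<ge> 0" "ennreal (U powr p) = moment p M (\<lambda>\<omega>. 2 * c * R \<omega>)"
    by (rule finite_ennreal_eq_powr[OF p_pos R_fin])
  have wX: "wdiff (X \<omega>) (Z n \<omega>) \<le> (1 / 2) ^ n * (2 * c * R \<omega>)" if \<omega>: "\<omega> \<in> space M" for n \<omega>
  proof (rule order_trans[OF weighted_norm_le_sup_norm sup_norm_le])
    show "continuous_on {0..T} (\<lambda>t. X \<omega> t - Z n \<omega> t)"
      by (intro continuous_on_diff cX cZ \<omega>)
  qed (use rate T0 dist_X[OF \<omega>] in auto)
  have EX: "moment p M (\<lambda>\<omega>. wdiff (X \<omega>) (Z n \<omega>)) \<le> ennreal (((1 / 2) ^ n * U) powr p)" for n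
  proof -
    have [measurable]: "R \<in> borel_measurable M"
      unfolding R_def by measurable
    have "moment p M (\<lambda>\<omega>. wdiff (X \<omega>) (Z n \<omega>))
      \<le> (\<integral>\<^sup>+\<omega>. ennreal (((1 / 2) ^ n) powr p) * ennreal ((2 * c * R \<omega>) powr p) \<partial>M)"
    proof (rule nn_integral_mono)
      fix \<omega> assume \<omega>: "\<omega> \<in> space M"
      have "wdiff (X \<omega>) (Z n \<omega>) powr p \<le> ((1 / 2) ^ n * (2 * c * R \<omega>)) powr p"
        using p by (intro powr_mono2 wX wdiff_nonneg cX cZ \<omega>) auto
      also have "\<dots> = ((1 / 2) ^ n) powr p * (2 * c * R \<omega>) powr p"
        using R0[OF \<omega>] c0 by (subst powr_mult) auto
      finally show "ennreal (wdiff (X \<omega>) (Z n \<omega>) powr p)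
          \<le> ennreal (((1 / 2) ^ n) powr p) * ennreal ((2 * c * R \<omega>) powr p)"
        by (subst ennreal_mult'[symmetric]) auto
    qed
    also have "\<dots> = ennreal (((1 / 2) ^ n) powr p) * ennreal (U powr p)"
      unfolding U(2) by (rule nn_integral_cmult) measurable
    also have "\<dots> = ennreal (((1 / 2) ^ n * U) powr p)"
      using U(1) by (subst powr_mult) (auto simp: ennreal_mult')
    finally show ?thesis .
  qed
  \<comment> \<open>The iterates with shifted index converge to \<open>X\<close> by construction and
    to \<open>picard M \<zeta> w X\<close> by the contraction estimate, so the two limits
    agree.\<close>
  have "picard M \<zeta> w X \<omega> t = X \<omega> t" if \<omega>: "\<omega> \<in> space M" and t: "t \<in> {0..T}" for \<omega> t
  proof (rule LIMSEQ_unique)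
    note pP = picard_process[OF M inp pX]
    have bound: "norm (Z (Suc n) \<omega> t - picard M \<zeta> w X \<omega> t) \<le> (1 / 2) ^ n * (((2 * c * R \<omega>) + U) / 8 * exp (rate * t))" for n
    proof -
      have "norm (picard M \<zeta> w X \<omega> t - Z (Suc n) \<omega> t)
          \<le> wdiff (picard M \<zeta> w X \<omega>) (Z (Suc n) \<omega>) * exp (rate * t)"
        by (intro norm_le_weighted_norm continuous_on_diff cZ process_continuous[OF pP] \<omega> t)
      also have "\<dots> \<le> (((1 / 2) ^ n * (2 * c * R \<omega>) + (1 / 2) ^ n * U) / 8) * exp (rate * t)"
      proof (rule mult_right_mono)
        have "wdiff (picard M \<zeta> w X \<omega>) (Z (Suc n) \<omega>)
            \<le> (wdiff (X \<omega>) (Z n \<omega>) + (1 / 2) ^ n * U) / 8"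
          unfolding Z_Suc using U(1) by (intro picard_contraction M pX Z EX \<omega>) auto
        also have "\<dots> \<le> ((1 / 2) ^ n * (2 * c * R \<omega>) + (1 / 2) ^ n * U) / 8"
          by (intro divide_right_mono add_right_mono wX \<omega>) simp
        finally show "wdiff (picard M \<zeta> w X \<omega>) (Z (Suc n) \<omega>)
            \<le> ((1 / 2) ^ n * (2 * c * R \<omega>) + (1 / 2) ^ n * U) / 8" .
      qed simp
      finally show ?thesis
        by (simp add: norm_minus_commute algebra_simps)
    qed
    have "(\<lambda>n. Z (Suc n) \<omega> t - picard M \<zeta> w X \<omega> t) \<longlonglongrightarrow> 0"
    proof (rule Lim_null_comparison)
      show "\<forall>\<^sub>F n in sequentially. norm (Z (Suc n) \<omega> t - picard M \<zeta> w X \<omega> t)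
          \<le> (1 / 2) ^ n * (((2 * c * R \<omega>) + U) / 8 * exp (rate * t))"
        by (intro always_eventually allI bound)
      show "(\<lambda>n. (1 / 2) ^ n * (((2 * c * R \<omega>) + U) / 8 * exp (rate * t))) \<longlonglongrightarrow> 0"
        by (intro tendsto_mult_left_zero LIMSEQ_power_zero) simp
    qed
    then show "(\<lambda>n. Z (Suc n) \<omega> t) \<longlonglongrightarrow> picard M \<zeta> w X \<omega> t"
      by (rule LIM_zero_cancel)
    show "(\<lambda>n. Z (Suc n) \<omega> t) \<longlonglongrightarrow> X \<omega> t"
      by (rule LIMSEQ_Suc[OF lim[OF \<omega> t]])
  qed
  with that show thesis
    using solution_if_picard_fixed[OF M pX] by blast
qed

end

section \<open>Empirical measures\<close>

text \<open>A continuous function of finitely many points of a separable space is Borel: the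
  preimage of an open set is covered by countably many boxes with centres in a dense set. Continuity
  is stated for extensional families with the maximum distance.\<close>

lemma borel_measurable_continuous_separable:
  fixes F :: "('i \<Rightarrow> 'e) \<Rightarrow> 'b::metric_space"
  assumes sep: "separable_space (mtopology_of m)" and I: "finite I"
    and \<Xi>: "\<And>i. i \<in> I \<Longrightarrow> \<Xi> i \<in> M \<rightarrow>\<^sub>M borel_metric m"
    and cont: "\<And>e \<delta>. e \<in> I \<rightarrow>\<^sub>E mspace m \<Longrightarrow> \<delta> > 0 \<Longrightarrow>
      \<exists>r>0. \<forall>e'\<in>I \<rightarrow>\<^sub>E mspace m. (\<forall>i\<in>I. mdist m (e i) (e' i) < r) \<longrightarrow> dist (F e) (F e') < \<delta>"
  shows "(\<lambda>\<omega>. F (\<lambda>i\<in>I. \<Xi> i \<omega>)) \<in> borel_measurable M"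
proof (rule borel_measurableI)
  fix U :: "'b set" assume "open U"
  obtain D where D: "countable D" "D \<subseteq> mspace m"
    "\<And>x r. x \<in> mspace m \<Longrightarrow> r > 0 \<Longrightarrow> \<exists>d\<in>D. mdist m x d < r"
    using sep unfolding separable_space_mtopology_of_iff by metis
  define \<xi> where "\<xi> \<omega> = (\<lambda>i\<in>I. \<Xi> i \<omega>)" for \<omega>
  have \<xi>: "\<xi> \<omega> \<in> I \<rightarrow>\<^sub>E mspace m" if "\<omega> \<in> space M" for \<omega>
    using measurable_space[OF \<Xi> that] by (auto simp: \<xi>_def)
  define B where "B d n = {e \<in> I \<rightarrow>\<^sub>E mspace m. \<forall>i\<in>I. mdist m (d i) (e i) < 1 / real (Suc n)}" for d n
  \<comment> \<open>The boxes with centres from the dense set on which \<open>F\<close> takes values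
    in \<open>U\<close> only. Finiteness of \<open>I\<close> makes the set of centres
    countable.\<close>
  define Q where "Q = {(d, n). d \<in> I \<rightarrow>\<^sub>E D \<and> (\<forall>e\<in>B d n. F e \<in> U)}"
  have "countable Q"
    by (rule countable_subset[of _ "(I \<rightarrow>\<^sub>E D) \<times> UNIV"])
      (auto simp: Q_def intro!: countable_SIGMA countable_PiE I D)
  have meas: "{\<omega> \<in> space M. \<xi> \<omega> \<in> B d n} \<in> sets M" if d: "d \<in> I \<rightarrow>\<^sub>E D" for d n
  proof -
    have "{\<omega> \<in> space M. mdist m (d i) (\<Xi> i \<omega>) < 1 / real (Suc n)} \<in> sets M" if i: "i \<in> I" for i
    proof -
      have di: "d i \<in> mspace m"
        using d i D by (auto simp: PiE_iff)
      interpret Metric_space "mspace m" "mdist m" by simp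
      have "mball (d i) (1 / real (Suc n)) \<in> sets (borel_metric m)"
        by (rule openin_in_sets_borel_metric) (simp add: mtopology_of_def)
      from measurable_sets[OF \<Xi>[OF i] this]
      have "\<Xi> i -` mball (d i) (1 / real (Suc n)) \<inter> space M \<in> sets M" .
      also have "\<Xi> i -` mball (d i) (1 / real (Suc n)) \<inter> space M =
          {\<omega> \<in> space M. mdist m (d i) (\<Xi> i \<omega>) < 1 / real (Suc n)}"
        using di measurable_space[OF \<Xi>[OF i]] by auto
      finally show ?thesis .
    qed
    then have "{\<omega> \<in> space M. \<forall>i\<in>I. mdist m (d i) (\<Xi> i \<omega>) < 1 / real (Suc n)} \<in> sets M"
      by (rule sets.sets_Collect_countable_All'[OF _ countable_finite[OF I]])
    also have "{\<omega> \<in> space M. \<forall>i\<in>I. mdist m (d i) (\<Xi> i \<omega>) < 1 / real (Suc n)} = {\<omega> \<in> space M. \<xi> \<omega> \<in> B d n}"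
      using \<xi> by (auto simp: B_def) (auto simp: \<xi>_def)
    finally show ?thesis .
  qed
  have "(\<lambda>\<omega>. F (\<xi> \<omega>)) -` U \<inter> space M = (\<Union>(d, n)\<in>Q. {\<omega> \<in> space M. \<xi> \<omega> \<in> B d n})"
  proof (intro equalityI subsetI)
    fix \<omega> assume "\<omega> \<in> (\<lambda>\<omega>. F (\<xi> \<omega>)) -` U \<inter> space M"
    then have \<omega>: "\<omega> \<in> space M" and "F (\<xi> \<omega>) \<in> U"
      by auto
    then obtain \<delta> where \<delta>: "\<delta> > 0" "\<And>y. dist (F (\<xi> \<omega>)) y < \<delta> \<Longrightarrow> y \<in> U"
      using \<open>open U\<close> unfolding open_dist by (metis dist_commute)
    obtain r where r: "r > 0" "\<And>e'. e' \<in> I \<rightarrow>\<^sub>E mspace m \<Longrightarrow> (\<forall>i\<in>I. mdist m (\<xi> \<omega> i) (e' i) < r) \<Longrightarrow>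
        dist (F (\<xi> \<omega>)) (F e') < \<delta>"
      using cont[OF \<xi>[OF \<omega>] \<delta>(1)] by blast
    obtain n where n: "1 / real (Suc n) < r / 2"
      using reals_Archimedean[of "r / 2"] r(1) by (auto simp: inverse_eq_divide)
    have "\<exists>d\<in>D. mdist m (\<xi> \<omega> i) d < 1 / real (Suc n)" if "i \<in> I" for i
      using D(3)[of "\<xi> \<omega> i" "1 / real (Suc n)"] \<xi>[OF \<omega>] that by (auto simp: PiE_iff)
    then obtain d0 where d0: "\<And>i. i \<in> I \<Longrightarrow> d0 i \<in> D" "\<And>i. i \<in> I \<Longrightarrow> mdist m (\<xi> \<omega> i) (d0 i) < 1 / real (Suc n)"
      by metis
    define d where "d = restrict d0 I"
    have d: "d \<in> I \<rightarrow>\<^sub>E D" "\<And>i. i \<in> I \<Longrightarrow> mdist m (\<xi> \<omega> i) (d i) < 1 / real (Suc n)"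
      using d0 by (auto simp: d_def)
    have "F e \<in> U" if e: "e \<in> B d n" for e
    proof (rule \<delta>(2)[OF r(2)])
      show "\<forall>i\<in>I. mdist m (\<xi> \<omega> i) (e i) < r"
      proof
        fix i assume i: "i \<in> I"
        have "\<xi> \<omega> i \<in> mspace m" "d i \<in> mspace m" "e i \<in> mspace m" "mdist m (d i) (e i) < 1 / real (Suc n)"
          using i \<xi>[OF \<omega>] d D e unfolding B_def PiE_iff by blast+
        then show "mdist m (\<xi> \<omega> i) (e i) < r"
          using mdist_triangle[of "\<xi> \<omega> i" m "d i" "e i"] d(2)[OF i] n by linarith
      qed
    qed (use e in \<open>simp add: B_def\<close>)
    then have "(d, n) \<in> Q"
      using d by (simp add: Q_def)
    moreover have "\<xi> \<omega> \<in> B d n"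
      using \<xi>[OF \<omega>] d(2) by (simp add: B_def mdist_commute)
    ultimately show "\<omega> \<in> (\<Union>(d, n)\<in>Q. {\<omega> \<in> space M. \<xi> \<omega> \<in> B d n})"
      using \<omega> by blast
  qed (auto simp: Q_def)
  also have "\<dots> \<in> sets M"
    using \<open>countable Q\<close> meas by (intro sets.countable_UN') (auto simp: Q_def)
  finally show "(\<lambda>\<omega>. F (\<lambda>i\<in>I. \<Xi> i \<omega>)) -` U \<inter> space M \<in> sets M"
    by (simp add: \<xi>_def)
qed

lemma AE_uniform_count_measure:
  "finite A \<Longrightarrow> (AE x in uniform_count_measure A. P x) \<longleftrightarrow> (\<forall>x\<in>A. P x)"
  unfolding uniform_count_measure_def AE_point_measure by (auto simp: card_gt_0_iff)

lemma nn_integral_uniform_count_measure: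
  "finite A \<Longrightarrow> (\<integral>\<^sup>+x. f x \<partial>uniform_count_measure A) = (\<Sum>x\<in>A. ennreal (1 / real (card A)) * f x)"
  unfolding uniform_count_measure_def by (rule nn_integral_point_measure_finite)

lemma measurable_uniform_count_measure:
  "f \<in> uniform_count_measure A \<rightarrow>\<^sub>M S \<longleftrightarrow> f \<in> A \<rightarrow> space S"
  by (auto simp: measurable_def space_uniform_count_measure sets_uniform_count_measure)

section \<open>Dependence of the solution on the law of its input\<close>

context lipschitz_drift
begin

abbreviation input_borel :: "('a \<times> (real \<Rightarrow> 'a)) measure" where
  "input_borel \<equiv> borel_metric (input_metric T)"

abbreviation input_law :: "'w measure \<Rightarrow> ('w \<Rightarrow> 'a) \<Rightarrow> ('w \<Rightarrow> real \<Rightarrow> 'a) \<Rightarrow> ('a \<times> (real \<Rightarrow> 'a)) measure" where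
  "input_law M \<zeta> w \<equiv> distr M input_borel (\<lambda>\<omega>. (\<zeta> \<omega>, w \<omega>))"

lemma stab_const_pos: "stab_const > 0"
  by (simp add: stab_const_def)

text \<open>Both summands of the gap are bounded by the Euclidean product distance. The 2 here is
  the origin of the factor \<open>2 powr p\<close> in the final constant.\<close>

lemma gap_le_mdist:
  assumes "u \<in> mspace (input_metric T)" "v \<in> mspace (input_metric T)"
  shows "gap (fst u) (snd u) (fst v) (snd v) \<le> 2 * mdist (input_metric T) u v"
proof -
  have "mdist (path_metric T) (snd u) (snd v) = sup_dist T (snd u) (snd v)"
    using assms by (intro mdist_path_metric T0) auto
  moreover have "mdist (path_metric T) (snd u) (snd v) \<le> mdist (input_metric T) u v"
      "dist (fst u) (fst v) \<le> mdist (input_metric T) u v"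
    by (simp_all add: prod_dist_def case_prod_beta)
  ultimately show ?thesis
    by (simp add: gap_def dist_norm)
qed

lemma mdist_input_le:
  assumes "v \<in> mspace (input_metric T)"
  shows "mdist (input_metric T) (0, restrict (\<lambda>_. 0) {0..T}) v \<le> norm (fst v) + sup_norm T (snd v :: real \<Rightarrow> 'a)"
proof -
  have "mdist (path_metric T) (restrict (\<lambda>_. 0) {0..T}) (snd v) = sup_dist T (restrict (\<lambda>_. 0) {0..T}) (snd v)"
    using assms by (intro mdist_path_metric T0 restrict_in_path_metric) auto
  also have "\<dots> = sup_norm T (snd v)"
    by (simp add: sup_norm_def)
  finally show ?thesis
    using sqrt_sum_squares_le_sum[of "norm (fst v)" "sup_norm T (snd v)"]
      sup_norm_nonneg[OF T0, of "snd v"] assms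
    by (auto simp: prod_dist_def case_prod_beta mspace_path_metric_iff)
qed

lemma measurable_input:
  assumes "input M \<zeta> w"
  shows "(\<lambda>\<omega>. (\<zeta> \<omega>, w \<omega>)) \<in> M \<rightarrow>\<^sub>M input_borel"
  using assms by (intro measurable_input_pair T0) (auto simp: input_def process_def)

lemma input_canonical:
  assumes inp: "input M \<zeta> w"
  shows "input (input_law M \<zeta> w) fst snd"
proof -
  note m = measurable_input[OF inp]
  note [measurable] = measurable_fst_input[of T, where 'a = 'a]
  have s: "snd \<in> input_borel \<rightarrow>\<^sub>M path_borel T"
    by (rule measurable_snd_input)
  note [measurable] = borel_measurable_process_sup_norm[OF s]
  show ?thesis
    using inp m s by (simp add: input_def process_def nn_integral_distr)
qed

text \<open>Composed with the input, \<open>Y\<close> solves the equation on \<open>M\<close> and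
  hence equals \<open>X\<close> almost surely. Pathwise uniqueness so gives uniqueness in law, and
  \<open>Y\<close> exhibits the solution as a function of its input.\<close>

lemma law_canonical:
  assumes M: "prob_space M" and inp: "input M \<zeta> w" and X: "solution M \<zeta> w X"
    and Y: "solution (input_law M \<zeta> w) fst snd Y"
  shows "distr M (path_borel T) X = distr (input_law M \<zeta> w) (path_borel T) Y"
proof -
  let ?\<xi> = "\<lambda>\<omega>. (\<zeta> \<omega>, w \<omega>)"
  let ?\<mu> = "distr M input_borel ?\<xi>"
  note m = measurable_input[OF inp]
  have Ym: "Y \<in> input_borel \<rightarrow>\<^sub>M path_borel T"
    using Y by (simp add: mckean_vlasov_solution_def)
  have "solution M (\<lambda>\<omega>. fst (?\<xi> \<omega>)) (\<lambda>\<omega>. snd (?\<xi> \<omega>)) (\<lambda>\<omega>. Y (?\<xi> \<omega>))"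
    by (rule solution_transfer[OF _ _ Y]) (use m in \<open>auto intro!: distr_cong\<close>)
  then have "AE \<omega> in M. X \<omega> = Y (?\<xi> \<omega>)"
    by (intro solution_unique[OF M inp X]) simp
  then have "distr M (path_borel T) X = distr M (path_borel T) (\<lambda>\<omega>. Y (?\<xi> \<omega>))"
    using X measurable_compose[OF m Ym]
    by (intro distr_cong_AE) (auto simp: mckean_vlasov_solution_def)
  also have "\<dots> = distr ?\<mu> (path_borel T) Y"
    by (subst distr_distr[OF Ym m]) (simp add: comp_def)
  finally show ?thesis .
qed

text \<open>The witness of finiteness that \<open>le_wasserstein_powr\<close> asks for.\<close>

lemma coupling_cost_input_finite:
  assumes M: "prob_space M" "prob_space M'" and in1: "input M \<zeta> w" and in2: "input M' \<zeta>' w'"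
  defines "\<mu> \<equiv> input_law M \<zeta> w"
    and "\<nu> \<equiv> input_law M' \<zeta>' w'"
  shows "\<mu> \<Otimes>\<^sub>M \<nu> \<in> couplings \<mu> \<nu>" "coupling_cost p (input_metric T) (\<mu> \<Otimes>\<^sub>M \<nu>) < \<infinity>"
proof -
  let ?o = "(0, restrict (\<lambda>_. 0) {0..T}) :: 'a \<times> (real \<Rightarrow> 'a)"
  have o: "?o \<in> mspace (input_metric T)"
    by (auto intro!: restrict_in_path_metric simp del: restrict_apply)
  note [measurable] = measurable_fst_input[of T, where 'a = 'a]
  have s: "snd \<in> input_borel \<rightarrow>\<^sub>M path_borel T"
    by (rule measurable_snd_input)
  have dist_meas: "(\<lambda>x. mdist (input_metric T) ?o x) \<in> borel_measurable input_borel"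
    using borel_measurable_input_dist[OF T0, of "\<lambda>_. 0" input_borel fst "\<lambda>_. restrict (\<lambda>_. 0) {0..T}" snd] s o
    by (simp del: restrict_apply)
  have fin: "moment p \<rho> (\<lambda>x. mdist (input_metric T) ?o x) < \<infinity>"
    if inp: "input \<rho> fst snd" and \<rho>: "sets \<rho> = sets input_borel" for \<rho>
  proof (rule nn_integral_powr_mono_finite)
    show "moment p \<rho> (\<lambda>x. norm (fst x) + sup_norm T (snd x :: real \<Rightarrow> 'a)) < \<infinity>"
      using inp p process_sup_norm_nonneg[of \<rho> snd]
      by (intro nn_integral_powr_add_finite borel_measurable_process_sup_norm)
        (auto simp: input_def process_def)
    show "AE x in \<rho>. 0 \<le> mdist (input_metric T) ?o x \<and> mdist (input_metric T) ?o x \<le> norm (fst x) + sup_norm T (snd x)"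
      using mdist_input_le sets_eq_imp_space_eq[OF \<rho>] by (intro AE_I2 conjI mdist_nonneg) (auto simp del: mdist_prod_metric)
  qed (use p in simp)
  have i: "input \<mu> fst snd" "input \<nu> fst snd"
    unfolding \<mu>_def \<nu>_def by (intro input_canonical in1 in2)+
  show c: "\<mu> \<Otimes>\<^sub>M \<nu> \<in> couplings \<mu> \<nu>"
    unfolding \<mu>_def \<nu>_def
    by (intro pair_measure_in_couplings prob_space.prob_space_distr M measurable_input in1 in2)
  show "coupling_cost p (input_metric T) (\<mu> \<Otimes>\<^sub>M \<nu>) < \<infinity>"
    by (rule coupling_cost_finite[OF p _ _ _ c o dist_meas fin[OF i(1)] fin[OF i(2)]])
      (simp_all add: \<mu>_def \<nu>_def del: mdist_prod_metric mspace_prod_metric)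
qed

text \<open>A coupling is itself used as the probability space: its projections preserve measure and
  carry the two canonical solutions to it, where \<open>solution_stability_sup\<close> compares
  them. The original spaces \<open>M\<close> and \<open>M'\<close> need not be related, so {1..N}
  and \<Omega> may be inserted.\<close>

lemma wasserstein_stability:
  assumes M: "prob_space M" "prob_space M'" and in1: "input M \<zeta> w" and in2: "input M' \<zeta>' w'"
    and X: "solution M \<zeta> w X" and Y: "solution M' \<zeta>' w' Y"
  shows "wasserstein p (path_metric T) (distr M (path_borel T) X) (distr M' (path_borel T) Y) powr p
    \<le> stab_const * 2 powr p *
      wasserstein p (input_metric T) (input_law M \<zeta> w)
        (input_law M' \<zeta>' w') powr p"
proof -
  let ?\<mu> = "input_law M \<zeta> w"
  let ?\<nu> = "input_law M' \<zeta>' w'"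
  note m = measurable_input[OF in1] measurable_input[OF in2]
  have P: "prob_space ?\<mu>" "prob_space ?\<nu>"
    by (intro prob_space.prob_space_distr M m)+
  note i = input_canonical[OF in1] input_canonical[OF in2]
  obtain X' where X': "solution ?\<mu> fst snd X'"
    by (rule solution_exists[OF P(1) i(1)])
  obtain Y' where Y': "solution ?\<nu> fst snd Y'"
    by (rule solution_exists[OF P(2) i(2)])
  have mX': "X' \<in> input_borel \<rightarrow>\<^sub>M path_borel T" and mY': "Y' \<in> input_borel \<rightarrow>\<^sub>M path_borel T"
    using X' Y' by (simp_all add: mckean_vlasov_solution_def)
  note law = law_canonical[OF M(1) in1 X X'] law_canonical[OF M(2) in2 Y Y']
  show ?thesis
  proof (rule le_wasserstein_powr[OF p _ _ coupling_cost_input_finite[OF M in1 in2]])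
    show "stab_const * 2 powr p > 0"
      using stab_const_pos by simp
    fix \<gamma> assume \<gamma>: "\<gamma> \<in> couplings ?\<mu> ?\<nu>"
    have s\<gamma>: "sets \<gamma> = sets (input_borel \<Otimes>\<^sub>M input_borel)"
      and marg: "distr \<gamma> input_borel fst = ?\<mu>" "distr \<gamma> input_borel snd = ?\<nu>"
      using \<gamma> couplings_iff[of ?\<mu> input_borel ?\<nu> \<gamma>] by auto
    have fs: "fst \<in> \<gamma> \<rightarrow>\<^sub>M input_borel" "snd \<in> \<gamma> \<rightarrow>\<^sub>M input_borel"
      using s\<gamma> by (auto simp: measurable_cong_sets[OF s\<gamma> refl])
    have fs': "fst \<in> \<gamma> \<rightarrow>\<^sub>M ?\<mu>" "snd \<in> \<gamma> \<rightarrow>\<^sub>M ?\<nu>"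
      using fs by simp_all
    have marg': "distr \<gamma> ?\<mu> fst = ?\<mu>" "distr \<gamma> ?\<nu> snd = ?\<nu>"
      using \<gamma> by (simp_all add: couplings_def)
    have P\<gamma>: "prob_space \<gamma>"
      using prob_space_distrD[OF fs(1)] P(1) marg(1) by simp
    note sX = solution_transfer[OF fs'(1) marg'(1) X'] and sY = solution_transfer[OF fs'(2) marg'(2) Y']
    note iX = input_transfer[OF fs'(1) marg'(1) i(1)] and iY = input_transfer[OF fs'(2) marg'(2) i(2)]
    have mX: "(\<lambda>u. X' (fst u)) \<in> \<gamma> \<rightarrow>\<^sub>M path_borel T" and mY: "(\<lambda>u. Y' (snd u)) \<in> \<gamma> \<rightarrow>\<^sub>M path_borel T"
      by (rule measurable_compose[OF fs(1) mX'] measurable_compose[OF fs(2) mY'])+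
    have l: "distr \<gamma> (path_borel T) (\<lambda>u. X' (fst u)) = distr ?\<mu> (path_borel T) X'"
        "distr \<gamma> (path_borel T) (\<lambda>u. Y' (snd u)) = distr ?\<nu> (path_borel T) Y'"
      using distr_distr[OF mX' fs(1)] distr_distr[OF mY' fs(2)] by (simp_all add: marg comp_def)
    have sp: "fst u \<in> mspace (input_metric T)" "snd u \<in> mspace (input_metric T)" if "u \<in> space \<gamma>" for u
      using that measurable_space[OF fs(1) that] measurable_space[OF fs(2) that] by simp_all
    have [measurable]: "(\<lambda>u. mdist (input_metric T) (fst u) (snd u)) \<in> borel_measurable \<gamma>"
      using borel_measurable_mdist_input_metric[OF T0, where 'a = 'a]
      by (simp add: case_prod_beta' measurable_cong_sets[OF s\<gamma> refl])
    have "ennreal (wasserstein p (path_metric T) (distr M (path_borel T) X) (distr M' (path_borel T) Y) powr p)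
      \<le> moment p \<gamma> (\<lambda>u. mdist (path_metric T) (X' (fst u)) (Y' (snd u)))"
      unfolding law l[symmetric] by (rule wasserstein_distr_le[OF p mX mY])
    also have "\<dots> = moment p \<gamma> (\<lambda>u. sup_dist T (X' (fst u)) (Y' (snd u)))"
      by (intro nn_integral_cong)
        (simp add: mdist_path_metric[OF T0 measurable_path_borel_space[OF mX] measurable_path_borel_space[OF mY]])
    also have "\<dots> \<le> ennreal stab_const *
        moment p \<gamma> (\<lambda>u. gap (fst (fst u)) (snd (fst u)) (fst (snd u)) (snd (snd u)))"
      by (rule solution_stability_sup[OF P\<gamma> iX iY sX sY])
    also have "\<dots> \<le> ennreal stab_const *
        (\<integral>\<^sup>+u. ennreal (2 powr p) * ennreal (mdist (input_metric T) (fst u) (snd u) powr p) \<partial>\<gamma>)"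
    proof (intro mult_left_mono nn_integral_mono)
      fix u assume u: "u \<in> space \<gamma>"
      have "gap (fst (fst u)) (snd (fst u)) (fst (snd u)) (snd (snd u)) powr p
          \<le> (2 * mdist (input_metric T) (fst u) (snd u)) powr p"
        using p sp[OF u] by (intro powr_mono2 gap_le_mdist gap_nonneg) (auto simp: mspace_path_metric_iff)
      also have "\<dots> = 2 powr p * mdist (input_metric T) (fst u) (snd u) powr p"
        by (rule powr_mult)
      finally show "ennreal (gap (fst (fst u)) (snd (fst u)) (fst (snd u)) (snd (snd u)) powr p)
          \<le> ennreal (2 powr p) * ennreal (mdist (input_metric T) (fst u) (snd u) powr p)"
        by (subst ennreal_mult'[symmetric]) (auto intro: ennreal_leI)
    qed simp
    also have "\<dots> = ennreal stab_const * (ennreal (2 powr p) * coupling_cost p (input_metric T) \<gamma>)"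
      unfolding case_prod_beta' by (subst nn_integral_cmult) measurable
    finally show "ennreal (wasserstein p (path_metric T) (distr M (path_borel T) X) (distr M' (path_borel T) Y) powr p)
      \<le> ennreal (stab_const * 2 powr p) * coupling_cost p (input_metric T) \<gamma>"
      using stab_const_pos by (simp add: ennreal_mult' mult.assoc del: mdist_prod_metric)
  qed
qed

section \<open>The particle system\<close>

abbreviation particles :: "nat \<Rightarrow> nat measure" where
  "particles N \<equiv> uniform_count_measure {1..N}"

lemma prob_space_particles: "N \<ge> 1 \<Longrightarrow> prob_space (particles N)"
  by (intro prob_space_uniform_count_measure) auto

text \<open>Moments under the uniform distribution on {1..N} are finite sums of finite terms,
  whatever the paths are.\<close>

lemma process_particles:
  assumes "\<And>i. i \<in> {1..N} \<Longrightarrow> x i \<in> mspace (path_metric T)"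
  shows "process (particles N) x"
  using assms
  by (auto simp: process_def measurable_uniform_count_measure nn_integral_uniform_count_measure
      sum_Inf less_top[symmetric] ennreal_mult_eq_top_iff)

lemma input_particles:
  assumes "\<And>i. i \<in> {1..N} \<Longrightarrow> w i \<in> mspace (path_metric T)"
  shows "input (particles N) z w"
  using process_particles[OF assms]
  by (auto simp: input_def measurable_uniform_count_measure nn_integral_uniform_count_measure
      sum_Inf less_top[symmetric] ennreal_mult_eq_top_iff)

text \<open>If the index is regarded as the random element, \<open>empirical\<close> is by
  definition the marginal law, so the two equations are literally the same. Almost every index means
  every index, since each has mass 1/N.\<close>

lemma particle_solution_iff:
  assumes N: "N \<ge> 1"
  shows "particle_solution T b N z w x \<longleftrightarrow>
    x \<in> {1..N} \<rightarrow>\<^sub>E mspace (path_metric T) \<and> solution (particles N) z w x"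
proof -
  have "x \<in> particles N \<rightarrow>\<^sub>M path_borel T \<and> (\<forall>t\<in>{0..T}. marginal (particles N) x t \<in> wasserstein_space p)"
    if "x \<in> {1..N} \<rightarrow>\<^sub>E mspace (path_metric T)"
  proof -
    have "process (particles N) x"
      using that by (intro process_particles) auto
    then show ?thesis
      using marginal_in_wasserstein_space[OF prob_space_particles[OF N]] process_measurable by blast
  qed
  then show ?thesis
    unfolding particle_solution_def mckean_vlasov_solution_def empirical_def
    by (auto simp: AE_uniform_count_measure)
qed

lemma particle_solution_unique:
  assumes N: "N \<ge> 1" and w: "\<And>i. i \<in> {1..N} \<Longrightarrow> w i \<in> mspace (path_metric T)"
    and x: "particle_solution T b N z w x" and y: "particle_solution T b N z w y"
  shows "x = y"
proof (rule PiE_ext)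
  show xy: "x \<in> {1..N} \<rightarrow>\<^sub>E mspace (path_metric T)" "y \<in> {1..N} \<rightarrow>\<^sub>E mspace (path_metric T)"
    using x y by (simp_all add: particle_solution_iff[OF N])
  have "AE i in particles N. x i = y i"
    using x y unfolding particle_solution_iff[OF N]
    by (intro solution_unique[OF prob_space_particles[OF N] input_particles[OF w, of N "\<lambda>i. i" z]]) auto
  then show "\<And>i. i \<in> {1..N} \<Longrightarrow> x i = y i"
    by (simp add: AE_uniform_count_measure)
qed

lemma particle_solution_exists:
  assumes N: "N \<ge> 1" and w: "\<And>i. i \<in> {1..N} \<Longrightarrow> w i \<in> mspace (path_metric T)"
  obtains x where "particle_solution T b N z w x"
proof -
  obtain x where x: "solution (particles N) z w x"
    by (rule solution_exists[OF prob_space_particles[OF N] input_particles[OF w]])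
  have xm: "x \<in> {1..N} \<rightarrow> mspace (path_metric T)"
    using x by (auto simp: mckean_vlasov_solution_def measurable_uniform_count_measure)
  \<comment> \<open>A solution on the uniform space is arbitrary outside {1..N}; the restriction
    makes it extensional, which uniqueness as a function demands.\<close>
  define x' where "x' = restrict x {1..N}"
  have "marginal (particles N) x' t = marginal (particles N) x t" for t
    by (intro distr_cong) (auto simp: x'_def space_uniform_count_measure)
  then have "solution (particles N) z w x'"
    using x unfolding mckean_vlasov_solution_def
    by (auto simp: AE_uniform_count_measure measurable_uniform_count_measure x'_def)
  moreover have "x' \<in> {1..N} \<rightarrow>\<^sub>E mspace (path_metric T)"
    using xm by (auto simp: x'_def)
  ultimately show ?thesis
    using that by (simp add: particle_solution_iff[OF N])
qed

lemma the_particle_solution: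
  assumes N: "N \<ge> 1" and w: "\<And>i. i \<in> {1..N} \<Longrightarrow> w i \<in> mspace (path_metric T)"
  shows "particle_solution T b N z w (the_particle_solution T b N z w)"
proof -
  obtain x where x: "particle_solution T b N z w x"
    by (rule particle_solution_exists[OF N w])
  show ?thesis
    unfolding the_particle_solution_def
    by (rule theI[where P = "particle_solution T b N z w", OF x])
      (rule particle_solution_unique[OF N w _ x])
qed

text \<open>One term of an average of N nonnegative terms is at most N times the average. The factor
  N is harmless, because the estimate serves only to show continuity in the inputs for fixed
  N.\<close>

lemma particle_solution_stability:
  assumes N: "N \<ge> 1" and w: "\<And>i. i \<in> {1..N} \<Longrightarrow> w i \<in> mspace (path_metric T)"
      "\<And>i. i \<in> {1..N} \<Longrightarrow> w' i \<in> mspace (path_metric T)"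
    and x: "particle_solution T b N z w x" and y: "particle_solution T b N z' w' y"
    and r: "r \<ge> 0" "\<And>i. i \<in> {1..N} \<Longrightarrow> gap (z i) (w i) (z' i) (w' i) \<le> r"
    and i: "i \<in> {1..N}"
  shows "sup_dist T (x i) (y i) powr p \<le> real N * stab_const * r powr p"
proof -
  note P = prob_space_particles[OF N]
  have gap0: "gap (z i) (w i) (z' i) (w' i) \<ge> 0" if "i \<in> {1..N}" for i
    using w[OF that] by (intro gap_nonneg) (auto simp: mspace_path_metric_iff)
  let ?s = "\<lambda>i. ennreal (sup_dist T (x i) (y i) powr p)"
  have "ennreal (1 / real N) * ?s i \<le> (\<Sum>j\<in>{1..N}. ennreal (1 / real N) * ?s j)"
    using i by (intro member_le_sum) auto
  also have "\<dots> = (\<integral>\<^sup>+j. ?s j \<partial>particles N)"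
    by (simp add: nn_integral_uniform_count_measure)
  also have "\<dots> \<le> ennreal stab_const *
      moment p (particles N) (\<lambda>j. gap (z j) (w j) (z' j) (w' j))"
    using x y by (intro solution_stability_sup P input_particles w) (simp_all add: particle_solution_iff[OF N])
  also have "\<dots> \<le> ennreal stab_const * moment p (particles N) (\<lambda>j. r)"
    using p by (intro mult_left_mono nn_integral_mono ennreal_leI powr_mono2 gap0 r)
      (auto simp: space_uniform_count_measure)
  also have "\<dots> = ennreal (stab_const * r powr p)"
    using stab_const_pos prob_space.emeasure_space_1[OF P] by (simp add: ennreal_mult')
  finally have "ennreal (1 / real N * sup_dist T (x i) (y i) powr p) \<le> ennreal (stab_const * r powr p)"
    by (subst ennreal_mult') auto
  then have "1 / real N * sup_dist T (x i) (y i) powr p \<le> stab_const * r powr p"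
    using stab_const_pos by (subst (asm) ennreal_le_iff) auto
  then show ?thesis
    using N by (simp add: field_simps)
qed

text \<open>Permits the family of inputs to be replaced by its restriction to {1..N}, an element of
  the extensional product on which continuity is stated.\<close>

lemma the_particle_solution_cong:
  assumes "\<And>i. i \<in> {1..N} \<Longrightarrow> z i = z' i" "\<And>i. i \<in> {1..N} \<Longrightarrow> w i = w' i"
  shows "the_particle_solution T b N z w = the_particle_solution T b N z' w'"
proof -
  have "particle_solution T b N z w x \<longleftrightarrow> particle_solution T b N z' w' x" for x
    using assms by (simp add: particle_solution_def)
  then show ?thesis
    by (simp add: the_particle_solution_def)
qed

text \<open>For each particle and each time, the value of the solution is a continuous function of
  the N inputs, and the inputs are measurable into a separable space.\<close>

lemma measurable_the_particle_solution:
  assumes N: "N \<ge> 1"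
    and meas: "\<And>i. i \<in> {1..N} \<Longrightarrow> \<zeta> i \<in> M \<rightarrow>\<^sub>M borel" "\<And>i. i \<in> {1..N} \<Longrightarrow> W i \<in> M \<rightarrow>\<^sub>M path_borel T"
  shows "(\<lambda>\<omega>. the_particle_solution T b N (\<lambda>i. \<zeta> i \<omega>) (\<lambda>i. W i \<omega>)) \<in> M \<rightarrow>\<^sub>M (\<Pi>\<^sub>M i\<in>{1..N}. path_borel T)"
proof (rule measurable_PiM_single')
  let ?X = "\<lambda>\<omega>. the_particle_solution T b N (\<lambda>i. \<zeta> i \<omega>) (\<lambda>i. W i \<omega>)"
  have W: "W i \<omega> \<in> mspace (path_metric T)" if "\<omega> \<in> space M" "i \<in> {1..N}" for i \<omega>
    by (rule measurable_path_borel_space[OF meas(2)[OF that(2)] that(1)])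
  have X: "?X \<omega> \<in> {1..N} \<rightarrow>\<^sub>E mspace (path_metric T)" if "\<omega> \<in> space M" for \<omega>
    using the_particle_solution[OF N W[OF that]] by (simp add: particle_solution_def)
  then show "?X \<in> space M \<rightarrow> {1..N} \<rightarrow>\<^sub>E space (path_borel T)"
    by simp
  fix i assume i: "i \<in> {1..N}"
  show "(\<lambda>\<omega>. ?X \<omega> i) \<in> M \<rightarrow>\<^sub>M path_borel T"
  proof (rule measurable_path_borelI[OF T0])
    show "?X \<omega> i \<in> mspace (path_metric T)" if "\<omega> \<in> space M" for \<omega>
      using X[OF that] i by auto
    fix t assume t: "t \<in> {0..T}"
    define S where "S e = the_particle_solution T b N (\<lambda>i. fst (e i)) (\<lambda>i. snd (e i))"
      for e :: "nat \<Rightarrow> 'a \<times> (real \<Rightarrow> 'a)"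
    have "(\<lambda>\<omega>. S (\<lambda>i\<in>{1..N}. (\<zeta> i \<omega>, W i \<omega>)) i t) \<in> borel_measurable M"
    proof (rule borel_measurable_continuous_separable[where F = "\<lambda>e. S e i t", OF separable_space_input_metric[OF T0]])
      show "(\<lambda>\<omega>. (\<zeta> i \<omega>, W i \<omega>)) \<in> M \<rightarrow>\<^sub>M input_borel" if "i \<in> {1..N}" for i
        by (rule measurable_input_pair[OF T0 meas(1)[OF that] meas(2)[OF that]])
      fix e :: "nat \<Rightarrow> 'a \<times> (real \<Rightarrow> 'a)" and \<delta> assume e: "e \<in> {1..N} \<rightarrow>\<^sub>E mspace (input_metric T)" and \<delta>: "\<delta> > (0 :: real)"
      define c where "c = real N * stab_const"
      have c: "c > 0"
        using N stab_const_pos by (simp add: c_def)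
      \<comment> \<open>Solves c r^p = (\<delta>/2)^p, so that gaps of size at most r move each
        particle by at most \<delta>/2. Inputs are taken within r/2 because
        \<open>gap_le_mdist\<close> loses a factor 2.\<close>
      define r where "r = ((\<delta> / 2) powr p / c) powr (1 / p)"
      have r: "r > 0" "c * r powr p = (\<delta> / 2) powr p"
        using c \<delta> p by (auto simp: r_def powr_powr)
      have sol: "particle_solution T b N (\<lambda>i. fst (e i)) (\<lambda>i. snd (e i)) (S e)"
        and e_path: "\<And>j. j \<in> {1..N} \<Longrightarrow> snd (e j) \<in> mspace (path_metric T)"
        if "e \<in> {1..N} \<rightarrow>\<^sub>E mspace (input_metric T)" for e :: "nat \<Rightarrow> 'a \<times> (real \<Rightarrow> 'a)"
      proof -
        have *: "snd (e j) \<in> mspace (path_metric T)" if "j \<in> {1..N}" for j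
          using PiE_mem[OF \<open>e \<in> _\<close> that] by (simp add: mem_Times_iff)
        then show "\<And>j. j \<in> {1..N} \<Longrightarrow> snd (e j) \<in> mspace (path_metric T)" .
        from * show "particle_solution T b N (\<lambda>i. fst (e i)) (\<lambda>i. snd (e i)) (S e)"
          unfolding S_def by (rule the_particle_solution[OF N])
      qed
      show "\<exists>r>0. \<forall>e'\<in>{1..N} \<rightarrow>\<^sub>E mspace (input_metric T).
          (\<forall>i\<in>{1..N}. mdist (input_metric T) (e i) (e' i) < r) \<longrightarrow> dist (S e i t) (S e' i t) < \<delta>"
      proof (intro exI[of _ "r / 2"] conjI ballI impI)
        fix e' :: "nat \<Rightarrow> 'a \<times> (real \<Rightarrow> 'a)" assume e': "e' \<in> {1..N} \<rightarrow>\<^sub>E mspace (input_metric T)"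
          and near: "\<forall>i\<in>{1..N}. mdist (input_metric T) (e i) (e' i) < r / 2"
        have gap: "gap (fst (e j)) (snd (e j)) (fst (e' j)) (snd (e' j)) \<le> r" if j: "j \<in> {1..N}" for j
          using gap_le_mdist[OF PiE_mem[OF e j] PiE_mem[OF e' j]] bspec[OF near j] by simp
        have "sup_dist T (S e i) (S e' i) powr p \<le> real N * stab_const * r powr p"
          by (rule particle_solution_stability[OF N e_path[OF e] e_path[OF e'] sol[OF e] sol[OF e'] less_imp_le[OF r(1)] gap i])
        also have "\<dots> = (\<delta> / 2) powr p"
          using r(2) by (simp only: c_def)
        finally have *: "sup_dist T (S e i) (S e' i) powr p \<le> (\<delta> / 2) powr p" .
        have "sup_dist T (S e i) (S e' i) \<le> \<delta> / 2"
          by (rule powr_le_imp_le[OF *]) (use \<delta> p in auto)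
        moreover have "norm (S e i t - S e' i t) \<le> sup_dist T (S e i) (S e' i)"
        proof (rule norm_le_sup_norm[OF _ t])
          have "S e i \<in> mspace (path_metric T)" "S e' i \<in> mspace (path_metric T)"
            by (rule PiE_mem[OF conjunct1[OF sol[OF e, unfolded particle_solution_def]] i]
                PiE_mem[OF conjunct1[OF sol[OF e', unfolded particle_solution_def]] i])+
          then show "continuous_on {0..T} (\<lambda>t. S e i t - S e' i t)"
            by (intro continuous_on_diff) (auto simp: mspace_path_metric_iff)
        qed
        ultimately show "dist (S e i t) (S e' i t) < \<delta>"
          using \<delta> by (simp add: dist_norm)
      qed (use r in simp)
    qed simp
    moreover have "S (\<lambda>i\<in>{1..N}. (\<zeta> i \<omega>, W i \<omega>)) = ?X \<omega>" for \<omega>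
      unfolding S_def by (rule the_particle_solution_cong) auto
    ultimately show "(\<lambda>\<omega>. ?X \<omega> i t) \<in> borel_measurable M"
      by simp
  qed
qed

end

theorem theorem21:
  fixes T p K\<^sub>b :: real
    and b :: "real \<Rightarrow> real ^ 'd \<Rightarrow> (real ^ 'd) measure \<Rightarrow> real ^ 'd"
  assumes T: "T > 0" and p: "p \<ge> 1"
    and b_measurable: "(\<lambda>(t, x, \<mu>). b t x \<mu>) \<in>
      restrict_space borel {0..T} \<Otimes>\<^sub>M borel \<Otimes>\<^sub>M wasserstein_borel p \<rightarrow>\<^sub>M borel"
    and b_lipschitz: "\<And>t x x' \<mu> \<mu>'. t \<in> {0..T} \<Longrightarrow>
      \<mu> \<in> wasserstein_space p \<Longrightarrow> \<mu>' \<in> wasserstein_space p \<Longrightarrow>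
      norm (b t x \<mu> - b t x' \<mu>') powr p
        \<le> K\<^sub>b * (norm (x - x') powr p + wasserstein p euclidean_metric \<mu> \<mu>' powr p)"
    and b_integrable: "set_integrable lborel {0..T} (\<lambda>t. b t 0 (return borel 0))"
  shows "\<exists>C::real. \<forall>(M :: 'w measure)
      (\<zeta> :: nat \<Rightarrow> nat \<Rightarrow> 'w \<Rightarrow> real ^ 'd) (W :: nat \<Rightarrow> nat \<Rightarrow> 'w \<Rightarrow> real \<Rightarrow> real ^ 'd)
      (\<zeta>bar :: 'w \<Rightarrow> real ^ 'd) (Wbar :: 'w \<Rightarrow> real \<Rightarrow> real ^ 'd).
    prob_space M \<longrightarrow>
    (\<forall>N\<ge>1. \<forall>i\<in>{1..N}. \<zeta> N i \<in> M \<rightarrow>\<^sub>M borel \<and> W N i \<in> M \<rightarrow>\<^sub>M path_borel T) \<longrightarrow>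
    \<zeta>bar \<in> M \<rightarrow>\<^sub>M borel \<and> integrable M (\<lambda>\<omega>. norm (\<zeta>bar \<omega>) powr p) \<longrightarrow>
    Wbar \<in> M \<rightarrow>\<^sub>M path_borel T \<and> integrable M (\<lambda>\<omega>. sup_norm T (Wbar \<omega>) powr p) \<longrightarrow>
    (let X = (\<lambda>N \<omega>. the_particle_solution T b N (\<lambda>i. \<zeta> N i \<omega>) (\<lambda>i. W N i \<omega>)) in
      (\<forall>N\<ge>1.
        (\<forall>\<omega>\<in>space M. \<exists>!x. particle_solution T b N (\<lambda>i. \<zeta> N i \<omega>) (\<lambda>i. W N i \<omega>) x) \<and>
        X N \<in> M \<rightarrow>\<^sub>M (\<Pi>\<^sub>M i\<in>{1..N}. path_borel T)) \<and>
      (\<exists>Xbar. mckean_vlasov_solution p T b M \<zeta>bar Wbar Xbar \<and>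
        (\<forall>Y. mckean_vlasov_solution p T b M \<zeta>bar Wbar Y \<longrightarrow> (AE \<omega> in M. Y \<omega> = Xbar \<omega>)) \<and>
        (\<forall>N\<ge>1. AE \<omega> in M.
          wasserstein p (path_metric T)
              (empirical (path_borel T) N (X N \<omega>)) (distr M (path_borel T) Xbar) powr p
            \<le> C * wasserstein p (input_metric T)
              (empirical (borel_metric (input_metric T)) N (\<lambda>i. (\<zeta> N i \<omega>, W N i \<omega>)))
              (distr M (borel_metric (input_metric T)) (\<lambda>\<omega>. (\<zeta>bar \<omega>, Wbar \<omega>))) powr p)))"
proof -
  \<comment> \<open>Each of the two p-th powers is at most the p-th power of the sum, which explains
    the factor 2. The absolute value is taken because no sign of \<open>K\<^sub>b\<close> is
    assumed.\<close>
  define L where "L = (2 * \<bar>K\<^sub>b\<bar>) powr (1 / p)"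
  have lip: "norm (b t x \<mu> - b t x' \<mu>') \<le> L * (norm (x - x') + wasserstein p euclidean_metric \<mu> \<mu>')"
    if "t \<in> {0..T}" "\<mu> \<in> wasserstein_space p" "\<mu>' \<in> wasserstein_space p" for t x x' \<mu> \<mu>'
  proof (rule powr_le_imp_le[of _ p])
    let ?a = "norm (x - x')" and ?w = "wasserstein p euclidean_metric \<mu> \<mu>'"
    have w: "?w \<ge> 0"
      by (rule wasserstein_nonneg)
    have "norm (b t x \<mu> - b t x' \<mu>') powr p \<le> K\<^sub>b * (?a powr p + ?w powr p)"
      by (rule b_lipschitz[OF that])
    also have "\<dots> \<le> \<bar>K\<^sub>b\<bar> * ((?a + ?w) powr p + (?a + ?w) powr p)"
      using w p by (intro mult_mono add_mono powr_mono2) auto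
    also have "\<dots> = (L * (?a + ?w)) powr p"
      using w p by (simp add: L_def powr_mult powr_powr)
    finally show "norm (b t x \<mu> - b t x' \<mu>') powr p \<le> (L * (?a + ?w)) powr p" .
  qed (use p wasserstein_nonneg[of p euclidean_metric \<mu> \<mu>'] in \<open>auto simp: L_def\<close>)
  interpret lipschitz_drift T p L b
  proof
    show "L \<ge> 0"
      by (simp add: L_def)
  qed (use T p b_measurable lip b_integrable in auto)
  show ?thesis
  \<comment> \<open>The constant is fixed before the probability space, the inputs and N are
    introduced, so the estimate is uniform in all of them.\<close>
  proof (intro exI[of _ "stab_const * 2 powr p"] allI impI)
    fix M :: "'w measure" and \<zeta> :: "nat \<Rightarrow> nat \<Rightarrow> 'w \<Rightarrow> real ^ 'd" and W :: "nat \<Rightarrow> nat \<Rightarrow> 'w \<Rightarrow> real \<Rightarrow> real ^ 'd"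
      and \<zeta>bar :: "'w \<Rightarrow> real ^ 'd" and Wbar :: "'w \<Rightarrow> real \<Rightarrow> real ^ 'd"
    assume M: "prob_space M"
      and meas: "\<forall>N\<ge>1. \<forall>i\<in>{1..N}. \<zeta> N i \<in> M \<rightarrow>\<^sub>M borel \<and> W N i \<in> M \<rightarrow>\<^sub>M path_borel T"
      and \<zeta>bar: "\<zeta>bar \<in> M \<rightarrow>\<^sub>M borel \<and> integrable M (\<lambda>\<omega>. norm (\<zeta>bar \<omega>) powr p)"
      and Wbar: "Wbar \<in> M \<rightarrow>\<^sub>M path_borel T \<and> integrable M (\<lambda>\<omega>. sup_norm T (Wbar \<omega>) powr p)"
    have m: "\<zeta> N i \<in> M \<rightarrow>\<^sub>M borel" "W N i \<in> M \<rightarrow>\<^sub>M path_borel T" if "N \<ge> 1" "i \<in> {1..N}" for N i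
      using meas that by blast+
    have W: "W N i \<omega> \<in> mspace (path_metric T)" if "\<omega> \<in> space M" "N \<ge> 1" "i \<in> {1..N}" for N i \<omega>
      by (rule measurable_path_borel_space[OF m(2)[OF that(2,3)] that(1)])
    have bar: "input M \<zeta>bar Wbar"
      using \<zeta>bar Wbar by (auto simp: input_def process_def integrable_iff_bounded)
    obtain Xbar where Xbar: "solution M \<zeta>bar Wbar Xbar"
      by (rule solution_exists[OF M bar])
    define X where "X N \<omega> = the_particle_solution T b N (\<lambda>i. \<zeta> N i \<omega>) (\<lambda>i. W N i \<omega>)" for N \<omega>
    have X: "particle_solution T b N (\<lambda>i. \<zeta> N i \<omega>) (\<lambda>i. W N i \<omega>) (X N \<omega>)"
      if "\<omega> \<in> space M" "N \<ge> 1" for N \<omega>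
      unfolding X_def by (rule the_particle_solution[OF that(2) W[OF that]])
    have unique: "\<exists>!x. particle_solution T b N (\<lambda>i. \<zeta> N i \<omega>) (\<lambda>i. W N i \<omega>) x"
      if "\<omega> \<in> space M" "N \<ge> 1" for N \<omega>
      by (rule ex1I[of _ "X N \<omega>"], rule X[OF that])
        (rule particle_solution_unique[OF that(2) W[OF that] _ X[OF that]])
    have X_meas: "X N \<in> M \<rightarrow>\<^sub>M (\<Pi>\<^sub>M i\<in>{1..N}. path_borel T)" if "N \<ge> 1" for N
      unfolding X_def by (rule measurable_the_particle_solution[OF that m[OF that]])
    \<comment> \<open>Unfolding \<open>empirical\<close> exhibits both empirical measures as laws on
      \<open>particles N\<close>, so the stability estimate applies between this space and
      \<open>M\<close>. It holds for every \<omega>, hence almost surely.\<close>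
    have bound: "wasserstein p (path_metric T) (empirical (path_borel T) N (X N \<omega>)) (distr M (path_borel T) Xbar) powr p
        \<le> stab_const * 2 powr p * wasserstein p (input_metric T)
          (empirical input_borel N (\<lambda>i. (\<zeta> N i \<omega>, W N i \<omega>)))
          (distr M input_borel (\<lambda>\<omega>. (\<zeta>bar \<omega>, Wbar \<omega>))) powr p"
      if "\<omega> \<in> space M" "N \<ge> 1" for N \<omega>
      unfolding empirical_def
      using X[OF that] unfolding particle_solution_iff[OF that(2)]
      by (intro wasserstein_stability prob_space_particles that M input_particles W bar Xbar) auto
    show "let X = (\<lambda>N \<omega>. the_particle_solution T b N (\<lambda>i. \<zeta> N i \<omega>) (\<lambda>i. W N i \<omega>)) in
      (\<forall>N\<ge>1.
        (\<forall>\<omega>\<in>space M. \<exists>!x. particle_solution T b N (\<lambda>i. \<zeta> N i \<omega>) (\<lambda>i. W N i \<omega>) x) \<and>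
        X N \<in> M \<rightarrow>\<^sub>M (\<Pi>\<^sub>M i\<in>{1..N}. path_borel T)) \<and>
      (\<exists>Xbar. mckean_vlasov_solution p T b M \<zeta>bar Wbar Xbar \<and>
        (\<forall>Y. mckean_vlasov_solution p T b M \<zeta>bar Wbar Y \<longrightarrow> (AE \<omega> in M. Y \<omega> = Xbar \<omega>)) \<and>
        (\<forall>N\<ge>1. AE \<omega> in M.
          wasserstein p (path_metric T)
              (empirical (path_borel T) N (X N \<omega>)) (distr M (path_borel T) Xbar) powr p
            \<le> stab_const * 2 powr p * wasserstein p (input_metric T)
              (empirical (borel_metric (input_metric T)) N (\<lambda>i. (\<zeta> N i \<omega>, W N i \<omega>)))
              (distr M (borel_metric (input_metric T)) (\<lambda>\<omega>. (\<zeta>bar \<omega>, Wbar \<omega>))) powr p))"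
      unfolding Let_def X_def[symmetric]
    proof (intro conjI allI impI ballI exI[of _ Xbar])
      show "AE \<omega> in M. Y \<omega> = Xbar \<omega>" if "solution M \<zeta>bar Wbar Y" for Y
        by (rule solution_unique[OF M bar that Xbar])
    qed (assumption | rule unique X_meas Xbar AE_I2 bound)+
  qed
qed

end
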